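(* Let $m,n\ge 3$, let $G$ and $H$ be graphs on $n$ and $m$ vertices respectively, with no isolated vertices, and let $F$ be any field. Then the following hold. (1) Let $c_G$ and $c_H$ be the numbers of connected components of $G$ and $H$ respectively. Then $$(n-c_G)(m-c_H)\le \ell(J_{G,H})\le mn.$$ The lower bound is achieved (i.e. $\ell(J_{G,H})=(n-c_G)(m-c_H)$) for every pair of forests $(G,H)$. The upper bound is achieved (i.e. $\ell(J_{G,H})=mn$) for every pair of complete graphs $(G,H)=(K_n,K_m)$. (2) When $G$ is the path on $n$ vertices and $H$ is a unicycle graph (on $m$ vertices), $$\ell(J_{G,H})=(n-1)m\ (=|E(G)||E(H)|).$$
   Context: Graphs are finite and simple. A forest is a graph all of whose connected components are trees. A unicycle graph is a connected graph with exactly one induced cycle. Binomial edge ideal of a pair: for graphs $G$ on $[n]$ and $H$ on $[m]$, in $S=F[x_{i,j}\mid 1\le i\le n,1\le j\le m]$ let $J_{G,H}$ be the ideal generated by the binomials $x_{i,k}x_{j,l}-x_{i,l}x_{j,k}$ for all $\{i,j\}\in E(G)$, $i<j$, and $\{k,l\}\in E(H)$, $k<l$. Analytic spread: for an ideal $I\subset S$ with graded maximal ideal $\mathfrak m=(x_{i,j})$, $\ell(I)$ is the Krull dimension of the special fiber ring $\bigoplus_{k\ge0} I^k/\mathfrak m I^k$. *)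

theory Defs
  imports
    "HOL-Library.Poly_Mapping"
    "HOL-Library.Extended_Nat"
    "HOL-Algebra.QuotRing"
    "HOL-Algebra.Ideal_Product"
    "Graph_Theory.Graph_Theory"
begin

section \<open>Graphs\<close>

text \<open>
  A finite simple graph is a \<^locale>\<open>pair_graph\<close>, in which an edge \<open>{u, v}\<close> is the pair of
  arcs \<open>(u, v)\<close>, \<open>(v, u)\<close>.  In a symmetric digraph the strongly connected components are the
  connected components.
\<close>

definition num_components :: "'a pair_pre_digraph \<Rightarrow> nat"
  where "num_components G = card (pre_digraph.sccs (with_proj G))"

definition num_edges :: "'a pair_pre_digraph \<Rightarrow> nat"
  where "num_edges G = card {{u, v} | u v. (u, v) \<in> parcs G}"

definition no_isolated_vertices :: "'a pair_pre_digraph \<Rightarrow> bool"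
  where "no_isolated_vertices G \<longleftrightarrow> (\<forall>u \<in> pverts G. \<exists>v. (u, v) \<in> parcs G)"

definition is_path_graph :: "('a, 'b) pre_digraph \<Rightarrow> bool"
  where "is_path_graph G \<longleftrightarrow>
    (\<exists>vs. vs \<noteq> [] \<and> distinct vs \<and> verts G = set vs \<and>
      arcs_ends G = (\<Union>i \<in> {i. Suc i < length vs}. {(vs ! i, vs ! Suc i), (vs ! Suc i, vs ! i)}))"

definition is_cycle_graph :: "('a, 'b) pre_digraph \<Rightarrow> bool"
  where "is_cycle_graph G \<longleftrightarrow>
    (\<exists>vs. length vs \<ge> 3 \<and> distinct vs \<and> verts G = set vs \<and>
      arcs_ends G = (\<Union>i < length vs. {(vs ! i, vs ! (Suc i mod length vs)),
                                     (vs ! (Suc i mod length vs), vs ! i)}))"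

text \<open>
  The constants \<^const>\<open>tree\<close> and \<^const>\<open>forest\<close> of the graph library are about directed graphs:
  there the arcs \<open>(u, v)\<close>, \<open>(v, u)\<close> already form a cycle.
\<close>

definition is_tree :: "('a, 'b) pre_digraph \<Rightarrow> bool"
  where "is_tree G \<longleftrightarrow> Digraph_Component.connected G \<and> \<not> (\<exists>C. subgraph C G \<and> is_cycle_graph C)"

definition is_forest :: "('a, 'b) pre_digraph \<Rightarrow> bool"
  where "is_forest G \<longleftrightarrow> (\<forall>C \<in> pre_digraph.sccs G. is_tree C)"

definition is_unicycle :: "('a, 'b) pre_digraph \<Rightarrow> bool"
  where "is_unicycle G \<longleftrightarrow>
    Digraph_Component.connected G \<and> (\<exists>!C. induced_subgraph C G \<and> is_cycle_graph C)"


section \<open>Krull dimension and analytic spread\<close>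

definition krull_dim :: "('a, 'b) ring_scheme \<Rightarrow> enat"
  where "krull_dim R = Sup {enat d | d.
    \<exists>P :: nat \<Rightarrow> 'a set. (\<forall>i \<le> d. primeideal (P i) R) \<and> (\<forall>i < d. P i \<subset> P (Suc i))}"

definition ideal_power :: "('a, 'b) ring_scheme \<Rightarrow> 'a set \<Rightarrow> nat \<Rightarrow> 'a set"
  where "ideal_power R I k = I [^]\<^bsub>ideals_set R\<^esub> k"

text \<open>
  The special fiber ring \<open>\<Oplus>\<^sub>k I\<^sup>k / M I\<^sup>k\<close>.  An element is a finitely supported family whose \<open>k\<close>-th
  entry is a coset of \<open>M I\<^sup>k\<close> in \<open>I\<^sup>k\<close>, regarded as an element of \<open>R / M I\<^sup>k\<close>.  The product of
  \<open>a + M I\<^sup>i\<close> and \<open>b + M I\<^sup>j\<close> is \<open>a b + M I\<^sup>i\<^sup>+\<^sup>j\<close>.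
\<close>

definition special_fiber_ring ::
    "('a, 'b) ring_scheme \<Rightarrow> 'a set \<Rightarrow> 'a set \<Rightarrow> (nat \<Rightarrow> 'a set) ring"
  where "special_fiber_ring R M I =
    (let N = (\<lambda>k. ideal_prod R M (ideal_power R I k)) in
      \<lparr>carrier = {f. (\<forall>k. f k \<in> (\<lambda>a. N k +>\<^bsub>R\<^esub> a) ` ideal_power R I k) \<and> finite {k. f k \<noteq> N k}},
       monoid.mult = (\<lambda>f g k. \<Oplus>\<^bsub>R Quot N k\<^esub>i \<in> {..k}. rcoset_mult R (N k) (f i) (g (k - i))),
       one = (\<lambda>k. if k = 0 then N 0 +>\<^bsub>R\<^esub> \<one>\<^bsub>R\<^esub> else N k),
       zero = N,
       add = (\<lambda>f g k. f k <+>\<^bsub>R\<^esub> g k)\<rparr>)"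


section \<open>Polynomial rings and binomial edge ideals\<close>

text \<open>Polynomials in variables from the type \<open>'v\<close>, as finitely supported maps from exponents.\<close>

type_synonym ('v, 'k) mpoly = "('v \<Rightarrow>\<^sub>0 nat) \<Rightarrow>\<^sub>0 'k"

definition mvar :: "'v \<Rightarrow> ('v, 'k::field) mpoly"
  where "mvar v = Poly_Mapping.single (Poly_Mapping.single v 1) 1"

definition mpoly_ring :: "'v set \<Rightarrow> ('v, 'k::field) mpoly ring"
  where "mpoly_ring V =
    \<lparr>carrier = {p. \<forall>t \<in> Poly_Mapping.keys p. Poly_Mapping.keys t \<subseteq> V},
     monoid.mult = (*), one = 1, zero = 0, add = (+)\<rparr>"

definition graded_maximal_ideal :: "'v set \<Rightarrow> ('v, 'k::field) mpoly set"
  where "graded_maximal_ideal V = Idl\<^bsub>mpoly_ring V\<^esub> (mvar ` V)"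

definition analytic_spread :: "'v set \<Rightarrow> ('v, 'k::field) mpoly set \<Rightarrow> enat"
  where "analytic_spread V I =
    krull_dim (special_fiber_ring (mpoly_ring V) (graded_maximal_ideal V) I)"

definition binomial_edge_ideal ::
    "nat pair_pre_digraph \<Rightarrow> nat pair_pre_digraph \<Rightarrow> (nat \<times> nat, 'k::field) mpoly set"
  where "binomial_edge_ideal G H = Idl\<^bsub>mpoly_ring (pverts G \<times> pverts H)\<^esub>
    {mvar (i, k) * mvar (j, l) - mvar (i, l) * mvar (j, k) | i j k l.
      (i, j) \<in> parcs G \<and> i < j \<and> (k, l) \<in> parcs H \<and> k < l}"

end

(*
All edge binomials f_1, ..., f_N have the same degree, so the special fiber ring is the subalgebra
F[f_1, ..., f_N] of the polynomial ring, that is, B / K for B = F[z_1, ..., z_N] and K the ideal of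
relations, and its dimension is the transcendence degree.

Upper bounds: going down a chain of primes, any element of Q - P extends a family that is
algebraically independent modulo Q to one that is independent modulo P.  So a chain of length d above
K gives d independent elements of F[f_1, ..., f_N], and counting monomials shows that d is at most
the number of variables and at most N.

Lower bounds: let P be a prime of B and Y a maximal set of variables with P meeting F[Y] only in 0.
Some s in F[Y] makes B / P, up to powers of s, a submodule of a free F[Y]-module of finite rank that
has 1 in its basis.  For y in Y the ideal P + (1 + y s) then contains no nonzero element of
F[Y - {y}], hence lies in a prime with the same property.  Iterating gives a chain of length |Y|.

Finally, binomials are algebraically independent as soon as a weight on the variables selects one
term of each such that the exponents of the selected terms are linearly independent.
*)

theory Submission
  imports Defs "HOL-Library.Product_Lexorder"
begin

section \<open>Polynomials and weights\<close>

text \<open>For a weight of product form \<open>w (i, k) = a i * b k\<close> the two terms of the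
  binomial of edges \<open>{i, j}\<close> and \<open>{k, l}\<close> differ in weight by
  \<open>(a i - a j) * (b k - b l)\<close>. So potentials on the two vertex sets orient the edges,
  and the selected term joins the two higher ends and the two lower ends. The selected terms are
  then edges of a graph on the variables, and their independence is a question about this graph: a
  forest is enough. A forest with \<open>m n\<close> vertices has fewer than \<open>m n\<close>
  edges, so complete graphs need an odd cycle. Moreover a product weight never selects a variable in
  the row of largest \<open>a\<close> and the column of smallest \<open>b\<close>; since all
  variables must occur, complete graphs use another weight.

  In the construction of primes, adjoining \<open>y\<close> itself would fail, since B / P need not
  be integral over F[Y]: for \<open>P = (x y - z)\<close> and \<open>Y = {y, z}\<close> the ideal
  \<open>P + (y)\<close> contains \<open>z\<close>. Modulo \<open>1 + y s\<close> the denominators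
  \<open>s\<close> are units, so being free up to powers of \<open>s\<close> is as good as being
  free.\<close>

abbreviation keys :: "('a \<Rightarrow>\<^sub>0 'b::zero) \<Rightarrow> 'a set"
  where "keys \<equiv> Poly_Mapping.keys"

abbreviation lookup :: "('a \<Rightarrow>\<^sub>0 'b::zero) \<Rightarrow> 'a \<Rightarrow> 'b"
  where "lookup \<equiv> Poly_Mapping.lookup"

abbreviation single :: "'a \<Rightarrow> 'b::zero \<Rightarrow> 'a \<Rightarrow>\<^sub>0 'b"
  where "single \<equiv> Poly_Mapping.single"

abbreviation const :: "'k::zero \<Rightarrow> ('v, 'k) mpoly"
  where "const c \<equiv> single 0 c"

definition poly_in :: "'v set \<Rightarrow> ('v, 'k::zero) mpoly set"
  where "poly_in V = {p. \<forall>t \<in> keys p. keys t \<subseteq> V}"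

section \<open>Weights of exponents; weight 1 on every variable gives the degree\<close>

definition weight :: "('v \<Rightarrow> nat) \<Rightarrow> ('v \<Rightarrow>\<^sub>0 nat) \<Rightarrow> nat"
  where "weight w t = (\<Sum>v \<in> keys t. w v * lookup t v)"

lemma weight_superset:
  assumes "finite A" "keys t \<subseteq> A"
  shows "weight w t = (\<Sum>v\<in>A. w v * lookup t v)"
  unfolding weight_def using assms by (intro sum.mono_neutral_left) (auto simp: in_keys_iff)

lemma weight_0 [simp]: "weight w 0 = 0"
  by (simp add: weight_def)

lemma weight_single [simp]: "weight w (single v n) = w v * n"
  by (simp add: weight_def)

lemma weight_add: "weight w (s + t) = weight w s + weight w t"
proof -
  let ?A = "keys s \<union> keys t"
  have "keys (s + t) \<subseteq> ?A" by (rule keys_add)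
  then show ?thesis
    using weight_superset[of ?A "s + t" w] weight_superset[of ?A s w] weight_superset[of ?A t w]
    by (simp add: lookup_add distrib_left sum.distrib)
qed

lemma exponent_induct [consumes 1, case_names zero add]:
  assumes "keys t \<subseteq> V" "P 0"
    and "\<And>v t. v \<in> V \<Longrightarrow> keys t \<subseteq> V \<Longrightarrow> P t \<Longrightarrow> P (single v 1 + t)"
  shows "P (t :: 'v \<Rightarrow>\<^sub>0 nat)"
  using assms(1)
proof (induction "weight (\<lambda>_. 1) t" arbitrary: t rule: less_induct)
  case less
  show ?case
  proof (cases "t = 0")
    case True
    then show ?thesis using assms(2) by simp
  next
    case False
    then obtain v where v: "v \<in> keys t"
      by (metis keys_eq_empty all_not_in_conv)
    define s where "s = t - single v 1"
    have t: "t = single v 1 + s"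
      using v by (intro poly_mapping_eqI)
        (auto simp: s_def lookup_add lookup_minus lookup_single when_def in_keys_iff)
    have "keys s \<subseteq> V"
      using less.prems by (auto simp: s_def in_keys_iff lookup_minus subset_iff)
    moreover have "weight (\<lambda>_. 1) s < weight (\<lambda>_. 1) t" by (simp add: t weight_add)
    ultimately have "P s" using less.hyps by blast
    then show ?thesis
      unfolding t using assms(3) v less.prems \<open>keys s \<subseteq> V\<close> by blast
  qed
qed

lemma poly_eq_sum_single:
  fixes p :: "'a \<Rightarrow>\<^sub>0 'b::comm_monoid_add"
  assumes "finite A" "keys p \<subseteq> A"
  shows "p = (\<Sum>t\<in>A. single t (lookup p t))"
proof (rule poly_mapping_eqI)
  fix s
  show "lookup p s =
      lookup (\<Sum>t\<in>A. single t (lookup p t)) s"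
    using assms by (auto simp: lookup_sum lookup_single when_def in_keys_iff subset_iff)
qed

lemma poly_in_single_induct [consumes 1, case_names zero single add]:
  fixes p :: "('v, 'k::comm_monoid_add) mpoly"
  assumes "p \<in> poly_in V" "P 0"
    and "\<And>t c. keys t \<subseteq> V \<Longrightarrow> P (single t c)"
    and "\<And>p q. P p \<Longrightarrow> P q \<Longrightarrow> P (p + q)"
  shows "P p"
proof -
  have "P (\<Sum>t\<in>A. single t (lookup p t))"
    if "finite A" "A \<subseteq> keys p" for A
    using that
  proof (induction rule: finite_induct)
    case (insert x F)
    then show ?case using assms(1,3,4) by (auto simp: poly_in_def)
  qed (simp add: assms)
  from this[of "keys p"] show ?thesis
    using poly_eq_sum_single[of "keys p" p] by simp
qed

lemma poly_in_UNIV [simp]: "poly_in UNIV = UNIV"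
  by (simp add: poly_in_def)

lemmas poly_single_induct = poly_in_single_induct[where V = UNIV, simplified, case_names zero single add]

lemma poly_in_mono: "V \<subseteq> W \<Longrightarrow> p \<in> poly_in V \<Longrightarrow> p \<in> poly_in W"
  by (auto simp: poly_in_def)

lemma mvar_times_single:
  "mvar v * single t c = single (single v 1 + t) (c::'k::field)"
  by (simp add: mvar_def mult_single)

lemma poly_in_induct [consumes 1, case_names const add mult]:
  fixes p :: "('v, 'k::field) mpoly"
  assumes "p \<in> poly_in V" "\<And>c. P (const c)"
    and "\<And>p q. P p \<Longrightarrow> P q \<Longrightarrow> P (p + q)"
    and "\<And>v p. v \<in> V \<Longrightarrow> P p \<Longrightarrow> P (mvar v * p)"
  shows "P p"
  using assms(1)
proof (induction rule: poly_in_single_induct)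
  case zero
  then show ?case using assms(2)[of 0] by simp
next
  case (single t c)
  then show ?case
  proof (induction t rule: exponent_induct)
    case zero
    then show ?case using assms(2)[of c] by simp
  next
    case (add v t)
    then show ?case using assms(4) by (metis mvar_times_single)
  qed
qed (rule assms(3))

lemma poly_in_0 [simp]: "0 \<in> poly_in V" and poly_in_1 [simp]: "1 \<in> poly_in V"
  by (auto simp: poly_in_def)

lemma poly_in_mvar [simp]: "mvar v \<in> poly_in V \<longleftrightarrow> v \<in> V"
  by (auto simp: poly_in_def mvar_def)

lemma poly_in_single [simp]:
  "single t c \<in> poly_in V \<longleftrightarrow> c = 0 \<or> keys t \<subseteq> V"
  by (auto simp: poly_in_def)

lemma poly_in_add [intro]: "p \<in> poly_in V \<Longrightarrow> q \<in> poly_in V \<Longrightarrow> p + q \<in> poly_in V"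
  using keys_add[of p q] by (auto simp: poly_in_def)

lemma poly_in_mult [intro]:
  fixes p :: "('v, 'k::comm_ring_1) mpoly"
  shows "p \<in> poly_in V \<Longrightarrow> q \<in> poly_in V \<Longrightarrow> p * q \<in> poly_in V"
proof -
  assume *: "p \<in> poly_in V" "q \<in> poly_in V"
  show ?thesis unfolding poly_in_def
  proof clarify
    fix t v assume "t \<in> keys (p * q)" "v \<in> keys t"
    then obtain a b where "t = a + b" "a \<in> keys p" "b \<in> keys q"
      using keys_mult[of p q] by auto
    then show "v \<in> V"
      using \<open>v \<in> _\<close> * keys_add[of a b] by (fastforce simp: poly_in_def)
  qed
qed

lemma poly_in_uminus [intro]: "(p::('v, 'k::comm_ring_1) mpoly) \<in> poly_in V \<Longrightarrow> - p \<in> poly_in V"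
  by (simp add: poly_in_def in_keys_iff)

lemma poly_in_diff [intro]:
  "(p::('v, 'k::comm_ring_1) mpoly) \<in> poly_in V \<Longrightarrow> q \<in> poly_in V \<Longrightarrow> p - q \<in> poly_in V"
  using poly_in_add[of p V "-q"] by auto

lemma poly_in_sum [intro]: "(\<And>a. a \<in> A \<Longrightarrow> f a \<in> poly_in V) \<Longrightarrow> sum f A \<in> poly_in V"
  by (induction A rule: infinite_finite_induct) auto

lemma poly_in_prod [intro]:
  fixes f :: "'a \<Rightarrow> ('v, 'k::comm_ring_1) mpoly"
  shows "(\<And>a. a \<in> A \<Longrightarrow> f a \<in> poly_in V) \<Longrightarrow> prod f A \<in> poly_in V"
  by (induction A rule: infinite_finite_induct) auto

lemma poly_in_power [intro]:
  fixes p :: "('v, 'k::comm_ring_1) mpoly"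
  shows "p \<in> poly_in V \<Longrightarrow> p ^ n \<in> poly_in V"
  by (induction n) auto

section \<open>Substituting polynomials for the variables\<close>

definition monom_val :: "('v \<Rightarrow> 'r::comm_monoid_mult) \<Rightarrow> ('v \<Rightarrow>\<^sub>0 nat) \<Rightarrow> 'r"
  where "monom_val f t = (\<Prod>v \<in> keys t. f v ^ lookup t v)"

lemma monom_val_superset:
  assumes "finite A" "keys t \<subseteq> A"
  shows "monom_val f t = (\<Prod>v\<in>A. f v ^ lookup t v)"
  unfolding monom_val_def using assms by (intro prod.mono_neutral_left) (auto simp: in_keys_iff)

lemma monom_val_0 [simp]: "monom_val f 0 = 1"
  by (simp add: monom_val_def)

lemma monom_val_single [simp]: "monom_val f (single v n) = f v ^ n"
  by (simp add: monom_val_def)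

lemma monom_val_add: "monom_val f (s + t) = monom_val f s * monom_val f t"
proof -
  let ?A = "keys s \<union> keys t"
  have "keys (s + t) \<subseteq> ?A" by (rule keys_add)
  then show ?thesis
    using monom_val_superset[of ?A "s + t" f] monom_val_superset[of ?A s f] monom_val_superset[of ?A t f]
    by (simp add: lookup_add power_add prod.distrib)
qed

definition eval_poly :: "('v \<Rightarrow> ('w, 'k::field) mpoly) \<Rightarrow> ('v, 'k) mpoly \<Rightarrow> ('w, 'k) mpoly"
  where "eval_poly f p =
    (\<Sum>t \<in> keys p. const (lookup p t) * monom_val f t)"

lemma eval_poly_superset:
  assumes "finite A" "keys p \<subseteq> A"
  shows "eval_poly f p = (\<Sum>t\<in>A. const (lookup p t) * monom_val f t)"
  unfolding eval_poly_def using assms by (intro sum.mono_neutral_left) (auto simp: in_keys_iff)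

lemma eval_poly_single: "eval_poly f (single t c) = const c * monom_val f t"
  by (auto simp: eval_poly_def)

lemma eval_poly_const [simp]: "eval_poly f (const c) = const c"
  by (simp add: eval_poly_single)

lemma eval_poly_0 [simp]: "eval_poly f 0 = 0" and eval_poly_1 [simp]: "eval_poly f 1 = 1"
  using eval_poly_const[of f 0] eval_poly_const[of f 1] by simp_all

lemma eval_poly_mvar [simp]: "eval_poly f (mvar v) = f v"
  by (simp add: mvar_def eval_poly_single)

lemma eval_poly_add [simp]: "eval_poly f (p + q) = eval_poly f p + eval_poly f q"
proof -
  let ?A = "keys p \<union> keys q"
  have "keys (p + q) \<subseteq> ?A" by (rule keys_add)
  then show ?thesis
    using eval_poly_superset[of ?A "p + q" f] eval_poly_superset[of ?A p f] eval_poly_superset[of ?A q f]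
    by (simp add: lookup_add single_add distrib_right sum.distrib)
qed

lemma eval_poly_uminus [simp]: "eval_poly f (- p) = - eval_poly f p"
  using eval_poly_add[of f p "- p"] by (simp add: add_eq_0_iff)

lemma eval_poly_mult [simp]: "eval_poly f (p * q) = eval_poly f p * eval_poly f q"
proof (induction p rule: poly_single_induct)
  case (single s c)
  show ?case
  proof (induction q rule: poly_single_induct)
    case (single t d)
    have "eval_poly f (single s c * single t d) =
        (const c * const d) * (monom_val f s * monom_val f t)"
      by (simp add: mult_single eval_poly_single monom_val_add)
    then show ?case by (simp only: eval_poly_single ac_simps)
  qed (auto simp: distrib_left)
qed (auto simp: distrib_right)

lemma eval_poly_sum: "eval_poly f (sum g A) = (\<Sum>a\<in>A. eval_poly f (g a))"
  by (induction A rule: infinite_finite_induct) auto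

lemma eval_poly_power [simp]: "eval_poly f (p ^ n) = eval_poly f p ^ n"
  by (induction n) auto

lemma eval_poly_cong:
  assumes "p \<in> poly_in V" "\<And>v. v \<in> V \<Longrightarrow> f v = g v"
  shows "eval_poly f p = eval_poly g p"
  using assms(1) by (induction rule: poly_in_induct) (auto simp: assms(2))

lemma eval_poly_eval_poly: "eval_poly f (eval_poly g p) = eval_poly (\<lambda>v. eval_poly f (g v)) p"
  by (induction p rule: poly_in_induct[where V = UNIV, simplified]) auto

lemma eval_poly_in:
  assumes "p \<in> poly_in V" "\<And>v. v \<in> V \<Longrightarrow> f v \<in> poly_in W"
  shows "eval_poly f p \<in> poly_in W"
  using assms(1) by (induction rule: poly_in_induct) (auto simp: assms(2))

section \<open>Graded components for an additive function on exponents, either the degree or a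
  weight\<close>

definition component :: "(('v \<Rightarrow>\<^sub>0 nat) \<Rightarrow> nat) \<Rightarrow> nat \<Rightarrow> ('v, 'k::zero) mpoly \<Rightarrow> ('v, 'k) mpoly"
  where "component h k p = Poly_Mapping.mapp (\<lambda>t c. c when h t = k) p"

lemma lookup_component: "lookup (component h k p) t = (lookup p t when h t = k)"
  by (auto simp: component_def lookup_mapp when_def in_keys_iff)

lemma component_0 [simp]: "component h k 0 = 0"
  by (rule poly_mapping_eqI) (simp add: lookup_component)

lemma component_add: "component h k (p + q) = component h k p + component h k q"
  by (rule poly_mapping_eqI) (simp add: lookup_component lookup_add when_def)

lemma component_uminus: "component h k (- p) = - component h k (p :: ('v, 'k::ab_group_add) mpoly)"
  by (rule poly_mapping_eqI) (simp add: lookup_component when_def)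

lemma component_diff:
  "component h k (p - q) = component h k p - component h k (q :: ('v, 'k::ab_group_add) mpoly)"
  by (rule poly_mapping_eqI) (simp add: lookup_component lookup_minus when_def)

lemma component_sum: "component h k (sum f A) = (\<Sum>a\<in>A. component h k (f a))"
  by (induction A rule: infinite_finite_induct) (auto simp: component_add)

lemma component_single:
  "component h k (single t c) = (if h t = k then single t c else 0)"
  by (rule poly_mapping_eqI) (auto simp: lookup_component lookup_single when_def)

lemma component_component: "component h k (component h l p) = (if k = l then component h k p else 0)"
  by (rule poly_mapping_eqI) (auto simp: lookup_component when_def)

lemma keys_component: "keys (component h k p) = {t \<in> keys p. h t = k}"
  by (auto simp: in_keys_iff lookup_component when_def split: if_splits)

lemma sum_component:
  assumes "finite A" "h ` keys p \<subseteq> A"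
  shows "(\<Sum>k\<in>A. component h k p) = p"
proof (rule poly_mapping_eqI)
  fix t
  have "lookup p t = 0" if "h t \<notin> A"
    using that assms(2) in_keys_iff[of t p] by blast
  then show "lookup (\<Sum>k\<in>A. component h k p) t = lookup p t"
    using assms(1) by (auto simp: lookup_sum lookup_component when_def)
qed

lemma component_mult:
  fixes p q :: "('v, 'k::comm_ring_1) mpoly"
  assumes h: "\<And>s t. h (s + t) = h s + h t"
  shows "component h k (p * q) = (\<Sum>i\<le>k. component h i p * component h (k - i) q)"
proof (induction p rule: poly_single_induct)
  case (single s c)
  show ?case
  proof (induction q rule: poly_single_induct)
    case (single t d)
    have *: "component h i (single s c) * component h (k - i) (single t d) =
        (if i = h s then (if h s + h t = k then single (s + t) (c * d) else 0) else 0)"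
      if "i \<le> k" for i
      using that by (auto simp: component_single mult_single)
    have "(\<Sum>i\<le>k. component h i (single s c) * component h (k - i) (single t d)) =
        (\<Sum>i\<le>k. if i = h s then (if h s + h t = k then single (s + t) (c * d) else 0) else 0)"
      using * by (intro sum.cong) auto
    also have "\<dots> = (if h s + h t = k then single (s + t) (c * d) else 0)" by auto
    finally have "(\<Sum>i\<le>k. component h i (single s c) * component h (k - i) (single t d)) =
        (if h s + h t = k then single (s + t) (c * d) else 0)" .
    then show ?case by (simp add: mult_single component_single h)
  qed (auto simp: distrib_left component_add sum.distrib)
qed (auto simp: distrib_right component_add sum.distrib)

text \<open>The top part \<open>p'\<close> may be zero. This makes \<open>tops\<close>
  multiplicative over every commutative ring, and nonvanishing is checked only once, on the final
  coefficient.\<close>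

definition tops :: "(('v \<Rightarrow>\<^sub>0 nat) \<Rightarrow> nat) \<Rightarrow> nat \<Rightarrow> ('v, 'k::zero) mpoly \<Rightarrow> ('v, 'k) mpoly \<Rightarrow> bool"
  where "tops h k p p' \<longleftrightarrow> component h k p = p' \<and> (\<forall>i>k. component h i p = 0)"

lemma tops_mult:
  fixes p q :: "('v, 'k::comm_ring_1) mpoly"
  assumes h: "\<And>s t. h (s + t) = h s + h t" and "tops h a p p'" "tops h b q q'"
  shows "tops h (a + b) (p * q) (p' * q')"
proof -
  have *: "component h i p * component h (k - i) q =
      (if i = a \<and> k = a + b then p' * q' else 0)" if "k \<ge> a + b" "i \<le> k" for i k
  proof -
    consider "i > a" | "k - i > b" | "i = a \<and> k = a + b" using \<open>k \<ge> a + b\<close> by linarith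
    then show ?thesis using assms(2,3) that by cases (auto simp: tops_def)
  qed
  have "component h k (p * q) = (if k = a + b then p' * q' else 0)" if "k \<ge> a + b" for k
  proof -
    have "component h k (p * q) = (\<Sum>i\<le>k. if i = a \<and> k = a + b then p' * q' else 0)"
      unfolding component_mult[OF h] using *[OF that] by (intro sum.cong) auto
    then show ?thesis by (cases "k = a + b") auto
  qed
  then show ?thesis by (simp add: tops_def)
qed

lemma tops_1:
  fixes h :: "('v \<Rightarrow>\<^sub>0 nat) \<Rightarrow> nat"
  assumes "\<And>s t. h (s + t) = h s + h t"
  shows "tops h 0 (1 :: ('v, 'k::comm_ring_1) mpoly) 1"
proof -
  have "h 0 = 0" using assms[of 0 0] by simp
  then show ?thesis using component_single[of h _ 0 "1::'k"] by (simp add: tops_def)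
qed

lemma tops_prod:
  fixes f :: "'a \<Rightarrow> ('v, 'k::comm_ring_1) mpoly"
  assumes h: "\<And>s t. h (s + t) = h s + h t" and "\<And>a. a \<in> A \<Longrightarrow> tops h (d a) (f a) (f' a)"
  shows "tops h (sum d A) (prod f A) (prod f' A)"
  using assms(2)
  by (induction A rule: infinite_finite_induct) (auto intro: tops_1 tops_mult simp: h)

lemma tops_power:
  fixes p :: "('v, 'k::comm_ring_1) mpoly"
  assumes h: "\<And>s t. h (s + t) = h s + h t" and "tops h d p p'"
  shows "tops h (d * n) (p ^ n) (p' ^ n)"
  using assms(2) by (induction n) (auto intro: tops_1 tops_mult simp: h)

lemma tops_Max:
  assumes "p \<noteq> 0"
  shows "tops h (Max (h ` keys p)) p (component h (Max (h ` keys p)) p)"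
    and "component h (Max (h ` keys p)) p \<noteq> 0"
proof -
  let ?m = "Max (h ` keys p)"
  have ne: "keys p \<noteq> {}" using assms by simp
  have "h t \<le> ?m" if "t \<in> keys p" for t using that by simp
  then have "component h i p = 0" if "i > ?m" for i
    using that keys_component[of h i p] keys_eq_empty[of "component h i p"] by fastforce
  then show "tops h ?m p (component h ?m p)" by (simp add: tops_def)
  have "?m \<in> h ` keys p" using ne by (intro Max_in) auto
  then have "keys (component h ?m p) \<noteq> {}" by (auto simp: keys_component)
  then show "component h ?m p \<noteq> 0" by auto
qed

text \<open>In a domain the product of the two top components is nonzero, so a product loses no
  weight. The linear order on \<open>'v\<close> supplies the type class instance by which
  polynomials form a domain.\<close>

lemma mult_weight_ge:
  fixes p q :: "('v::linorder, 'k::field) mpoly" and h :: "('v \<Rightarrow>\<^sub>0 nat) \<Rightarrow> nat"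
  assumes h: "\<And>s t. h (s + t) = h s + h t" and "q \<noteq> 0" "t \<in> keys p"
  shows "\<exists>s \<in> keys (p * q). h t \<le> h s"
proof -
  have "p \<noteq> 0" using assms(3) by auto
  let ?a = "Max (h ` keys p)" and ?b = "Max (h ` keys q)"
  have "component h (?a + ?b) (p * q) = component h ?a p * component h ?b q"
    using tops_mult[OF h tops_Max(1)[OF \<open>p \<noteq> 0\<close>, of h] tops_Max(1)[OF \<open>q \<noteq> 0\<close>, of h]]
    by (simp add: tops_def)
  also have "\<dots> \<noteq> 0" using tops_Max(2)[OF \<open>p \<noteq> 0\<close>, of h] tops_Max(2)[OF \<open>q \<noteq> 0\<close>, of h] by simp
  finally obtain s where "s \<in> keys (component h (?a + ?b) (p * q))"
    by (metis keys_eq_empty all_not_in_conv)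
  then have "s \<in> keys (p * q)" "h s = ?a + ?b" by (auto simp: keys_component)
  moreover have "h t \<le> ?a" using assms(3) by simp
  ultimately show ?thesis by (intro bexI[of _ s]) auto
qed

text \<open>A weight that separates the terms of each \<open>f v\<close> does the work of a monomial order.\<close>

lemma eval_poly_neq_0I:
  fixes f :: "'v \<Rightarrow> ('w, 'k::field) mpoly"
  assumes h: "\<And>s t. h (s + t) = h s + h t"
    and f: "\<And>v. v \<in> Y \<Longrightarrow> c v \<noteq> 0 \<and> tops h (h (T v)) (f v) (single (T v) (c v))"
    and inj: "\<And>a b v. v \<in> Y \<Longrightarrow> (\<And>u. (\<Sum>v\<in>Y. a v * lookup (T v) u) =
        (\<Sum>v\<in>Y. b v * lookup (T v) u)) \<Longrightarrow> a v = b v"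
    and "finite Y"
    and p: "p \<in> poly_in Y" "p \<noteq> 0"
  shows "eval_poly f p \<noteq> 0"
proof -
  \<comment> \<open>\<open>L t\<close> and \<open>C t\<close> are the exponent and the coefficient
    of the top term of the product \<open>monom_val f t\<close>.\<close>
  define L where "L t = (\<Sum>v\<in>keys t. Poly_Mapping.map ((*) (lookup t v)) (T v))" for t
  define C where "C t = (\<Prod>v\<in>keys t. c v ^ lookup t v)" for t
  have h0: "h 0 = 0" using h[of 0 0] by simp
  have hsum: "h (sum g A) = (\<Sum>a\<in>A. h (g a))" for g and A :: "'v set"
    by (induction A rule: infinite_finite_induct) (auto simp: h h0)
  have map_Suc: "Poly_Mapping.map ((*) (Suc n)) t = t + Poly_Mapping.map ((*) n) t" for n and t :: "'w \<Rightarrow>\<^sub>0 nat"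
    by (rule poly_mapping_eqI) (auto simp: lookup_add map.rep_eq when_def)
  have map_0: "Poly_Mapping.map ((*) 0) t = 0" for t :: "'w \<Rightarrow>\<^sub>0 nat"
    by (rule poly_mapping_eqI) (auto simp: map.rep_eq when_def)
  have hmap: "h (Poly_Mapping.map ((*) n) t) = h t * n" for n t
  proof (induction n)
    case (Suc n)
    then show ?case by (simp only: map_Suc h mult_Suc_right)
  qed (simp only: map_0 h0 mult_0_right)
  have single_power: "single t a ^ n = single (Poly_Mapping.map ((*) n) t) (a ^ n)"
    for n and t :: "'w \<Rightarrow>\<^sub>0 nat" and a :: 'k
  proof (induction n)
    case (Suc n)
    then show ?case by (simp only: map_Suc power_Suc mult_single)
  qed (simp only: map_0 power_0 single_one)
  have single_prod: "prod (\<lambda>v. single (g v) (b v)) A = single (sum g A) (prod b A)"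
    for g :: "'v \<Rightarrow> 'w \<Rightarrow>\<^sub>0 nat" and b :: "'v \<Rightarrow> 'k" and A
    by (induction A rule: infinite_finite_induct) (auto simp: mult_single)
  have top: "tops h (h (L t)) (monom_val f t) (single (L t) (C t))"
    if "keys t \<subseteq> Y" for t
  proof -
    have "tops h (\<Sum>v\<in>keys t. h (T v) * lookup t v) (monom_val f t)
      (\<Prod>v\<in>keys t. single (T v) (c v) ^ lookup t v)"
      unfolding monom_val_def using that f by (intro tops_prod tops_power) (auto simp: h)
    then show ?thesis
      by (simp add: L_def C_def hsum hmap single_power single_prod)
  qed
  define m where "m = Max ((\<lambda>t. h (L t)) ` keys p)"
  have keys: "keys t \<subseteq> Y" if "t \<in> keys p" for t
    using that p by (auto simp: poly_in_def)
  have comp: "component h m (const (lookup p t) * monom_val f t) =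
      (if h (L t) = m then single (L t) (lookup p t * C t) else 0)"
    if "t \<in> keys p" for t
  proof -
    have "h (L t) \<le> m" unfolding m_def using that by simp
    moreover have "tops h (0 + h (L t)) (const (lookup p t) * monom_val f t)
        (const (lookup p t) * single (L t) (C t))"
      using top[OF keys[OF that]] by (intro tops_mult h) (auto simp: tops_def component_single h0)
    ultimately show ?thesis by (auto simp: tops_def mult_single)
  qed
  have "m \<in> (\<lambda>t. h (L t)) ` keys p"
    unfolding m_def using p(2) by (intro Max_in) auto
  then obtain t where t: "t \<in> keys p" "h (L t) = m" by auto
  \<comment> \<open>The monomial \<open>t\<close> attains the largest weight \<open>m\<close>. As
    the \<open>L s\<close> are pairwise distinct, no other monomial of \<open>p\<close> can cancel
    its top term.\<close>
  have inj': "L s = L t \<longleftrightarrow> s = t" if "s \<in> keys p" for s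
  proof
    assume "L s = L t"
    have *: "lookup (L r) u = (\<Sum>v\<in>Y. lookup r v * lookup (T v) u)"
      if "r \<in> keys p" for r u
      using \<open>finite Y\<close> keys[OF that] unfolding L_def lookup_sum
      by (intro sum.mono_neutral_cong_left) (auto simp: map.rep_eq when_def in_keys_iff)
    have "lookup s v = lookup t v" if "v \<in> Y" for v
      using inj[OF that] * \<open>L s = L t\<close> \<open>s \<in> _\<close> t by metis
    moreover have "lookup s v = lookup t v" if "v \<notin> Y" for v
      using that keys[OF \<open>s \<in> _\<close>] keys[OF t(1)] by (metis in_keys_iff subsetD)
    ultimately show "s = t" by (intro poly_mapping_eqI) blast
  qed simp
  have "lookup (component h m (eval_poly f p)) (L t) =
      (\<Sum>s\<in>keys p. if s = t then lookup p t * C t else 0)"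
    unfolding eval_poly_def component_sum lookup_sum
    using inj' t by (intro sum.cong) (auto simp: comp lookup_single when_def)
  also have "\<dots> \<noteq> 0"
    using t keys[OF t(1)] f by (auto simp: C_def in_keys_iff)
  finally show ?thesis by auto
qed

section \<open>Prime ideals and algebraic independence\<close>

text \<open>Ideals of a whole type: the ring B, with one variable for each natural number, needs no
  carrier. \<open>comm_ring_image\<close> later carries its primes over to rings with a
  carrier.\<close>

definition ring_ideal :: "'r::comm_ring_1 set \<Rightarrow> bool"
  where "ring_ideal I \<longleftrightarrow> 0 \<in> I \<and> (\<forall>a\<in>I. \<forall>b\<in>I. a + b \<in> I) \<and> (\<forall>a\<in>I. \<forall>r. r * a \<in> I)"

definition prime_ideal :: "'r::comm_ring_1 set \<Rightarrow> bool"
  where "prime_ideal P \<longleftrightarrow> ring_ideal P \<and> 1 \<notin> P \<and> (\<forall>a b. a * b \<in> P \<longrightarrow> a \<in> P \<or> b \<in> P)"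

context
  fixes I :: "'r::comm_ring_1 set"
  assumes I: "ring_ideal I"
begin

lemma ring_ideal_0: "0 \<in> I"
  using I by (simp add: ring_ideal_def)

lemma ring_ideal_add: "a \<in> I \<Longrightarrow> b \<in> I \<Longrightarrow> a + b \<in> I"
  using I by (simp add: ring_ideal_def)

lemma ring_ideal_mult: "a \<in> I \<Longrightarrow> r * a \<in> I"
  using I by (simp add: ring_ideal_def)

lemma ring_ideal_uminus: "a \<in> I \<Longrightarrow> - a \<in> I"
  using ring_ideal_mult[of a "-1"] by simp

lemma ring_ideal_diff: "a \<in> I \<Longrightarrow> b \<in> I \<Longrightarrow> a - b \<in> I"
  using ring_ideal_add[of a "- b"] ring_ideal_uminus[of b] by simp

lemma ring_ideal_adjoin: "ring_ideal {p + q * h |p h. p \<in> I}"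
proof -
  have "\<exists>p h. x + y = p + q * h \<and> p \<in> I"
    if "x = p1 + q * h1" "y = p2 + q * h2" "p1 \<in> I" "p2 \<in> I" for x y p1 h1 p2 h2
    using that by (intro exI[of _ "p1 + p2"] exI[of _ "h1 + h2"]) (auto simp: algebra_simps ring_ideal_add)
  moreover have "\<exists>p h. r * x = p + q * h \<and> p \<in> I"
    if "x = p1 + q * h1" "p1 \<in> I" for x p1 h1 r
    using that by (intro exI[of _ "r * p1"] exI[of _ "r * h1"])
      (auto simp: distrib_left mult.left_commute ring_ideal_mult)
  moreover have "\<exists>p h. 0 = p + q * h \<and> p \<in> I"
    using ring_ideal_0 by (intro exI[of _ 0]) auto
  ultimately show ?thesis unfolding ring_ideal_def by blast
qed

end

text \<open>Zorn's lemma gives an ideal \<open>M\<close> that is maximal among those containing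
  \<open>I\<close> and disjoint from \<open>W\<close>. If neither \<open>a\<close> nor
  \<open>b\<close> is in \<open>M\<close>, then \<open>M + (a)\<close> and \<open>M + (b)\<close>
  both meet \<open>W\<close>; the product of the two meeting elements is in \<open>W\<close>, and
  \<open>a * b \<in> M\<close> would put it into \<open>M\<close>.\<close>

lemma prime_ideal_avoiding:
  assumes I: "ring_ideal I" and W: "1 \<in> W" "\<And>a b. a \<in> W \<Longrightarrow> b \<in> W \<Longrightarrow> a * b \<in> W" and "I \<inter> W = {}"
  obtains Q where "prime_ideal Q" "I \<subseteq> Q" "Q \<inter> W = {}"
proof -
  define \<A> where "\<A> = {J. ring_ideal J \<and> I \<subseteq> J \<and> J \<inter> W = {}}"
  have "\<exists>M\<in>\<A>. \<forall>X\<in>\<A>. M \<subseteq> X \<longrightarrow> X = M"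
  proof (rule subset_Zorn_nonempty)
    have "I \<in> \<A>" using I \<open>I \<inter> W = {}\<close> by (simp add: \<A>_def)
    then show "\<A> \<noteq> {}" by blast
  next
    fix C assume C: "C \<noteq> {}" "subset.chain \<A> C"
    then have CA: "C \<subseteq> \<A>" by (auto simp: subset_chain_def)
    have "a + b \<in> \<Union>C" if ab: "a \<in> \<Union>C" "b \<in> \<Union>C" for a b
    proof -
      obtain X Y where XY: "X \<in> C" "Y \<in> C" "a \<in> X" "b \<in> Y" using ab by auto
      then have "X \<subseteq> Y \<or> Y \<subseteq> X" using C(2) by (auto simp: subset_chain_def)
      then obtain Z where "Z \<in> C" "a \<in> Z" "b \<in> Z" using XY by blast
      moreover have "ring_ideal Z" using CA \<open>Z \<in> C\<close> by (auto simp: \<A>_def)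
      ultimately show ?thesis using ring_ideal_add by blast
    qed
    moreover have "r * a \<in> \<Union>C" if a: "a \<in> \<Union>C" for a r
    proof -
      obtain Z where "Z \<in> C" "a \<in> Z" using a by blast
      moreover have "ring_ideal Z" using CA \<open>Z \<in> C\<close> by (auto simp: \<A>_def)
      ultimately show ?thesis using ring_ideal_mult by blast
    qed
    moreover have "0 \<in> \<Union>C" using C(1) CA by (auto simp: \<A>_def ring_ideal_def)
    ultimately have "ring_ideal (\<Union>C)" by (simp add: ring_ideal_def)
    then show "\<Union>C \<in> \<A>" using C(1) CA by (auto simp: \<A>_def)
  qed
  then obtain M where M: "ring_ideal M" "I \<subseteq> M" "M \<inter> W = {}"
    and max: "\<And>X. X \<in> \<A> \<Longrightarrow> M \<subseteq> X \<Longrightarrow> X = M"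
    by (auto simp: \<A>_def)
  have meet: "\<exists>p r. p \<in> M \<and> p + a * r \<in> W" if "a \<notin> M" for a
  proof (rule ccontr)
    assume *: "\<not> ?thesis"
    let ?X = "{p + a * h |p h. p \<in> M}"
    have "M \<subseteq> ?X" by (force intro: exI[of _ 0])
    moreover have "ring_ideal ?X" by (rule ring_ideal_adjoin[OF M(1)])
    ultimately have "?X \<in> \<A>" using M(2) * by (auto simp: \<A>_def)
    then have "?X = M" using max \<open>M \<subseteq> ?X\<close> by blast
    moreover have "a \<in> ?X" using M(1) by (force simp: ring_ideal_def intro: exI[of _ 0] exI[of _ 1])
    ultimately show False using that by simp
  qed
  have "a \<in> M \<or> b \<in> M" if "a * b \<in> M" for a b
  proof (rule ccontr)
    assume "\<not> ?thesis"
    then obtain p r p' r' where *: "p \<in> M" "p + a * r \<in> W" "p' \<in> M" "p' + b * r' \<in> W"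
      using meet by meson
    have "(p + a * r) * (p' + b * r') = (p' + b * r') * p + (a * r) * p' + (r * r') * (a * b)"
      by (simp add: algebra_simps)
    also have "\<dots> \<in> M" using M(1) * that unfolding ring_ideal_def by blast
    finally show False using W(2)[OF *(2,4)] M(3) by blast
  qed
  then have "prime_ideal M" using M W(1) by (auto simp: prime_ideal_def)
  then show ?thesis using that M by blast
qed

lemma prime_ideal_powerD: "prime_ideal P \<Longrightarrow> a ^ n \<in> P \<Longrightarrow> a \<in> P"
  by (induction n) (auto simp: prime_ideal_def)

lemma poly_in_insert_cases:
  fixes p :: "('v, 'k::field) mpoly"
  assumes "p \<in> poly_in (insert v V)"
  obtains n c where "\<And>i. c i \<in> poly_in V" "\<And>i. i \<ge> n \<Longrightarrow> c i = 0" "p = (\<Sum>i<n. c i * mvar v ^ i)"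
proof -
  have "\<exists>n c. (\<forall>i. c i \<in> poly_in V) \<and> (\<forall>i\<ge>n. c i = 0) \<and> p = (\<Sum>i<n. c i * mvar v ^ i)"
    using assms
  proof (induction rule: poly_in_induct)
    case (const c)
    show ?case by (intro exI[of _ 1] exI[of _ "\<lambda>i. if i = 0 then const c else 0"]) auto
  next
    case (add p q)
    obtain n c where c: "\<forall>i. c i \<in> poly_in V" "\<forall>i\<ge>n. c i = 0" "p = (\<Sum>i<n. c i * mvar v ^ i)"
      using add.IH(1) by blast
    obtain m d where d: "\<forall>i. d i \<in> poly_in V" "\<forall>i\<ge>m. d i = 0" "q = (\<Sum>i<m. d i * mvar v ^ i)"
      using add.IH(2) by blast
    note * = c d
    have "p = (\<Sum>i<max n m. c i * mvar v ^ i)"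
      unfolding *(3) using *(2) by (intro sum.mono_neutral_left) auto
    moreover have "q = (\<Sum>i<max n m. d i * mvar v ^ i)"
      unfolding *(6) using *(5) by (intro sum.mono_neutral_left) auto
    ultimately have "p + q = (\<Sum>i<max n m. (c i + d i) * mvar v ^ i)"
      by (simp add: distrib_right sum.distrib)
    then show ?case using * by (intro exI[of _ "max n m"] exI[of _ "\<lambda>i. c i + d i"]) auto
  next
    case (mult u p)
    obtain n c where *: "\<forall>i. c i \<in> poly_in V" "\<forall>i\<ge>n. c i = 0" "p = (\<Sum>i<n. c i * mvar v ^ i)"
      using mult.IH by blast
    show ?case
    proof (cases "u = v")
      case True
      have "mvar u * p = (\<Sum>i<n. c i * mvar v ^ Suc i)"
        by (simp add: *(3) True sum_distrib_left ac_simps)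
      also have "\<dots> = (\<Sum>i<Suc n. (if i = 0 then 0 else c (i - 1)) * mvar v ^ i)"
        by (subst sum.lessThan_Suc_shift) simp
      finally show ?thesis
        using * by (intro exI[of _ "Suc n"] exI[of _ "\<lambda>i. if i = 0 then 0 else c (i - 1)"]) auto
    next
      case False
      then have "u \<in> V" using mult.hyps by auto
      then show ?thesis
        using * by (intro exI[of _ n] exI[of _ "\<lambda>i. mvar u * c i"])
          (auto simp: sum_distrib_left ac_simps)
    qed
  qed
  then show ?thesis using that by blast
qed

section \<open>Algebraic independence modulo a prime ideal\<close>

definition indep_mod :: "('v, 'k::field) mpoly set \<Rightarrow> (nat \<Rightarrow> ('v, 'k) mpoly) \<Rightarrow> nat \<Rightarrow> bool"
  where "indep_mod P g d \<longleftrightarrow> (\<forall>r \<in> poly_in {..<d}. r \<noteq> 0 \<longrightarrow> eval_poly g r \<notin> P)"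

text \<open>A relation modulo \<open>P\<close> is read as a polynomial in \<open>h\<close>. Since
  \<open>h\<close> is not in the prime \<open>P\<close>, the lowest power of \<open>h\<close> can be
  cancelled; then everything but the lowest coefficient vanishes modulo \<open>Q\<close>, where
  \<open>h\<close> is zero, and this coefficient is a relation of the old family modulo
  \<open>Q\<close>.\<close>

lemma indep_mod_Suc:
  assumes P: "prime_ideal P" and Q: "prime_ideal Q" and "P \<subseteq> Q" and h: "h \<in> Q" "h \<notin> P"
    and indep: "indep_mod Q g d"
  shows "indep_mod P (g(d := h)) (Suc d)"
  unfolding indep_mod_def
proof (intro ballI impI notI)
  fix r :: "(nat, 'b) mpoly"
  assume r: "r \<in> poly_in {..<Suc d}" "r \<noteq> 0" "eval_poly (g(d := h)) r \<in> P"
  have "{..<Suc d} = insert d {..<d}" by auto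
  then obtain n c where c: "\<And>i. c i \<in> poly_in {..<d}" "\<And>i. i \<ge> n \<Longrightarrow> c i = 0" "r = (\<Sum>i<n. c i * mvar d ^ i)"
    using poly_in_insert_cases[of r d "{..<d}"] r(1) by metis
  have "\<exists>i. c i \<noteq> 0" using r(2) c(3) by (auto intro: ccontr)
  define k where "k = (LEAST i. c i \<noteq> 0)"
  have ck: "c k \<noteq> 0" unfolding k_def using \<open>\<exists>i. c i \<noteq> 0\<close> by (rule LeastI_ex)
  have lt: "c i = 0" if "i < k" for i using not_less_Least[of i "\<lambda>i. c i \<noteq> 0"] that k_def by auto
  have "k < n" using ck c(2) by (meson not_less)
  have ev: "eval_poly (g(d := h)) (c i) = eval_poly g (c i)" for i
    using c(1) by (intro eval_poly_cong[where V = "{..<d}"]) auto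
  have "eval_poly (g(d := h)) r = (\<Sum>i<n. eval_poly g (c i) * h ^ i)"
    unfolding c(3) eval_poly_sum by (simp add: ev)
  also have "\<dots> = (\<Sum>i\<in>{k..<n}. eval_poly g (c i) * h ^ i)"
    using lt by (intro sum.mono_neutral_right) auto
  also have "\<dots> = (\<Sum>i<n - k. eval_poly g (c (i + k)) * h ^ (i + k))"
    using \<open>k < n\<close> sum.shift_bounds_nat_ivl[of "\<lambda>i. eval_poly g (c i) * h ^ i" 0 k "n - k"]
    by (simp add: atLeast0LessThan)
  also have "\<dots> = h ^ k * (\<Sum>i<n - k. eval_poly g (c (i + k)) * h ^ i)"
    by (simp add: sum_distrib_left power_add ac_simps)
  finally have "(\<Sum>i<n - k. eval_poly g (c (i + k)) * h ^ i) \<in> P"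
    using r(3) P prime_ideal_powerD[OF P, of h k] h(2) by (auto simp: prime_ideal_def)
  then have sum_Q: "(\<Sum>i<n - k. eval_poly g (c (i + k)) * h ^ i) \<in> Q" using \<open>P \<subseteq> Q\<close> by blast
  obtain l where l: "n - k = Suc l" using \<open>k < n\<close> by (metis Suc_diff_Suc)
  define T where "T = (\<Sum>i<l. eval_poly g (c (Suc i + k)) * h ^ i) * h"
  have "(\<Sum>i<n - k. eval_poly g (c (i + k)) * h ^ i) =
      eval_poly g (c k) + T"
    unfolding T_def l by (subst sum.lessThan_Suc_shift) (simp add: sum_distrib_left ac_simps)
  then have "eval_poly g (c k) + T \<in> Q" using sum_Q by simp
  moreover have Qi: "ring_ideal Q" using Q by (simp add: prime_ideal_def)
  moreover have "T \<in> Q" unfolding T_def using h(1) ring_ideal_mult[OF Qi] by simp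
  ultimately have "(eval_poly g (c k) + T) - T \<in> Q" by (intro ring_ideal_diff)
  then have "eval_poly g (c k) \<in> Q" by simp
  then show False using indep c(1)[of k] ck by (auto simp: indep_mod_def)
qed

text \<open>The family is built from the top of the chain downwards. At the top it is empty: a
  polynomial in no variables is a constant, and a nonzero constant is a unit, hence in no
  prime.\<close>

lemma chain_imp_indep_mod:
  fixes P :: "nat \<Rightarrow> ('v, 'k::field) mpoly set"
  assumes "\<And>i. i \<le> d \<Longrightarrow> prime_ideal (P i)" "\<And>i. i < d \<Longrightarrow> P i \<subset> P (Suc i)"
  shows "\<exists>g. indep_mod (P 0) g d"
  using assms
proof (induction d arbitrary: P)
  case 0
  have "eval_poly g r \<notin> P 0" if r: "r \<in> poly_in {..<0::nat}" "r \<noteq> 0" for r g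
  proof
    assume *: "eval_poly g r \<in> P 0"
    have "\<exists>c. r = const c" using r(1)
      by (induction rule: poly_in_induct) (auto simp: single_add[symmetric])
    then obtain c where c: "r = const c" by blast
    with r(2) have "c \<noteq> 0" by auto
    have "const (1 / c) * eval_poly g r = 1"
      using \<open>c \<noteq> 0\<close> by (simp add: c mult_single)
    then have "1 \<in> P 0" using * 0(1)[of 0] ring_ideal_mult by (metis prime_ideal_def le_refl)
    then show False using 0(1)[of 0] by (simp add: prime_ideal_def)
  qed
  then show ?case by (auto simp: indep_mod_def)
next
  case (Suc d)
  have "\<exists>g. indep_mod (P (Suc 0)) g d"
    using Suc.IH[of "\<lambda>i. P (Suc i)"] Suc.prems by auto
  moreover obtain h where "h \<in> P (Suc 0)" "h \<notin> P 0" using Suc.prems(2)[of 0] by auto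
  ultimately show ?case
    using indep_mod_Suc[of "P 0" "P (Suc 0)" h] Suc.prems(1)[of 0] Suc.prems(1)[of "Suc 0"]
      Suc.prems(2)[of 0] by (metis Suc_le_mono le0 psubset_imp_subset zero_less_Suc)
qed

section \<open>Counting exponents with bounded entries\<close>

definition box :: "'v set \<Rightarrow> nat \<Rightarrow> ('v \<Rightarrow>\<^sub>0 nat) set"
  where "box V k = {t. keys t \<subseteq> V \<and> (\<forall>v. lookup t v \<le> k)}"

lemma card_box:
  assumes "finite V"
  shows "finite (box V k)" "card (box V k) = Suc k ^ card V"
proof -
  have "bij_betw (\<lambda>t. restrict (lookup t) V) (box V k) (PiE V (\<lambda>_. {..k}))"
  proof (rule bij_betw_imageI)
    show "inj_on (\<lambda>t. restrict (lookup t) V) (box V k)"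
    proof (rule inj_onI, rule poly_mapping_eqI)
      fix s t v assume *: "s \<in> box V k" "t \<in> box V k"
        "restrict (lookup s) V = restrict (lookup t) V"
      show "lookup s v = lookup t v"
      proof (cases "v \<in> V")
        case True
        then show ?thesis using fun_cong[OF *(3), of v] by simp
      next
        case False
        then have "v \<notin> keys s" "v \<notin> keys t" using * by (auto simp: box_def)
        then show ?thesis by (simp add: in_keys_iff)
      qed
    qed
    show "(\<lambda>t. restrict (lookup t) V) ` box V k = PiE V (\<lambda>_. {..k})"
    proof (intro equalityI subsetI)
      fix f assume f: "f \<in> PiE V (\<lambda>_. {..k})"
      define t where "t = Abs_poly_mapping (\<lambda>v. if v \<in> V then f v else 0)"
      have l: "lookup t v = (if v \<in> V then f v else 0)" for v
        unfolding t_def by (subst lookup_Abs_poly_mapping) (auto intro: finite_subset[OF _ assms])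
      have "t \<in> box V k" using f by (auto simp: box_def l in_keys_iff PiE_def Pi_def split: if_splits)
      moreover have "restrict (lookup t) V = f"
        using f by (auto simp: l fun_eq_iff PiE_def extensional_def)
      ultimately show "f \<in> (\<lambda>t. restrict (lookup t) V) ` box V k" by blast
    qed (auto simp: box_def)
  qed
  then show "finite (box V k)" "card (box V k) = Suc k ^ card V"
    using assms by (auto simp: bij_betw_finite finite_PiE bij_betw_same_card card_PiE)
qed

lemma keys_mult_box:
  fixes p q :: "('v, 'k::comm_ring_1) mpoly"
  assumes "keys p \<subseteq> box V a" "keys q \<subseteq> box V b"
  shows "keys (p * q) \<subseteq> box V (a + b)"
proof
  fix t assume "t \<in> keys (p * q)"
  then obtain r s where *: "t = r + s" "r \<in> keys p" "s \<in> keys q"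
    using keys_mult[of p q] by auto
  then have "r \<in> box V a" "s \<in> box V b" using assms by auto
  then show "t \<in> box V (a + b)"
    unfolding * box_def using keys_add[of r s] by (auto simp: lookup_add add_mono)
qed

lemma keys_one_box: "keys (1 :: ('v, 'k::comm_ring_1) mpoly) \<subseteq> box V 0"
  by (auto simp: box_def)

lemma keys_power_box:
  fixes p :: "('v, 'k::comm_ring_1) mpoly"
  assumes "keys p \<subseteq> box V a"
  shows "keys (p ^ n) \<subseteq> box V (a * n)"
proof (induction n)
  case (Suc n)
  then show ?case using keys_mult_box[OF assms Suc] by simp
qed (use keys_one_box in simp)

lemma keys_prod_box:
  fixes f :: "'a \<Rightarrow> ('v, 'k::comm_ring_1) mpoly"
  assumes "\<And>a. a \<in> A \<Longrightarrow> keys (f a) \<subseteq> box V (d a)"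
  shows "keys (prod f A) \<subseteq> box V (sum d A)"
  using assms
proof (induction A rule: infinite_finite_induct)
  case (insert x F)
  then show ?case using keys_mult_box[of "f x" V "d x" "prod f F" "sum d F"] by simp
qed (use keys_one_box in auto)

lemma box_mono: "a \<le> b \<Longrightarrow> box V a \<subseteq> box V b"
  by (auto simp: box_def) (meson le_trans)

text \<open>The \<open>(k + 1)\<^sup>d\<close> products of powers of \<open>y\<close> with exponents at most \<open>k\<close> are independent in a
  space of dimension \<open>O(k\<^bsup>card V\<^esup>)\<close>.\<close>

lemma indep_le_card:
  fixes y :: "nat \<Rightarrow> ('v, 'k::field) mpoly"
  assumes V: "finite V" and y: "\<And>i. i < d \<Longrightarrow> y i \<in> poly_in V" and indep: "indep_mod {0} y d"
  shows "d \<le> card V"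
proof -
  interpret vs: vector_space "\<lambda>(c::'k) (p::('v, 'k) mpoly). const c * p"
    by unfold_locales (auto simp: algebra_simps single_add mult_single mult.assoc[symmetric])
  define E where "E = (\<lambda>k. box {..<d} k)"
  \<comment> \<open>A crude common bound for all exponents in all \<open>y i\<close>. A product of
    \<open>d\<close> powers with exponents at most \<open>k\<close> then has all its exponents at
    most \<open>d * D * k\<close>.\<close>
  define D where "D = (\<Sum>i<d. \<Sum>t\<in>keys (y i). \<Sum>v\<in>keys t. lookup t v)"
  have keys_y: "keys (y i) \<subseteq> box V D" if "i < d" for i
  proof
    fix t assume t: "t \<in> keys (y i)"
    have "lookup t v \<le> D" for v
    proof (cases "v \<in> keys t")
      case True
      then have "lookup t v \<le> (\<Sum>v\<in>keys t. lookup t v)"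
        by (intro member_le_sum) auto
      also have "\<dots> \<le> (\<Sum>t\<in>keys (y i). \<Sum>v\<in>keys t. lookup t v)"
        using t by (intro member_le_sum) auto
      also have "\<dots> \<le> D"
        unfolding D_def using \<open>i < d\<close>
        by (intro member_le_sum[where f = "\<lambda>i. \<Sum>t\<in>keys (y i). \<Sum>v\<in>keys t. lookup t v"]) auto
      finally show ?thesis .
    qed (simp add: in_keys_iff)
    then show "t \<in> box V D" using y[OF that] t by (auto simp: box_def poly_in_def)
  qed
  have bound: "Suc k ^ d \<le> Suc (d * D * k) ^ card V" for k
  proof -
    have fin: "finite (E k)" unfolding E_def by (intro card_box) auto
    have eval: "eval_poly y (\<Sum>t\<in>E k. single t (c t)) = (\<Sum>t\<in>E k. const (c t) * monom_val y t)" for c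
      by (simp add: eval_poly_sum eval_poly_single)
    have zero: "c t = 0" if "(\<Sum>t\<in>E k. const (c t) * monom_val y t) = 0" "t \<in> E k" for c t
    proof -
      let ?r = "\<Sum>t\<in>E k. single t (c t)"
      have "?r \<in> poly_in {..<d}" by (auto simp: E_def box_def)
      then have "?r = 0" using indep that(1) eval by (auto simp: indep_mod_def)
      then have "lookup ?r t = 0" by simp
      also have "lookup ?r t = c t"
        using fin that(2) by (simp add: lookup_sum lookup_single when_def)
      finally show ?thesis .
    qed
    \<comment> \<open>Distinct exponents have distinct values, since the difference of two equal
      ones would be a relation. The cardinality of the image is therefore the full
      \<open>(k + 1) ^ d\<close>.\<close>
    have inj: "inj_on (monom_val y) (E k)"
    proof (rule inj_onI, rule ccontr)
      fix s t assume *: "s \<in> E k" "t \<in> E k" "monom_val y s = monom_val y t" "s \<noteq> t"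
      have "(\<Sum>r\<in>E k. const (if r = s then 1 else if r = t then -1 else 0) * monom_val y r) =
          (\<Sum>r\<in>E k. (if r = s then monom_val y s else 0) - (if r = t then monom_val y t else 0))"
        using *(4) by (intro sum.cong) (auto simp: single_uminus)
      also have "\<dots> = 0" using fin * by (simp add: sum_subtractf)
      finally show False using zero[of "\<lambda>r. if r = s then 1 else if r = t then -1 else 0" s] *(1) by simp
    qed
    have "\<not> vs.dependent (monom_val y ` E k)"
    proof (rule vs.independent_if_scalars_zero)
      fix c x assume "(\<Sum>x\<in>monom_val y ` E k. const (c x) * x) = 0" "x \<in> monom_val y ` E k"
      then show "c x = 0" using zero[of "\<lambda>t. c (monom_val y t)"] by (auto simp: sum.reindex[OF inj])
    qed (use fin in simp)
    moreover have "monom_val y ` E k \<subseteq> vs.span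
        ((\<lambda>t. single t 1) ` box V (d * D * k))"
    proof clarify
      fix t assume t: "t \<in> E k"
      have "keys (monom_val y t) \<subseteq> box V (\<Sum>i\<in>keys t. D * lookup t i)"
        unfolding monom_val_def using t keys_y
        by (intro keys_prod_box keys_power_box) (auto simp: E_def box_def)
      moreover have "(\<Sum>i\<in>keys t. D * lookup t i) \<le> (\<Sum>i<d. D * k)"
        using t by (intro sum_mono2[THEN order_trans, OF _ _ _ sum_mono]) (auto simp: E_def box_def)
      ultimately have sub: "keys (monom_val y t) \<subseteq> box V (d * D * k)"
        using box_mono[of "(\<Sum>i\<in>keys t. D * lookup t i)" "d * D * k" V] by auto
      have "monom_val y t = (\<Sum>s\<in>box V (d * D * k). const (lookup (monom_val y t) s) * single s 1)"
        using poly_eq_sum_single[OF card_box(1)[OF V] sub] by (simp add: mult_single)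
      also have "\<dots> \<in> vs.span
        ((\<lambda>t. single t 1) ` box V (d * D * k))"
        by (intro vs.span_sum vs.span_scale vs.span_base) auto
      finally show "monom_val y t \<in> vs.span
        ((\<lambda>t. single t 1) ` box V (d * D * k))" .
    qed
    ultimately have "card (monom_val y ` E k) \<le> card ((\<lambda>t. single t (1::'k)) ` box V (d * D * k))"
      using vs.independent_span_bound[OF finite_imageI[OF card_box(1)[OF V]]] by blast
    also have "\<dots> \<le> card (box V (d * D * k))" by (intro card_image_le card_box V)
    finally show ?thesis using card_box(2)[of "{..<d}" k] by (simp add: card_image[OF inj] E_def[symmetric] card_box V)
  qed
  show ?thesis
  proof (rule ccontr)
    assume "\<not> d \<le> card V"
    then have "Suc (card V) \<le> d" by simp
    \<comment> \<open>The constants are chosen so that \<open>C ^ card V\<close> equals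
      \<open>k\<close>: if \<open>d\<close> exceeds \<open>card V\<close>, the two bounds give
      \<open>Suc k * Suc k ^ card V \<le> k * Suc k ^ card V\<close>.\<close>
    define C where "C = Suc (d * D)"
    define k where "k = C ^ card V"
    have "Suc k ^ Suc (card V) \<le> Suc k ^ d" by (intro power_increasing) (use \<open>Suc (card V) \<le> d\<close> in auto)
    also have "\<dots> \<le> Suc (d * D * k) ^ card V" by (rule bound)
    also have "\<dots> \<le> (C * Suc k) ^ card V" by (intro power_mono) (auto simp: C_def algebra_simps)
    also have "\<dots> = k * Suc k ^ card V" by (simp only: k_def power_mult_distrib)
    finally show False by simp
  qed
qed

section \<open>Chains of prime ideals\<close>

lemma lookup_mvar_mult:
  "lookup (mvar v * p) (single v 1 + t) = lookup (p :: ('v, 'k::field) mpoly) t"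
  by (induction p rule: poly_single_induct)
    (auto simp: mvar_times_single lookup_single when_def distrib_left lookup_add)

text \<open>Every exponent of \<open>mvar v * p\<close> is positive at \<open>v\<close>, so the term
  1 cancels none of them.\<close>

lemma keys_1_plus_mvar_mult:
  fixes p :: "('v, 'k::field) mpoly"
  assumes "p \<noteq> 0"
  shows "\<exists>t \<in> keys (1 + mvar v * p). lookup t v \<ge> 1"
proof -
  obtain t where "t \<in> keys p" using assms by (metis keys_eq_empty all_not_in_conv)
  moreover have "single v 1 + t \<noteq> 0"
  proof
    assume "single v 1 + t = 0"
    then have "lookup (single v 1 + t) v = 0" by simp
    then show False by (simp add: lookup_add)
  qed
  ultimately have "single v 1 + t \<in> keys (1 + mvar v * p)"
    by (simp add: in_keys_iff lookup_add lookup_mvar_mult[unfolded One_nat_def] lookup_one)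
  then show ?thesis by (rule bexI[rotated]) (simp add: lookup_add)
qed

text \<open>Modulo \<open>1 + y \<rho>\<close> the element \<open>\<rho>\<close> is a unit.\<close>

lemma not_dvd_power_mult:
  fixes \<rho> w :: "('v::linorder, 'k::field) mpoly"
  assumes "\<rho> \<noteq> 0" "w \<noteq> 0" "w \<in> poly_in (Y - {y})"
  shows "\<not> 1 + mvar y * \<rho> dvd \<rho> ^ k * w"
proof
  define x where "x = mvar y * \<rho>"
  assume "1 + mvar y * \<rho> dvd \<rho> ^ k * w"
  \<comment> \<open>The factor \<open>(- mvar y) ^ k\<close> turns \<open>\<rho> ^ k\<close> into
    \<open>(- x) ^ k\<close>, which is congruent to 1 modulo \<open>1 + x\<close>. So
    \<open>1 + x\<close> divides \<open>w\<close> itself.\<close>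
  then have "1 + x dvd (- mvar y) ^ k * (\<rho> ^ k * w)" by (simp add: x_def)
  also have "(- mvar y) ^ k * (\<rho> ^ k * w) = (- x) ^ k * w"
    by (simp add: x_def mult.assoc[symmetric] power_mult_distrib[symmetric])
  finally have "1 + x dvd (- x) ^ k * w" .
  moreover have "1 + x dvd 1 - (- x) ^ k"
    using one_diff_power_eq[of "- x" k] by simp
  then have "1 + x dvd (1 - (- x) ^ k) * w" by simp
  ultimately have "1 + x dvd (- x) ^ k * w + (1 - (- x) ^ k) * w" by (rule dvd_add)
  then have "1 + x dvd w" by (simp add: algebra_simps)
  then obtain v where v: "w = (1 + x) * v" by (rule dvdE)
  then have "v \<noteq> 0" using assms(2) by auto
  \<comment> \<open>Now degrees in \<open>y\<close> are compared: \<open>1 + x\<close> has positive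
    degree in \<open>y\<close>, hence so has its nonzero multiple \<open>w\<close>, in which
    \<open>y\<close> does not occur.\<close>
  obtain t where "t \<in> keys (1 + x)" "lookup t y \<ge> 1"
    using keys_1_plus_mvar_mult[OF assms(1)] x_def by blast
  then obtain s where "s \<in> keys w" "lookup s y \<ge> 1"
    using mult_weight_ge[of "\<lambda>t. lookup t y" v t "1 + x"] \<open>v \<noteq> 0\<close> v
    by (auto simp: lookup_add intro: order_trans)
  then have "y \<in> keys s" by (simp add: in_keys_iff)
  then show False using assms(3) \<open>s \<in> _\<close> by (auto simp: poly_in_def)
qed

section \<open>Submodules of B / P over F[Y], represented by their preimages in B\<close>

definition span_mod :: "'v set \<Rightarrow> ('v, 'k::field) mpoly set \<Rightarrow> ('a \<Rightarrow> ('v, 'k) mpoly) \<Rightarrow> 'a set \<Rightarrow> ('v, 'k) mpoly set"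
  where "span_mod Y P b A =
    {p. \<exists>u. (\<forall>a\<in>A. u a \<in> poly_in Y) \<and> p - (\<Sum>a\<in>A. u a * b a) \<in> P}"

context
  fixes Y :: "'v set" and P :: "('v, 'k::field) mpoly set" and b :: "'a \<Rightarrow> ('v, 'k) mpoly" and A :: "'a set"
  assumes P: "ring_ideal P"
begin

lemma span_mod_ideal: "p \<in> P \<Longrightarrow> p \<in> span_mod Y P b A"
  unfolding span_mod_def by (intro CollectI exI[of _ "\<lambda>_. 0"]) auto

lemma span_mod_base:
  assumes "finite A" "a \<in> A"
  shows "b a \<in> span_mod Y P b A"
proof -
  have "(\<Sum>x\<in>A. (if x = a then 1 else 0) * b x) = (\<Sum>x\<in>A. if x = a then b a else 0)"
    by (intro sum.cong) auto
  also have "\<dots> = b a" using assms by simp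
  finally show ?thesis
    unfolding span_mod_def using ring_ideal_0[OF P]
    by (intro CollectI exI[of _ "\<lambda>x. if x = a then 1 else 0"]) simp
qed

lemma span_mod_add:
  assumes "p \<in> span_mod Y P b A" "q \<in> span_mod Y P b A"
  shows "p + q \<in> span_mod Y P b A"
proof -
  obtain u v where *: "\<forall>a\<in>A. u a \<in> poly_in Y" "p - (\<Sum>a\<in>A. u a * b a) \<in> P"
    "\<forall>a\<in>A. v a \<in> poly_in Y" "q - (\<Sum>a\<in>A. v a * b a) \<in> P"
    using assms by (auto simp: span_mod_def)
  have eq: "p + q - (\<Sum>a\<in>A. (u a + v a) * b a) = (p - (\<Sum>a\<in>A. u a * b a)) + (q - (\<Sum>a\<in>A. v a * b a))"
    by (simp add: distrib_right sum.distrib)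
  have "p + q - (\<Sum>a\<in>A. (u a + v a) * b a) \<in> P"
    unfolding eq by (rule ring_ideal_add[OF P *(2,4)])
  then show ?thesis
    unfolding span_mod_def using *(1,3) by (intro CollectI exI[of _ "\<lambda>a. u a + v a"]) auto
qed

lemma span_mod_mult:
  assumes "p \<in> span_mod Y P b A" "c \<in> poly_in Y"
  shows "c * p \<in> span_mod Y P b A"
proof -
  obtain u where *: "\<forall>a\<in>A. u a \<in> poly_in Y" "p - (\<Sum>a\<in>A. u a * b a) \<in> P"
    using assms by (auto simp: span_mod_def)
  have "c * p - (\<Sum>a\<in>A. (c * u a) * b a) = c * (p - (\<Sum>a\<in>A. u a * b a))"
    by (simp add: right_diff_distrib sum_distrib_left mult.assoc)
  then have "c * p - (\<Sum>a\<in>A. (c * u a) * b a) \<in> P" using ring_ideal_mult[OF P *(2)] by simp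
  then show ?thesis
    unfolding span_mod_def using *(1) assms(2) by (intro CollectI exI[of _ "\<lambda>a. c * u a"]) auto
qed

lemma span_mod_sum: "(\<And>i. i \<in> S \<Longrightarrow> f i \<in> span_mod Y P b A) \<Longrightarrow> sum f S \<in> span_mod Y P b A"
  by (induction S rule: infinite_finite_induct) (auto intro: span_mod_add span_mod_ideal ring_ideal_0[OF P])

text \<open>The closure properties of the target span are premises because the facts of this context
  concern the fixed \<open>b\<close> and \<open>A\<close> only, whereas \<open>b'\<close> and
  \<open>A'\<close> vary here.\<close>

lemma span_mod_subset:
  assumes "p \<in> span_mod Y P b A" "\<And>a. a \<in> A \<Longrightarrow> c * b a \<in> span_mod Y P b' A'"
    "\<And>p q. p \<in> span_mod Y P b' A' \<Longrightarrow> q \<in> span_mod Y P b' A' \<Longrightarrow> p + q \<in> span_mod Y P b' A'"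
    "\<And>c p. p \<in> span_mod Y P b' A' \<Longrightarrow> c \<in> poly_in Y \<Longrightarrow> c * p \<in> span_mod Y P b' A'"
    "\<And>p. p \<in> P \<Longrightarrow> p \<in> span_mod Y P b' A'"
  shows "c * p \<in> span_mod Y P b' A'"
proof -
  obtain u where *: "\<forall>a\<in>A. u a \<in> poly_in Y" "p - (\<Sum>a\<in>A. u a * b a) \<in> P"
    using assms(1) by (auto simp: span_mod_def)
  have "(\<Sum>a\<in>S. u a * (c * b a)) \<in> span_mod Y P b' A'" if "S \<subseteq> A" for S
    using that
    by (induction S rule: infinite_finite_induct) (use * assms(2-5) ring_ideal_0[OF P] in auto)
  from this[of A] have "(\<Sum>a\<in>A. u a * (c * b a)) \<in> span_mod Y P b' A'" by simp
  moreover have "c * (p - (\<Sum>a\<in>A. u a * b a)) \<in> span_mod Y P b' A'"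
    using assms(5) ring_ideal_mult[OF P *(2)] by blast
  ultimately have "(\<Sum>a\<in>A. u a * (c * b a)) + c * (p - (\<Sum>a\<in>A. u a * b a)) \<in> span_mod Y P b' A'"
    using assms(3) by blast
  also have "(\<Sum>a\<in>A. u a * (c * b a)) + c * (p - (\<Sum>a\<in>A. u a * b a)) = c * p"
    by (simp add: right_diff_distrib sum_distrib_left mult.left_commute)
  finally show ?thesis .
qed

end

text \<open>The relation is written as a polynomial in \<open>mvar j\<close>, and \<open>s\<close>
  is its leading coefficient. Its degree \<open>e\<close> is positive because \<open>P\<close>
  contains no nonzero element of F[Y].\<close>

lemma poly_in_algebraic_cases:
  fixes P :: "('v, 'k::field) mpoly set"
  assumes P: "prime_ideal P" and PY: "P \<inter> poly_in Y \<subseteq> {0}"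
    and r: "r \<in> poly_in (insert j Y)" "r \<noteq> 0" "r \<in> P"
  obtains e s c where "e > 0" "s \<in> poly_in Y" "s \<noteq> 0" "\<And>i. c i \<in> poly_in Y"
    "s * mvar j ^ e - (\<Sum>i<e. c i * mvar j ^ i) \<in> P"
proof -
  obtain n c where c: "\<And>i. c i \<in> poly_in Y" "\<And>i. i \<ge> n \<Longrightarrow> c i = 0" "r = (\<Sum>i<n. c i * mvar j ^ i)"
    using poly_in_insert_cases[OF r(1)] by metis
  have "\<exists>i. c i \<noteq> 0" using r(2) c(3) by (auto intro: ccontr)
  have fin: "finite {i. c i \<noteq> 0}"
    using c(2) by (intro finite_subset[of "{i. c i \<noteq> 0}" "{..<n}"]) (auto simp: not_less[symmetric])
  define e where "e = Max {i. c i \<noteq> 0}"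
  have e: "c e \<noteq> 0" "\<And>i. c i \<noteq> 0 \<Longrightarrow> i \<le> e"
    using Max_in[OF fin] Max_ge[OF fin] \<open>\<exists>i. c i \<noteq> 0\<close> by (auto simp: e_def)
  have "e < n" using e(1) c(2) by (meson not_less)
  have zero: "c i = 0" if "i > e" for i using e(2)[of i] that by (cases "c i = 0") auto
  have "r = (\<Sum>i<Suc e. c i * mvar j ^ i)"
    unfolding c(3) using \<open>e < n\<close> zero by (intro sum.mono_neutral_right) (auto simp: not_less Suc_le_eq)
  then have r': "c e * mvar j ^ e - (\<Sum>i<e. - c i * mvar j ^ i) = r"
    by (simp add: sum_negf)
  have "e > 0"
  proof (rule ccontr)
    assume "\<not> e > 0"
    then have "c e \<in> P" using r' r(3) by simp
    then show False using PY c(1) e(1) by blast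
  qed
  then show ?thesis
    using that[of e "c e" "\<lambda>i. - c i"] c(1) e(1) r' r(3) by auto
qed

text \<open>The generators \<open>b a\<close> are the monomials in \<open>X\<close> whose exponent
  at each \<open>j\<close> is below the degree \<open>e j\<close> of a relation of
  \<open>mvar j\<close> over F[Y]. Reducing higher powers costs the leading coefficients
  \<open>s j\<close>, whose product is \<open>\<sigma>\<close>. The index \<open>a0\<close> is the
  zero exponent.\<close>

lemma algebraic_span_mod:
  fixes P :: "('v::linorder, 'k::field) mpoly set"
  assumes P: "prime_ideal P" and PY: "P \<inter> poly_in Y \<subseteq> {0}" and X: "finite X"
    and alg: "\<And>j. j \<in> X \<Longrightarrow> \<exists>r \<in> poly_in (insert j Y). r \<noteq> 0 \<and> r \<in> P"
    and rest: "\<And>j. j \<notin> X \<Longrightarrow> j \<notin> Y \<Longrightarrow> mvar j \<in> P"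
  obtains A :: "('v \<Rightarrow> nat) set" and a0 b \<sigma> where "finite A" "a0 \<in> A" "b a0 = 1"
    "\<sigma> \<in> poly_in Y" "\<sigma> \<noteq> 0" "\<And>p. \<exists>k. \<sigma> ^ k * p \<in> span_mod Y P b A"
proof -
  have Pi: "ring_ideal P" using P by (simp add: prime_ideal_def)
  have ex: "\<exists>e s c. e > 0 \<and> s \<in> poly_in Y \<and> s \<noteq> 0 \<and> (\<forall>i. c i \<in> poly_in Y) \<and>
      s * mvar j ^ e - (\<Sum>i<e. c i * mvar j ^ i) \<in> P" if j: "j \<in> X" for j
  proof -
    obtain r where r: "r \<in> poly_in (insert j Y)" "r \<noteq> 0" "r \<in> P" using alg[OF j] by blast
    show ?thesis by (rule poly_in_algebraic_cases[OF P PY r]) blast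
  qed
  have "\<forall>j\<in>X. \<exists>e. \<exists>s c. e > 0 \<and> s \<in> poly_in Y \<and> s \<noteq> 0 \<and> (\<forall>i. c i \<in> poly_in Y) \<and>
      s * mvar j ^ e - (\<Sum>i<e. c i * mvar j ^ i) \<in> P" using ex by blast
  from bchoice[OF this] obtain e where "\<forall>j\<in>X. \<exists>s c. e j > 0 \<and> s \<in> poly_in Y \<and> s \<noteq> 0 \<and>
      (\<forall>i. c i \<in> poly_in Y) \<and> s * mvar j ^ e j - (\<Sum>i<e j. c i * mvar j ^ i) \<in> P" ..
  from bchoice[OF this] obtain s where "\<forall>j\<in>X. \<exists>c. e j > 0 \<and> s j \<in> poly_in Y \<and> s j \<noteq> 0 \<and>
      (\<forall>i. c i \<in> poly_in Y) \<and> s j * mvar j ^ e j - (\<Sum>i<e j. c i * mvar j ^ i) \<in> P" ..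
  from bchoice[OF this] obtain c where c: "\<forall>j\<in>X. e j > 0 \<and> s j \<in> poly_in Y \<and> s j \<noteq> 0 \<and>
      (\<forall>i. c j i \<in> poly_in Y) \<and> s j * mvar j ^ e j - (\<Sum>i<e j. c j i * mvar j ^ i) \<in> P" ..
  have rel: "e j > 0" "s j \<in> poly_in Y" "s j \<noteq> 0" "c j i \<in> poly_in Y"
    "s j * mvar j ^ e j - (\<Sum>i<e j. c j i * mvar j ^ i) \<in> P" if "j \<in> X" for j i
    using c that by blast+
  define A where "A = PiE X (\<lambda>j. {..<e j})"
  define b where "b a = (\<Prod>j\<in>X. mvar j ^ a j :: ('v, 'k) mpoly)" for a
  define a0 where "a0 = restrict (\<lambda>_. 0::nat) X"
  define \<sigma> where "\<sigma> = prod s X"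
  let ?S = "span_mod Y P b A"
  note span = span_mod_ideal[OF Pi] span_mod_add[OF Pi] span_mod_mult[OF Pi] span_mod_sum[OF Pi]
  have A: "finite A" unfolding A_def using X by (intro finite_PiE) auto
  have a0: "a0 \<in> A" "b a0 = 1" using rel(1) by (auto simp: A_def a0_def b_def)
  have \<sigma>: "\<sigma> \<in> poly_in Y" "\<sigma> \<noteq> 0" using rel X by (auto simp: \<sigma>_def)
  \<comment> \<open>Multiplying by \<open>mvar j\<close> either stays below \<open>e j\<close> or
    reaches it exactly. In the latter case the factor \<open>s j\<close> of \<open>\<sigma>\<close>
    is used to rewrite \<open>mvar j ^ e j\<close> in lower powers.\<close>
  have step1: "\<sigma> * mvar j * b a \<in> ?S" if "a \<in> A" "j \<in> X" for a j
  proof -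
    define M where "M = (\<Prod>i\<in>X - {j}. mvar i ^ a i :: ('v, 'k) mpoly)"
    have b_upd: "b (a(j := i)) = mvar j ^ i * M" for i
      unfolding b_def M_def using that X by (subst prod.remove[of X j]) auto
    have ba: "b a = mvar j ^ a j * M" using b_upd[of "a j"] by simp
    have A_upd: "a(j := i) \<in> A" if "i < e j" for i
      using \<open>a \<in> A\<close> \<open>j \<in> X\<close> that by (auto simp: A_def PiE_iff extensional_def)
    have "a j < e j" using that by (auto simp: A_def)
    show ?thesis
    proof (cases "Suc (a j) < e j")
      case True
      have eq: "\<sigma> * mvar j * b a = \<sigma> * b (a(j := Suc (a j)))"
        by (simp add: ba b_upd ac_simps)
      show ?thesis unfolding eq by (rule span(3)[OF span_mod_base[OF Pi A A_upd[OF True]] \<sigma>(1)])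
    next
      case False
      then have ej: "e j = Suc (a j)" using \<open>a j < e j\<close> by simp
      define \<sigma>' where "\<sigma>' = prod s (X - {j})"
      have \<sigma>': "\<sigma> = \<sigma>' * s j" "\<sigma>' \<in> poly_in Y"
        unfolding \<sigma>_def \<sigma>'_def using that X rel(2) by (auto simp: prod.remove[of X j] mult.commute)
      have "\<sigma> * mvar j * b a = \<sigma>' * M * (s j * mvar j ^ e j)"
        by (simp add: ba ej \<sigma>'(1) ac_simps)
      also have "\<dots> = \<sigma>' * M * (s j * mvar j ^ e j - (\<Sum>i<e j. c j i * mvar j ^ i)) +
          \<sigma>' * (\<Sum>i<e j. c j i * b (a(j := i)))"
        by (simp add: right_diff_distrib sum_distrib_left b_upd ac_simps)
      also have "\<dots> \<in> ?S"
      proof (rule span(2))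
        show "\<sigma>' * M * (s j * mvar j ^ e j - (\<Sum>i<e j. c j i * mvar j ^ i)) \<in> ?S"
          by (rule span(1), rule ring_ideal_mult[OF Pi], rule rel(5)[OF \<open>j \<in> X\<close>])
        show "\<sigma>' * (\<Sum>i<e j. c j i * b (a(j := i))) \<in> ?S"
        proof (rule span(3)[OF span(4) \<sigma>'(2)])
          fix i assume "i \<in> {..<e j}"
          then show "c j i * b (a(j := i)) \<in> ?S"
            using span(3)[OF span_mod_base[OF Pi A A_upd] rel(4)[OF \<open>j \<in> X\<close>]] by simp
        qed
      qed
      finally show ?thesis .
    qed
  qed
  have step2: "\<sigma> * mvar j * p \<in> ?S" if p: "p \<in> ?S" for p j
  proof (cases "j \<in> X")
    case True
    then show ?thesis
      using span_mod_subset[OF Pi p, of "\<sigma> * mvar j" b A] step1 span by blast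
  next
    case False
    show ?thesis
    proof (cases "j \<in> Y")
      case True
      then have "\<sigma> * mvar j \<in> poly_in Y" using poly_in_mult[OF \<sigma>(1), of "mvar j"] by simp
      then show ?thesis by (rule span(3)[OF p])
    next
      case False
      then have "mvar j \<in> P" using rest \<open>j \<notin> X\<close> by blast
      then have "(\<sigma> * p) * mvar j \<in> P" by (rule ring_ideal_mult[OF Pi])
      then show ?thesis using span(1) by (simp add: ac_simps)
    qed
  qed
  have "\<exists>k. \<sigma> ^ k * p \<in> ?S" for p
  proof (induction p rule: poly_in_induct[where V = UNIV, simplified, case_names const add mult])
    case (const d)
    have "const d * b a0 \<in> ?S" using span(3)[OF span_mod_base[OF Pi A a0(1)]] by simp
    then show ?case using a0 by (intro exI[of _ 0]) simp
  next
    case (add p q)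
    then obtain k l where kl: "\<sigma> ^ k * p \<in> ?S" "\<sigma> ^ l * q \<in> ?S" by blast
    have "\<sigma> ^ l * (\<sigma> ^ k * p) + \<sigma> ^ k * (\<sigma> ^ l * q) \<in> ?S"
      by (rule span(2)[OF span(3)[OF kl(1) poly_in_power[OF \<sigma>(1)]] span(3)[OF kl(2) poly_in_power[OF \<sigma>(1)]]])
    then show ?case by (intro exI[of _ "k + l"]) (simp add: power_add algebra_simps)
  next
    case (mult v p)
    then obtain k where "\<sigma> ^ k * p \<in> ?S" by blast
    then have "\<sigma> * mvar v * (\<sigma> ^ k * p) \<in> ?S" by (rule step2)
    then show ?case by (intro exI[of _ "Suc k"]) (simp add: ac_simps)
  qed
  then show ?thesis using that A a0 \<sigma> by blast
qed

text \<open>\<open>B\<close> is a maximal subset of \<open>A\<close> that contains \<open>a0\<close>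
  and is linearly independent over F[Y] modulo \<open>P\<close>. By maximality each remaining
  generator has a nonzero multiple in the span of \<open>B\<close>, and \<open>\<tau>\<close>
  collects the multipliers. The singleton \<open>{a0}\<close> qualifies because
  \<open>b a0 = 1\<close>; keeping 1 in the basis lets coefficients of elements of F[Y] be read
  off.\<close>

lemma maximal_independent_span_mod:
  fixes P :: "('v::linorder, 'k::field) mpoly set"
  assumes P: "prime_ideal P" and PY: "P \<inter> poly_in Y \<subseteq> {0}"
    and A: "finite A" "a0 \<in> A" "b a0 = 1"
  obtains B \<tau> where "B \<subseteq> A" "a0 \<in> B"
    "\<forall>u. (\<forall>a\<in>B. u a \<in> poly_in Y) \<longrightarrow> (\<Sum>a\<in>B. u a * b a) \<in> P \<longrightarrow> (\<forall>a\<in>B. u a = 0)"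
    "\<tau> \<in> poly_in Y" "\<tau> \<noteq> 0" "\<And>p. p \<in> span_mod Y P b A \<Longrightarrow> \<tau> * p \<in> span_mod Y P b B"
proof -
  have Pi: "ring_ideal P" using P by (simp add: prime_ideal_def)
  define ind where "ind B \<longleftrightarrow> (\<forall>u. (\<forall>a\<in>B. u a \<in> poly_in Y) \<longrightarrow> (\<Sum>a\<in>B. u a * b a) \<in> P \<longrightarrow> (\<forall>a\<in>B. u a = 0))" for B
  let ?F = "{B. B \<subseteq> A \<and> a0 \<in> B \<and> ind B}"
  have "{a0} \<in> ?F" using A PY by (auto simp: ind_def)
  moreover have "finite ?F" using A(1) by simp
  ultimately obtain B where B: "B \<in> ?F" and max: "\<And>B'. B' \<in> ?F \<Longrightarrow> B \<subseteq> B' \<Longrightarrow> B' = B"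
    using finite_has_maximal[of ?F] by (metis (no_types, lifting) empty_iff)
  have fB: "finite B" using B A(1) finite_subset by auto
  have "\<exists>s. s \<in> poly_in Y \<and> s \<noteq> 0 \<and> s * b t \<in> span_mod Y P b B" if "t \<in> A" for t
  proof (cases "t \<in> B")
    case True
    then show ?thesis using span_mod_base[OF Pi fB True] by (intro exI[of _ 1]) auto
  next
    case False
    then have "\<not> ind (insert t B)" using max[of "insert t B"] B that by auto
    then obtain u where u: "\<forall>a\<in>insert t B. u a \<in> poly_in Y" "(\<Sum>a\<in>insert t B. u a * b a) \<in> P"
      "\<exists>a\<in>insert t B. u a \<noteq> 0" unfolding ind_def by blast
    have sum: "(\<Sum>a\<in>insert t B. u a * b a) = u t * b t + (\<Sum>a\<in>B. u a * b a)"
      using False fB by simp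
    have "u t \<noteq> 0"
    proof
      assume "u t = 0"
      then have "(\<Sum>a\<in>B. u a * b a) \<in> P" using u(2) sum by simp
      then show False using B u(1,3) \<open>u t = 0\<close> by (auto simp: ind_def)
    qed
    moreover have "u t * b t - (\<Sum>a\<in>B. (- u a) * b a) \<in> P" using u(2) sum by (simp add: sum_negf)
    then have "u t * b t \<in> span_mod Y P b B"
      unfolding span_mod_def using u(1) by (intro CollectI exI[of _ "\<lambda>a. - u a"]) auto
    ultimately show ?thesis using u(1) by blast
  qed
  then obtain s where s: "\<And>t. t \<in> A \<Longrightarrow> s t \<in> poly_in Y" "\<And>t. t \<in> A \<Longrightarrow> s t \<noteq> 0"
    "\<And>t. t \<in> A \<Longrightarrow> s t * b t \<in> span_mod Y P b B" by metis
  define \<tau> where "\<tau> = prod s A"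
  have "\<tau> * b t \<in> span_mod Y P b B" if "t \<in> A" for t
  proof -
    have eq: "\<tau> * b t = prod s (A - {t}) * (s t * b t)"
      unfolding \<tau>_def using A(1) that by (simp add: prod.remove[of A t] ac_simps)
    have "prod s (A - {t}) \<in> poly_in Y" using s(1) by auto
    then show ?thesis unfolding eq by (rule span_mod_mult[OF Pi s(3)[OF that]])
  qed
  then have "\<tau> * p \<in> span_mod Y P b B" if "p \<in> span_mod Y P b A" for p
    using span_mod_subset[OF Pi that, of \<tau> b B] span_mod_add[OF Pi] span_mod_mult[OF Pi]
      span_mod_ideal[OF Pi] by blast
  moreover have "\<tau> \<in> poly_in Y" "\<tau> \<noteq> 0" unfolding \<tau>_def using s A(1) by auto
  ultimately show ?thesis using that[of B \<tau>] B unfolding ind_def by auto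
qed

text \<open>With \<open>\<rho> = \<sigma> * \<tau>\<close> the ideal generated by \<open>P\<close>
  and \<open>q = 1 + y \<rho>\<close> is shown to avoid the nonzero elements of F[Y - {y}], so some
  prime above it avoids them too. The inclusion is strict since \<open>q\<close> is a nonzero
  element of F[Y] and thus not in \<open>P\<close>.\<close>

lemma prime_ideal_step:
  fixes P :: "('v::linorder, 'k::field) mpoly set"
  assumes P: "prime_ideal P" and PY: "P \<inter> poly_in Y \<subseteq> {0}" and X: "finite X"
    and alg: "\<And>j. j \<in> X \<Longrightarrow> \<exists>r \<in> poly_in (insert j Y). r \<noteq> 0 \<and> r \<in> P"
    and rest: "\<And>j. j \<notin> X \<Longrightarrow> j \<notin> Y \<Longrightarrow> mvar j \<in> P"
    and y: "y \<in> Y"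
  obtains Q where "prime_ideal Q" "P \<subset> Q" "Q \<inter> poly_in (Y - {y}) \<subseteq> {0}"
proof -
  have Pi: "ring_ideal P" using P by (simp add: prime_ideal_def)
  obtain A :: "('v \<Rightarrow> nat) set" and a0 b \<sigma> where A: "finite A" "a0 \<in> A" "b a0 = 1"
    and \<sigma>: "\<sigma> \<in> poly_in Y" "\<sigma> \<noteq> 0" "\<And>p. \<exists>k. \<sigma> ^ k * p \<in> span_mod Y P b A"
    by (rule algebraic_span_mod[OF P PY X alg rest]; (assumption | rule that))
  obtain B \<tau> where B: "B \<subseteq> A" "a0 \<in> B"
    "\<forall>u. (\<forall>a\<in>B. u a \<in> poly_in Y) \<longrightarrow> (\<Sum>a\<in>B. u a * b a) \<in> P \<longrightarrow> (\<forall>a\<in>B. u a = 0)"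
    and \<tau>: "\<tau> \<in> poly_in Y" "\<tau> \<noteq> 0" "\<And>p. p \<in> span_mod Y P b A \<Longrightarrow> \<tau> * p \<in> span_mod Y P b B"
    by (rule maximal_independent_span_mod[where b = b, OF P PY A]) (rule that)
  have fB: "finite B" using B(1) A(1) by (rule finite_subset)
  define \<rho> where "\<rho> = \<sigma> * \<tau>"
  have \<rho>: "\<rho> \<noteq> 0" "\<rho> \<in> poly_in Y" using \<sigma> \<tau> by (auto simp: \<rho>_def)
  define q where "q = 1 + mvar y * \<rho>"
  have qY: "q \<in> poly_in Y" unfolding q_def by (intro poly_in_add poly_in_mult poly_in_1 \<rho>(2)) (simp add: y)
  have "q \<noteq> 0" using keys_1_plus_mvar_mult[OF \<rho>(1), of y] by (auto simp: q_def)
  define W where "W = poly_in (Y - {y}) - {0 :: ('v, 'k) mpoly}"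
  define I where "I = {p + q * h |p h. p \<in> P}"
  have "I \<inter> W = {}"
  proof (rule ccontr)
    assume "I \<inter> W \<noteq> {}"
    then obtain p h where ph: "p \<in> P" "p + q * h \<in> W" by (auto simp: I_def)
    define w where "w = p + q * h"
    have w: "w \<in> poly_in (Y - {y})" "w \<noteq> 0" using ph by (auto simp: W_def w_def)
    have wY: "w \<in> poly_in Y" using w(1) poly_in_mono[of "Y - {y}" Y] by blast
    obtain k where "\<sigma> ^ k * h \<in> span_mod Y P b A" using \<sigma>(3) by blast
    then have "\<tau> * (\<sigma> ^ k * h) \<in> span_mod Y P b B" by (rule \<tau>(3))
    then obtain u where u: "\<forall>a\<in>B. u a \<in> poly_in Y" "\<tau> * (\<sigma> ^ k * h) - (\<Sum>a\<in>B. u a * b a) \<in> P"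
      by (auto simp: span_mod_def)
    \<comment> \<open>Suppose \<open>w = p + q * h\<close>, and multiply by
      \<open>\<tau> * \<sigma> ^ k\<close>, so that \<open>h\<close> becomes the combination given
      by \<open>u\<close>. The \<open>v a\<close> are the coefficients of the resulting relation;
      \<open>w\<close> lies in F[Y] and therefore enters only at \<open>a0\<close>.\<close>
    define v where "v a = (if a = a0 then q * u a - \<tau> * \<sigma> ^ k * w else q * u a)" for a
    have "(\<Sum>a\<in>B. v a * b a) = (\<Sum>a\<in>B. q * u a * b a) - \<tau> * \<sigma> ^ k * w"
    proof -
      have "(\<Sum>a\<in>B. v a * b a) = (\<Sum>a\<in>B. q * u a * b a - (if a = a0 then \<tau> * \<sigma> ^ k * w else 0))"
        using A(3) by (intro sum.cong) (auto simp: v_def left_diff_distrib)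
      then show ?thesis using fB B(2) by (simp add: sum_subtractf)
    qed
    also have "\<dots> = - (q * (\<tau> * (\<sigma> ^ k * h) - (\<Sum>a\<in>B. u a * b a))) - \<tau> * \<sigma> ^ k * p"
      by (simp add: w_def algebra_simps sum_distrib_left)
    also have "\<dots> \<in> P"
      by (rule ring_ideal_diff[OF Pi], rule ring_ideal_uminus[OF Pi], rule ring_ideal_mult[OF Pi],
        rule u(2), rule ring_ideal_mult[OF Pi], rule ph(1))
    finally have sum_P: "(\<Sum>a\<in>B. v a * b a) \<in> P" .
    have "v a \<in> poly_in Y" if "a \<in> B" for a
    proof -
      have "q * u a \<in> poly_in Y" using u(1) that by (intro poly_in_mult qY) blast
      moreover have "\<tau> * \<sigma> ^ k * w \<in> poly_in Y" by (intro poly_in_mult poly_in_power \<tau>(1) \<sigma>(1) wY)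
      ultimately show ?thesis by (auto simp: v_def intro: poly_in_diff)
    qed
    with sum_P have "v a0 = 0" using B(2,3) by blast
    then have "\<tau> * \<sigma> ^ k * w = q * u a0" by (simp add: v_def)
    \<comment> \<open>The factor \<open>\<sigma> * \<tau> ^ k\<close> completes
      \<open>\<tau> * \<sigma> ^ k\<close> to \<open>\<rho> ^ Suc k\<close>.\<close>
    then have "q dvd \<sigma> * \<tau> ^ k * (\<tau> * \<sigma> ^ k * w)" by simp
    then have "q dvd \<rho> ^ Suc k * w" by (simp add: \<rho>_def power_mult_distrib ac_simps)
    then show False using not_dvd_power_mult[OF \<rho>(1) w(2,1)] q_def by blast
  qed
  moreover have "1 \<in> W" "\<And>a b. a \<in> W \<Longrightarrow> b \<in> W \<Longrightarrow> a * b \<in> W" by (auto simp: W_def)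
  moreover have "ring_ideal I" unfolding I_def by (rule ring_ideal_adjoin[OF Pi])
  ultimately obtain Q where Q: "prime_ideal Q" "I \<subseteq> Q" "Q \<inter> W = {}"
    using prime_ideal_avoiding[of I W] by metis
  have "P \<subseteq> I" by (force simp: I_def intro: exI[of _ 0])
  moreover have "q \<in> I" using ring_ideal_0[OF Pi] by (force simp: I_def intro: exI[of _ 0] exI[of _ 1])
  moreover have "q \<notin> P" using qY \<open>q \<noteq> 0\<close> PY by blast
  ultimately show ?thesis using that[of Q] Q by (auto simp: W_def)
qed

text \<open>One variable of \<open>Y\<close> is spent at each step. The finite set \<open>N\<close>
  contains all variables that are not already in \<open>P\<close>, so only finitely many relations
  are ever needed.\<close>

lemma prime_ideal_chain:
  fixes P :: "('v::linorder, 'k::field) mpoly set"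
  assumes "prime_ideal P" "P \<inter> poly_in Y \<subseteq> {0}" "finite N" "Y \<subseteq> N" "\<And>j. j \<notin> N \<Longrightarrow> mvar j \<in> P"
  shows "\<exists>R. R 0 = P \<and> (\<forall>i\<le>card Y. prime_ideal (R i)) \<and> (\<forall>i<card Y. R i \<subset> R (Suc i))"
  using assms
proof (induction "card Y" arbitrary: P Y)
  case 0
  then show ?case by (intro exI[of _ "\<lambda>_. P"]) auto
next
  case (Suc d)
  have fY: "finite Y" using Suc.prems finite_subset by blast
  \<comment> \<open>\<open>Y\<close> is enlarged to a maximal \<open>Z\<close>, over which the other
    variables are algebraic modulo \<open>P\<close>. The prime found for \<open>Z - {y}\<close> also
    serves the smaller set \<open>Y - {y}\<close>.\<close>
  let ?F = "{Z. Y \<subseteq> Z \<and> Z \<subseteq> N \<and> P \<inter> poly_in Z \<subseteq> {0}}"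
  have "Y \<in> ?F" "finite ?F" using Suc.prems by auto
  then obtain Z where Z: "Z \<in> ?F" and max: "\<And>Z'. Z' \<in> ?F \<Longrightarrow> Z \<subseteq> Z' \<Longrightarrow> Z' = Z"
    using finite_has_maximal[of ?F] by (metis (no_types, lifting) empty_iff)
  have alg: "\<exists>r \<in> poly_in (insert j Z). r \<noteq> 0 \<and> r \<in> P" if "j \<in> N - Z" for j
    using max[of "insert j Z"] Z that by auto
  obtain y where y: "y \<in> Y" using Suc.hyps(2) by (metis card.empty ex_in_conv nat.distinct(1))
  obtain Q where Q: "prime_ideal Q" "P \<subset> Q" "Q \<inter> poly_in (Z - {y}) \<subseteq> {0}"
    by (rule prime_ideal_step[of P Z "N - Z" y]) (use Suc.prems Z y alg in auto)
  have "poly_in (Y - {y}) \<subseteq> (poly_in (Z - {y}) :: ('v, 'k) mpoly set)"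
    using Z poly_in_mono[of "Y - {y}" "Z - {y}"] by blast
  then have "Q \<inter> poly_in (Y - {y}) \<subseteq> {0}" using Q(3) by blast
  moreover have "d = card (Y - {y})" using Suc.hyps(2) y fY by simp
  moreover have "Y - {y} \<subseteq> N" "\<And>j. j \<notin> N \<Longrightarrow> mvar j \<in> Q" using Suc.prems Q(2) by auto
  ultimately have "\<exists>R. R 0 = Q \<and> (\<forall>i\<le>d. prime_ideal (R i)) \<and> (\<forall>i<d. R i \<subset> R (Suc i))"
    using Suc.hyps(1)[of "Y - {y}" Q] Q(1) Suc.prems(3) by simp
  then obtain R where R: "R 0 = Q" "\<forall>i\<le>d. prime_ideal (R i)" "\<forall>i<d. R i \<subset> R (Suc i)" by blast
  show ?case
    unfolding Suc.hyps(2)[symmetric]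
  proof (intro exI[of _ "case_nat P R"] conjI allI impI)
    fix i assume "i \<le> Suc d"
    then show "prime_ideal (case_nat P R i)" using R(2) Suc.prems(1) by (cases i) auto
  next
    fix i assume "i < Suc d"
    then show "case_nat P R i \<subset> case_nat P R (Suc i)" using R Q(2) by (cases i) auto
  qed simp
qed

section \<open>Krull dimension of a homomorphic image\<close>

text \<open>\<open>R\<close> is not assumed to be a ring. The special fiber ring comes with bare
  operations on families of cosets, and its ring axioms are inherited from B through the surjection
  \<open>\<psi>\<close>.\<close>

locale comm_ring_image =
  fixes R :: "('a, 'b) ring_scheme" (structure) and \<psi> :: "'r::comm_ring_1 \<Rightarrow> 'a"
  assumes range_\<psi>: "range \<psi> = carrier R"
    and \<psi>_add: "\<psi> (p + q) = \<psi> p \<oplus> \<psi> q"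
    and \<psi>_mult: "\<psi> (p * q) = \<psi> p \<otimes> \<psi> q"
    and \<psi>_zero: "\<psi> 0 = \<zero>"
    and \<psi>_one: "\<psi> 1 = \<one>"
begin

lemma \<psi>_closed [simp]: "\<psi> p \<in> carrier R"
  using range_\<psi> by blast

lemma carrierE:
  assumes "x \<in> carrier R"
  obtains p where "x = \<psi> p"
  using assms range_\<psi> by blast

lemma cring: "cring R"
proof (rule cringI)
  show "abelian_group R"
  proof (rule abelian_groupI)
    fix x y z assume "x \<in> carrier R" "y \<in> carrier R" "z \<in> carrier R"
    then obtain p q r where "x = \<psi> p" "y = \<psi> q" "z = \<psi> r" by (meson carrierE)
    then show "x \<oplus> y \<oplus> z = x \<oplus> (y \<oplus> z)"
      by (simp add: \<psi>_add[symmetric] add.assoc)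
  next
    fix x y assume "x \<in> carrier R" "y \<in> carrier R"
    then obtain p q where "x = \<psi> p" "y = \<psi> q" by (meson carrierE)
    then show "x \<oplus> y = y \<oplus> x" "x \<oplus> y \<in> carrier R"
      by (simp_all add: \<psi>_add[symmetric] add.commute)
  next
    fix x assume "x \<in> carrier R"
    then obtain p where x: "x = \<psi> p" by (meson carrierE)
    then show "\<zero> \<oplus> x = x" by (simp add: \<psi>_add[symmetric] \<psi>_zero[symmetric])
    show "\<exists>y\<in>carrier R. y \<oplus> x = \<zero>"
      using x by (intro bexI[of _ "\<psi> (- p)"]) (simp_all add: \<psi>_add[symmetric] \<psi>_zero)
  qed (simp add: \<psi>_zero[symmetric])
  show "comm_monoid R"
  proof (rule comm_monoidI)
    fix x y z assume "x \<in> carrier R" "y \<in> carrier R" "z \<in> carrier R"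
    then obtain p q r where "x = \<psi> p" "y = \<psi> q" "z = \<psi> r" by (meson carrierE)
    then show "x \<otimes> y \<otimes> z = x \<otimes> (y \<otimes> z)"
      by (simp add: \<psi>_mult[symmetric] mult.assoc)
  next
    fix x y assume "x \<in> carrier R" "y \<in> carrier R"
    then obtain p q where "x = \<psi> p" "y = \<psi> q" by (meson carrierE)
    then show "x \<otimes> y = y \<otimes> x" "x \<otimes> y \<in> carrier R"
      by (simp_all add: \<psi>_mult[symmetric] mult.commute)
  next
    fix x assume "x \<in> carrier R"
    then obtain p where "x = \<psi> p" by (meson carrierE)
    then show "\<one> \<otimes> x = x" by (simp add: \<psi>_mult[symmetric] \<psi>_one[symmetric])
  qed (simp add: \<psi>_one[symmetric])
  fix x y z assume "x \<in> carrier R" "y \<in> carrier R" "z \<in> carrier R"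
  then obtain p q r where "x = \<psi> p" "y = \<psi> q" "z = \<psi> r" by (meson carrierE)
  then show "(x \<oplus> y) \<otimes> z = x \<otimes> z \<oplus> y \<otimes> z"
    by (simp add: \<psi>_add[symmetric] \<psi>_mult[symmetric] distrib_right)
qed

lemma \<psi>_uminus: "\<psi> (- p) = \<ominus> \<psi> p"
proof -
  interpret cring R by (rule cring)
  have "\<psi> (- p) \<oplus> \<psi> p = \<zero>" by (simp add: \<psi>_add[symmetric] \<psi>_zero)
  then show ?thesis by (simp add: minus_equality)
qed

lemma prime_ideal_vimage:
  assumes "primeideal Q R"
  shows "prime_ideal (\<psi> -` Q)"
proof -
  interpret primeideal Q R by fact
  have "\<one> \<notin> Q" using one_imp_carrier I_notcarr by blast
  then show ?thesis
    using I_prime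
    by (auto simp: prime_ideal_def ring_ideal_def \<psi>_add \<psi>_mult \<psi>_zero \<psi>_one I_l_closed)
qed

text \<open>Because \<open>P\<close> contains the kernel, \<open>\<psi> p\<close> lies in the image
  of \<open>P\<close> only if \<open>p\<close> lies in \<open>P\<close>. Everything else follows
  from this equivalence, \<open>mem\<close> below.\<close>

lemma primeideal_image:
  assumes P: "prime_ideal P" and K: "{p. \<psi> p = \<zero>} \<subseteq> P"
  shows "primeideal (\<psi> ` P) R" and "\<psi> -` \<psi> ` P = P"
proof -
  interpret cring R by (rule cring)
  have Pi: "ring_ideal P" using P by (simp add: prime_ideal_def)
  have mem: "\<psi> p \<in> \<psi> ` P \<longleftrightarrow> p \<in> P" for p
  proof
    assume "\<psi> p \<in> \<psi> ` P"
    then obtain q where q: "q \<in> P" "\<psi> p = \<psi> q" by blast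
    have "\<psi> (p - q) = \<psi> p \<oplus> \<psi> (- q)" by (simp add: \<psi>_add[symmetric])
    also have "\<dots> = \<zero>" by (simp add: \<psi>_uminus q r_neg)
    finally have "p - q \<in> P" using K by blast
    then have "(p - q) + q \<in> P" using ring_ideal_add[OF Pi] q(1) by blast
    then show "p \<in> P" by simp
  qed simp
  show "\<psi> -` \<psi> ` P = P" using mem by auto
  show "primeideal (\<psi> ` P) R"
  proof (rule primeidealI2)
    show "additive_subgroup (\<psi> ` P) R"
    proof (rule additive_subgroup.intro, rule group.subgroupI)
      show "group (add_monoid R)" by (rule add.group_axioms)
      show "\<psi> ` P \<subseteq> carrier (add_monoid R)" by auto
      show "\<psi> ` P \<noteq> {}" using ring_ideal_0[OF Pi] by auto
      show "inv\<^bsub>add_monoid R\<^esub> a \<in> \<psi> ` P" if a: "a \<in> \<psi> ` P" for a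
      proof -
        obtain p where "p \<in> P" "a = \<psi> p" using a by blast
        then have "\<ominus> a \<in> \<psi> ` P" using ring_ideal_uminus[OF Pi] by (metis \<psi>_uminus imageI)
        then show ?thesis by (simp add: a_inv_def)
      qed
      show "a \<otimes>\<^bsub>add_monoid R\<^esub> b \<in> \<psi> ` P" if "a \<in> \<psi> ` P" "b \<in> \<psi> ` P" for a b
        using that ring_ideal_add[OF Pi] by (auto simp: \<psi>_add[symmetric])
    qed
    show "cring R" by (rule cring)
    fix a x assume "a \<in> \<psi> ` P" "x \<in> carrier R"
    then obtain p q where "p \<in> P" "a = \<psi> p" "x = \<psi> q" by (metis carrierE imageE)
    then show "x \<otimes> a \<in> \<psi> ` P" "a \<otimes> x \<in> \<psi> ` P"
      using ring_ideal_mult[OF Pi, of p q] by (auto simp: \<psi>_mult[symmetric] mult.commute)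
  next
    show "carrier R \<noteq> \<psi> ` P"
      using P mem[of 1] \<psi>_closed[of 1] by (auto simp: prime_ideal_def)
    fix a b assume "a \<in> carrier R" "b \<in> carrier R" "a \<otimes> b \<in> \<psi> ` P"
    then obtain p q where "a = \<psi> p" "b = \<psi> q" "p * q \<in> P"
      by (metis \<psi>_mult carrierE mem)
    then show "a \<in> \<psi> ` P \<or> b \<in> \<psi> ` P" using P by (auto simp: prime_ideal_def)
  qed
qed

text \<open>Chains of \<open>R\<close> are pulled back to B; surjectivity of \<open>\<psi>\<close>
  keeps the inclusions strict.\<close>

lemma krull_dim_leI:
  assumes "\<And>P n. (\<And>i. i \<le> n \<Longrightarrow> prime_ideal (P i)) \<Longrightarrow> (\<And>i. i < n \<Longrightarrow> P i \<subset> P (Suc i)) \<Longrightarrow>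
    {p. \<psi> p = \<zero>} \<subseteq> P 0 \<Longrightarrow> n \<le> d"
  shows "krull_dim R \<le> enat d"
  unfolding krull_dim_def
proof (rule Sup_least, clarify)
  fix n and Q :: "nat \<Rightarrow> 'a set"
  assume Q: "\<forall>i\<le>n. primeideal (Q i) R" "\<forall>i<n. Q i \<subset> Q (Suc i)"
  have "n \<le> d"
  proof (rule assms[of n "\<lambda>i. \<psi> -` Q i"])
    fix i assume "i \<le> n"
    then show "prime_ideal (\<psi> -` Q i)" using Q prime_ideal_vimage by blast
  next
    fix i assume "i < n"
    then have "primeideal (Q (Suc i)) R" using Q(1) by simp
    then have "Q (Suc i) \<subseteq> carrier R"
      by (intro additive_subgroup.a_subset ideal.axioms(1) primeideal.axioms(1))
    moreover obtain x where "x \<in> Q (Suc i)" "x \<notin> Q i" using Q(2) \<open>i < n\<close> by blast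
    ultimately obtain p where "\<psi> p \<in> Q (Suc i)" "\<psi> p \<notin> Q i" by (metis carrierE subsetD)
    then show "\<psi> -` Q i \<subset> \<psi> -` Q (Suc i)" using Q(2) \<open>i < n\<close> by blast
  next
    have "\<zero> \<in> Q 0"
      using Q(1) by (intro additive_subgroup.zero_closed ideal.axioms(1) primeideal.axioms(1)) auto
    then show "{p. \<psi> p = \<zero>} \<subseteq> \<psi> -` Q 0" by auto
  qed
  then show "enat n \<le> enat d" by simp
qed

text \<open>Chains above the kernel are pushed forward; since each member contains the kernel, it is
  recovered from its image, and the inclusions stay strict.\<close>

lemma krull_dim_geI:
  assumes "\<And>i. i \<le> n \<Longrightarrow> prime_ideal (P i)" "\<And>i. i < n \<Longrightarrow> P i \<subset> P (Suc i)" "{p. \<psi> p = \<zero>} \<subseteq> P 0"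
  shows "enat n \<le> krull_dim R"
  unfolding krull_dim_def
proof (rule Sup_upper, intro CollectI exI[of _ n] conjI refl exI[of _ "\<lambda>i. \<psi> ` P i"] allI impI)
  have K: "{p. \<psi> p = \<zero>} \<subseteq> P i" if "i \<le> n" for i
    using that by (induction i) (use assms(2,3) in \<open>fastforce simp: Suc_le_eq\<close>)+
  fix i
  show "primeideal (\<psi> ` P i) R" if "i \<le> n" using assms(1)[OF that] K[OF that] by (rule primeideal_image)
  assume "i < n"
  then have "P i \<subset> P (Suc i)" "\<psi> -` \<psi> ` P i = P i" "\<psi> -` \<psi> ` P (Suc i) = P (Suc i)"
    using assms(2) primeideal_image(2) assms(1) K by simp_all
  then show "\<psi> ` P i \<subset> \<psi> ` P (Suc i)" by blast
qed

end

section \<open>The special fiber ring of an equigenerated ideal\<close>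

lemma mpoly_ring_simps [simp]:
  "carrier (mpoly_ring V) = poly_in V" "a \<otimes>\<^bsub>mpoly_ring V\<^esub> b = a * b" "\<one>\<^bsub>mpoly_ring V\<^esub> = 1"
  "\<zero>\<^bsub>mpoly_ring V\<^esub> = 0" "a \<oplus>\<^bsub>mpoly_ring V\<^esub> b = a + b"
  by (simp_all add: mpoly_ring_def poly_in_def)

lemma cring_mpoly_ring: "cring (mpoly_ring V :: ('v, 'k::field) mpoly ring)"
proof (rule cringI)
  show "abelian_group (mpoly_ring V :: ('v, 'k) mpoly ring)"
  proof (rule abelian_groupI)
    fix x :: "('v, 'k) mpoly" assume "x \<in> carrier (mpoly_ring V)"
    then show "\<exists>y\<in>carrier (mpoly_ring V). y \<oplus>\<^bsub>mpoly_ring V\<^esub> x = \<zero>\<^bsub>mpoly_ring V\<^esub>"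
      by (intro bexI[of _ "- x"]) auto
  qed (auto simp: algebra_simps)
  show "comm_monoid (mpoly_ring V :: ('v, 'k) mpoly ring)"
    by (rule comm_monoidI) (auto simp: algebra_simps)
qed (auto simp: algebra_simps)

lemma mpoly_idealI:
  fixes I :: "('v, 'k::field) mpoly set"
  assumes "I \<subseteq> poly_in V" "0 \<in> I" "\<And>a b. a \<in> I \<Longrightarrow> b \<in> I \<Longrightarrow> a + b \<in> I"
    "\<And>a r. a \<in> I \<Longrightarrow> r \<in> poly_in V \<Longrightarrow> r * a \<in> I"
  shows "ideal I (mpoly_ring V)"
proof -
  interpret cring "mpoly_ring V :: ('v, 'k) mpoly ring" by (rule cring_mpoly_ring)
  show ?thesis
  proof (rule idealI)
    show "subgroup I (add_monoid (mpoly_ring V))"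
    proof (rule group.subgroupI)
      show "group (add_monoid (mpoly_ring V :: ('v, 'k) mpoly ring))" by (rule add.group_axioms)
      show "inv\<^bsub>add_monoid (mpoly_ring V)\<^esub> a \<in> I" if a: "a \<in> I" for a
      proof -
        have "- 1 * a \<in> I" using a by (intro assms(4)) auto
        moreover have "\<ominus>\<^bsub>mpoly_ring V\<^esub> a = - a" using a assms(1) by (intro minus_equality) auto
        ultimately show ?thesis by (simp add: a_inv_def)
      qed
    qed (use assms in auto)
  qed (use assms ring_axioms in \<open>auto simp: mult.commute\<close>)
qed

context
  fixes V :: "'v set" and I :: "('v, 'k::field) mpoly set"
  assumes I: "ideal I (mpoly_ring V)"
begin

interpretation ideal I "mpoly_ring V" by (rule I)

lemma mpoly_ideal_subset: "I \<subseteq> poly_in V"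
  using a_subset by simp

lemma mpoly_ideal_0: "0 \<in> I"
  using additive_subgroup.zero_closed[OF additive_subgroup_axioms] by simp

lemma mpoly_ideal_add: "a \<in> I \<Longrightarrow> b \<in> I \<Longrightarrow> a + b \<in> I"
  using additive_subgroup.a_closed[OF additive_subgroup_axioms, of a b] by simp

lemma mpoly_ideal_mult: "a \<in> I \<Longrightarrow> r \<in> poly_in V \<Longrightarrow> r * a \<in> I"
  using I_l_closed[of a r] by simp

lemma mpoly_ideal_uminus: "a \<in> I \<Longrightarrow> - a \<in> I"
  using mpoly_ideal_mult[of a "- 1"] by (simp add: poly_in_uminus)

lemma mpoly_ideal_diff: "a \<in> I \<Longrightarrow> b \<in> I \<Longrightarrow> a - b \<in> I"
  using mpoly_ideal_add[of a "- b"] mpoly_ideal_uminus[of b] by simp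

lemma mpoly_ideal_sum: "(\<And>a. a \<in> A \<Longrightarrow> g a \<in> I) \<Longrightarrow> sum g A \<in> I"
  by (induction A rule: infinite_finite_induct) (auto intro: mpoly_ideal_0 mpoly_ideal_add)

lemma mpoly_coset_eq: "I +>\<^bsub>mpoly_ring V\<^esub> a = (\<lambda>x. x + a) ` I"
  by (auto simp: a_r_coset_def')

lemma mpoly_coset_eq_iff:
  "I +>\<^bsub>mpoly_ring V\<^esub> a = I +>\<^bsub>mpoly_ring V\<^esub> b \<longleftrightarrow> a - b \<in> I"
proof
  assume "I +>\<^bsub>mpoly_ring V\<^esub> a = I +>\<^bsub>mpoly_ring V\<^esub> b"
  then have "0 + a \<in> (\<lambda>x. x + b) ` I" unfolding mpoly_coset_eq using mpoly_ideal_0 by blast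
  then show "a - b \<in> I" by auto
next
  assume "a - b \<in> I"
  then have "x + (a - b) \<in> I" "x - (a - b) \<in> I" if "x \<in> I" for x
    using that mpoly_ideal_add mpoly_ideal_diff by blast+
  moreover have "x + a = (x + (a - b)) + b" "x + b = (x - (a - b)) + a" for x by simp_all
  ultimately show "I +>\<^bsub>mpoly_ring V\<^esub> a = I +>\<^bsub>mpoly_ring V\<^esub> b"
    unfolding mpoly_coset_eq by blast
qed

lemma mpoly_coset_eq_self_iff: "I +>\<^bsub>mpoly_ring V\<^esub> a = I \<longleftrightarrow> a \<in> I"
  using mpoly_coset_eq_iff[of a 0] mpoly_coset_eq[of 0] by simp

lemma mpoly_coset_add:
  assumes "a \<in> poly_in V" "b \<in> poly_in V"
  shows "(I +>\<^bsub>mpoly_ring V\<^esub> a) <+>\<^bsub>mpoly_ring V\<^esub> (I +>\<^bsub>mpoly_ring V\<^esub> b) = I +>\<^bsub>mpoly_ring V\<^esub> (a + b)"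
  using a_rcos_sum[of a b] assms by simp

text \<open>A product in the special fiber ring is a \<open>finsum\<close> in a quotient ring; this
  turns it into the coset of an ordinary sum.\<close>

lemma finsum_Quot_coset:
  assumes "finite A" "\<And>i. i \<in> A \<Longrightarrow> g i \<in> poly_in V"
  shows "finsum (mpoly_ring V Quot I) (\<lambda>i. I +>\<^bsub>mpoly_ring V\<^esub> g i) A = I +>\<^bsub>mpoly_ring V\<^esub> sum g A"
  using assms
proof (induction A rule: finite_induct)
  case empty
  interpret Q: ring "mpoly_ring V Quot I" by (rule quotient_is_ring)
  show ?case
    unfolding Q.finsum_empty using mpoly_coset_eq_self_iff[of 0] mpoly_ideal_0 by (simp add: FactRing_def)
next
  case (insert x F)
  interpret Q: ring "mpoly_ring V Quot I" by (rule quotient_is_ring)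
  have carr: "I +>\<^bsub>mpoly_ring V\<^esub> g i \<in> carrier (mpoly_ring V Quot I)" if "i \<in> insert x F" for i
    using insert.prems[OF that] by (auto simp: FactRing_def A_RCOSETS_def')
  then have "finsum (mpoly_ring V Quot I) (\<lambda>i. I +>\<^bsub>mpoly_ring V\<^esub> g i) (insert x F) =
      (I +>\<^bsub>mpoly_ring V\<^esub> g x) \<oplus>\<^bsub>mpoly_ring V Quot I\<^esub> (I +>\<^bsub>mpoly_ring V\<^esub> sum g F)"
    using insert by (subst Q.finsum_insert) auto
  then show ?case
    using insert by (simp add: FactRing_def mpoly_coset_add poly_in_sum)
qed

end

text \<open>The factors are cosets of two different ideals and the result is a coset of a third one,
  as in the product of entries of degrees \<open>i\<close> and \<open>k - i\<close>. The last three
  premises are exactly independence of representatives.\<close>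

lemma rcoset_mult_mpoly:
  fixes I I' K :: "('v, 'k::field) mpoly set"
  assumes I: "ideal I (mpoly_ring V)" and I': "ideal I' (mpoly_ring V)" and K: "ideal K (mpoly_ring V)"
    and "\<And>x y. x \<in> I \<Longrightarrow> y \<in> I' \<Longrightarrow> x * y \<in> K" "\<And>x. x \<in> I \<Longrightarrow> x * b \<in> K" "\<And>y. y \<in> I' \<Longrightarrow> a * y \<in> K"
  shows "rcoset_mult (mpoly_ring V) K (I +>\<^bsub>mpoly_ring V\<^esub> a) (I' +>\<^bsub>mpoly_ring V\<^esub> b) =
    K +>\<^bsub>mpoly_ring V\<^esub> (a * b)"
proof -
  have "K +>\<^bsub>mpoly_ring V\<^esub> ((x + a) * (y + b)) = K +>\<^bsub>mpoly_ring V\<^esub> (a * b)"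
    if "x \<in> I" "y \<in> I'" for x y
  proof -
    have "(x + a) * (y + b) - a * b = x * y + x * b + a * y" by (simp add: algebra_simps)
    also have "\<dots> \<in> K" using assms(4-6) that by (intro mpoly_ideal_add[OF K]) auto
    finally show ?thesis by (simp add: mpoly_coset_eq_iff[OF K])
  qed
  moreover have "I \<noteq> {}" "I' \<noteq> {}" using mpoly_ideal_0[OF I] mpoly_ideal_0[OF I'] by auto
  ultimately show ?thesis
    unfolding rcoset_mult_def mpoly_coset_eq[OF I] mpoly_coset_eq[OF I'] by (auto simp: image_iff)
qed

abbreviation degree :: "('v \<Rightarrow>\<^sub>0 nat) \<Rightarrow> nat"
  where "degree \<equiv> weight (\<lambda>_. Suc 0)"

text \<open>The \<open>d\<close>-th power of the graded maximal ideal, described by the exponents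
  that occur.\<close>

definition order_ge :: "'v set \<Rightarrow> nat \<Rightarrow> ('v, 'k::field) mpoly set"
  where "order_ge V d = {p \<in> poly_in V. \<forall>t \<in> keys p. d \<le> degree t}"

lemma order_ge_mult:
  assumes "p \<in> order_ge V a" "q \<in> order_ge V b"
  shows "p * q \<in> order_ge V (a + b)"
proof -
  have "a + b \<le> degree t" if "t \<in> keys (p * q)" for t
  proof -
    obtain r s where "t = r + s" "r \<in> keys p" "s \<in> keys q"
      using keys_mult[of p q] \<open>t \<in> _\<close> by auto
    then show ?thesis using assms by (auto simp: order_ge_def weight_add intro: add_mono)
  qed
  then show ?thesis using assms by (auto simp: order_ge_def)
qed

lemma ideal_order_ge: "ideal (order_ge V d :: ('v, 'k::field) mpoly set) (mpoly_ring V)"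
proof (rule mpoly_idealI)
  fix a b :: "('v, 'k) mpoly" assume "a \<in> order_ge V d" "b \<in> order_ge V d"
  then show "a + b \<in> order_ge V d" using keys_add[of a b] by (fastforce simp: order_ge_def)
next
  fix a r :: "('v, 'k) mpoly" assume "a \<in> order_ge V d" "r \<in> poly_in V"
  then show "r * a \<in> order_ge V d" using order_ge_mult[of r V 0 a d] by (simp add: order_ge_def)
qed (auto simp: order_ge_def)

lemma ideal_prod_order_ge:
  assumes "I \<subseteq> order_ge V a" "J \<subseteq> order_ge V b"
  shows "ideal_prod (mpoly_ring V) I J \<subseteq> order_ge V (a + b)"
proof
  fix x assume "x \<in> ideal_prod (mpoly_ring V) I J"
  then show "x \<in> order_ge V (a + b)"
  proof (induction rule: ideal_prod.induct)
    case (prod i j)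
    then show ?case using assms order_ge_mult[of i V a j b] by auto
  next
    case (sum s t)
    then show ?case using mpoly_ideal_add[OF ideal_order_ge] by simp
  qed
qed

text \<open>The generators are indexed by all natural numbers, so that B is the polynomial ring over
  the type \<open>nat\<close>; a finite list is padded with zeros. Positivity of
  \<open>\<delta>\<close> ensures that the degree of a value determines the degree of the
  form.\<close>

locale homogeneous_generators =
  fixes V :: "'v set" and f :: "nat \<Rightarrow> ('v, 'k::field) mpoly" and \<delta> :: nat
  assumes f_in: "f i \<in> poly_in V"
    and \<delta>_pos: "\<delta> > 0"
    and f_homogeneous: "t \<in> keys (f i) \<Longrightarrow> degree t = \<delta>"
begin

abbreviation "S \<equiv> (mpoly_ring V :: ('v, 'k) mpoly ring)"
definition "\<mm> = (graded_maximal_ideal V :: ('v, 'k) mpoly set)"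
definition "J = Idl\<^bsub>S\<^esub> (range f)"
definition "Jpow k = ideal_power S J k"
definition "N k = ideal_prod S \<mm> (Jpow k)"

sublocale S: cring S by (rule cring_mpoly_ring)

lemma ideal_\<mm>: "ideal \<mm> S"
  unfolding \<mm>_def graded_maximal_ideal_def by (rule S.genideal_ideal) auto

lemma ideal_J: "ideal J S"
  unfolding J_def using f_in by (intro S.genideal_ideal) auto

lemma f_in_J: "f i \<in> J"
  unfolding J_def using f_in S.genideal_self[of "range f"] by auto

lemma J_minimal: "ideal I S \<Longrightarrow> (\<And>i. f i \<in> I) \<Longrightarrow> J \<subseteq> I"
  unfolding J_def by (rule S.genideal_minimal) auto

lemma Jpow_0: "Jpow 0 = poly_in V"
  by (simp add: Jpow_def ideal_power_def ideals_set_def nat_pow_def)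

lemma Jpow_Suc: "Jpow (Suc k) = ideal_prod S (Jpow k) J"
  by (simp add: Jpow_def ideal_power_def ideals_set_def nat_pow_def)

lemma ideal_Jpow: "ideal (Jpow k) S"
proof (induction k)
  case 0
  then show ?case using S.oneideal by (simp add: Jpow_0)
next
  case (Suc k)
  then show ?case unfolding Jpow_Suc using ideal_J by (rule S.ideal_prod_is_ideal)
qed

lemma ideal_N: "ideal (N k) S"
  unfolding N_def using ideal_\<mm> ideal_Jpow by (rule S.ideal_prod_is_ideal)

lemma N_subset_Jpow: "N k \<subseteq> Jpow k"
  unfolding N_def using S.ideal_prod_inter[OF ideal_\<mm> ideal_Jpow] by blast

lemma \<mm>_mult_Jpow: "x \<in> \<mm> \<Longrightarrow> y \<in> Jpow k \<Longrightarrow> x * y \<in> N k"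
  unfolding N_def using ideal_prod.prod[of x \<mm> y "Jpow k" S] by simp

lemma Jpow_mult: "x \<in> Jpow i \<Longrightarrow> y \<in> Jpow j \<Longrightarrow> x * y \<in> Jpow (i + j)"
proof -
  have "ideal_prod S (Jpow i) (Jpow j) = Jpow (i + j)"
  proof (induction j)
    case 0
    then show ?case using S.ideal_prod_one[OF ideal_Jpow[of i]] by (simp add: Jpow_0)
  next
    case (Suc j)
    then show ?case
      using S.ideal_prod_assoc[OF ideal_Jpow[of i] ideal_Jpow[of j] ideal_J] by (simp add: Jpow_Suc)
  qed
  then show "x * y \<in> Jpow (i + j)" if "x \<in> Jpow i" "y \<in> Jpow j"
    using ideal_prod.prod[of x "Jpow i" y "Jpow j" S] that by simp
qed

lemma N_mult: "x \<in> N i \<Longrightarrow> y \<in> Jpow j \<Longrightarrow> x * y \<in> N (i + j)"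
proof -
  assume x: "x \<in> N i" and y: "y \<in> Jpow j"
  from x[unfolded N_def] show "x * y \<in> N (i + j)"
  proof (induction rule: ideal_prod.induct)
    case (prod a b)
    then have "a * (b * y) \<in> N (i + j)" using y by (intro \<mm>_mult_Jpow Jpow_mult)
    then show ?case by (simp add: mult.assoc)
  next
    case (sum s t)
    then show ?case using mpoly_ideal_add[OF ideal_N] by (simp add: distrib_right)
  qed
qed

lemma mult_N: "x \<in> Jpow i \<Longrightarrow> y \<in> N j \<Longrightarrow> x * y \<in> N (i + j)"
  using N_mult[of y j x i] by (simp add: mult.commute add.commute)

lemma mvar_in_\<mm>: "v \<in> V \<Longrightarrow> mvar v \<in> \<mm>"
proof -
  have "mvar ` V \<subseteq> carrier S" by auto
  from S.genideal_self[OF this] show "v \<in> V \<Longrightarrow> mvar v \<in> \<mm>"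
    by (auto simp: \<mm>_def graded_maximal_ideal_def)
qed

lemma \<mm>_order_ge: "\<mm> \<subseteq> order_ge V 1"
  unfolding \<mm>_def graded_maximal_ideal_def
  by (rule S.genideal_minimal[OF ideal_order_ge]) (auto simp: order_ge_def mvar_def)

lemma Jpow_order_ge: "Jpow k \<subseteq> order_ge V (\<delta> * k)"
proof (induction k)
  case 0
  then show ?case by (auto simp: Jpow_0 order_ge_def)
next
  case (Suc k)
  have "J \<subseteq> order_ge V \<delta>"
    using f_in f_homogeneous by (intro J_minimal ideal_order_ge) (auto simp: order_ge_def)
  then show ?case using ideal_prod_order_ge[OF Suc] by (simp add: Jpow_Suc add.commute)
qed

lemma N_order_ge: "N k \<subseteq> order_ge V (Suc (\<delta> * k))"
  unfolding N_def using ideal_prod_order_ge[OF \<mm>_order_ge Jpow_order_ge] by simp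

text \<open>The residue field of \<open>\<mm>\<close> is the ground field.\<close>

lemma diff_const_in_\<mm>: "p \<in> poly_in V \<Longrightarrow> \<exists>c. p - const c \<in> \<mm>"
proof (induction rule: poly_in_induct)
  case (const c)
  then show ?case using mpoly_ideal_0[OF ideal_\<mm>] by (intro exI[of _ c]) simp
next
  case (add p q)
  then obtain c d where "p - const c \<in> \<mm>" "q - const d \<in> \<mm>" by blast
  then have "(p - const c) + (q - const d) \<in> \<mm>" by (rule mpoly_ideal_add[OF ideal_\<mm>])
  then show ?case by (intro exI[of _ "c + d"]) (simp add: single_add algebra_simps)
next
  case (mult v p)
  then obtain c where c: "p - const c \<in> \<mm>" by blast
  have "mvar v * (p - const c) \<in> \<mm>" using mult.hyps by (intro mpoly_ideal_mult[OF ideal_\<mm> c]) simp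
  moreover have "const c * mvar v \<in> \<mm>" using mvar_in_\<mm>[OF mult.hyps] by (intro mpoly_ideal_mult[OF ideal_\<mm>]) auto
  ultimately have "mvar v * (p - const c) + const c * mvar v \<in> \<mm>" by (rule mpoly_ideal_add[OF ideal_\<mm>])
  then show ?case by (intro exI[of _ 0]) (simp add: algebra_simps)
qed

section \<open>Forms in the variables of B and their values on the generators\<close>

definition form :: "nat \<Rightarrow> (nat, 'k) mpoly \<Rightarrow> bool"
  where "form k p \<longleftrightarrow> component degree k p = p"

lemma form_keys: "form k p \<Longrightarrow> t \<in> keys p \<Longrightarrow> degree t = k"
  using keys_component[of degree k p] by (auto simp: form_def)

lemma formI: "(\<And>t. t \<in> keys p \<Longrightarrow> degree t = k) \<Longrightarrow> form k p"
  unfolding form_def by (rule poly_mapping_eqI) (auto simp: lookup_component when_def in_keys_iff)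

lemma form_component: "form k (component degree k p)"
  by (simp add: form_def component_component)

lemma form_add: "form k p \<Longrightarrow> form k q \<Longrightarrow> form k (p + q)"
  by (simp add: form_def component_add)

lemma form_mult:
  assumes "form i p" "form j q"
  shows "form (i + j) (p * q)"
proof (rule formI)
  fix t assume "t \<in> keys (p * q)"
  then obtain r s where "t = r + s" "r \<in> keys p" "s \<in> keys q"
    using keys_mult[of p q] by auto
  then show "degree t = i + j" using form_keys assms by (simp add: weight_add)
qed

lemma eval_poly_in_V: "eval_poly f p \<in> poly_in V"
  by (rule eval_poly_in[where V = UNIV]) (auto simp: f_in)

lemma monom_val_in_Jpow: "monom_val f t \<in> Jpow (degree t)"
proof (induction t rule: exponent_induct[where V = UNIV, simplified, case_names zero add])
  case zero
  then show ?case by (simp add: Jpow_0)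
next
  case (add v t)
  have "f v \<in> Jpow 1"
    using f_in_J S.ideal_prod_one[OF ideal_J] S.ideal_prod_commute[OF ideal_J S.oneideal]
    by (simp add: Jpow_Suc Jpow_0)
  then have "f v * monom_val f t \<in> Jpow (1 + degree t)" using add by (rule Jpow_mult)
  then show ?case by (simp add: monom_val_add weight_add)
qed

lemma form_eval_in_Jpow:
  assumes "form k p"
  shows "eval_poly f p \<in> Jpow k"
  unfolding eval_poly_def
proof (intro mpoly_ideal_sum[OF ideal_Jpow] mpoly_ideal_mult[OF ideal_Jpow])
  fix t assume "t \<in> keys p"
  then show "monom_val f t \<in> Jpow k" using monom_val_in_Jpow[of t] form_keys[OF assms] by simp
qed simp

text \<open>Modulo \<open>\<mm>\<close> times \<open>J^k\<close>, coefficients may be replaced by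
  their constant terms, so forms with constant coefficients already reach all of \<open>J^k\<close>.
  This gives surjectivity onto each entry of the special fiber ring.\<close>

lemma Jpow_approx: "a \<in> Jpow k \<Longrightarrow> \<exists>p. form k p \<and> a - eval_poly f p \<in> N k"
proof (induction k arbitrary: a)
  case 0
  then have a: "a \<in> poly_in V" by (simp add: Jpow_0)
  obtain c where "a - const c \<in> \<mm>" using diff_const_in_\<mm>[OF a] by blast
  then have "(a - const c) * 1 \<in> N 0" by (intro \<mm>_mult_Jpow) (auto simp: Jpow_0)
  moreover have "form 0 (const c)" by (rule formI) (auto split: if_splits)
  ultimately show ?case by (intro exI[of _ "const c"]) simp
next
  case (Suc k)
  \<comment> \<open>In degree 1 the approximable elements of \<open>J\<close> form an ideal that
    contains the generators. Higher degrees follow by multiplying approximations.\<close>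
  have one: "\<exists>p. form 1 p \<and> b - eval_poly f p \<in> N 1" if b: "b \<in> J" for b
  proof -
    let ?I = "{b \<in> J. \<exists>p. form 1 p \<and> b - eval_poly f p \<in> N 1}"
    have J1: "J = Jpow 1"
      using S.ideal_prod_one[OF ideal_J] S.ideal_prod_commute[OF ideal_J S.oneideal]
      by (simp add: Jpow_Suc Jpow_0)
    have "ideal ?I S"
    proof (rule mpoly_idealI)
      show "?I \<subseteq> poly_in V" using mpoly_ideal_subset[OF ideal_J] by blast
      show "0 \<in> ?I"
        using mpoly_ideal_0[OF ideal_J] mpoly_ideal_0[OF ideal_N]
        by (auto intro!: exI[of _ 0] simp: form_def)
    next
      fix a b :: "('v, 'k) mpoly" assume "a \<in> ?I" "b \<in> ?I"
      then obtain p q where pq: "a \<in> J" "b \<in> J" "form 1 p" "a - eval_poly f p \<in> N 1"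
        "form 1 q" "b - eval_poly f q \<in> N 1" by blast
      have "a + b - eval_poly f (p + q) = (a - eval_poly f p) + (b - eval_poly f q)" by simp
      also have "\<dots> \<in> N 1" by (rule mpoly_ideal_add[OF ideal_N pq(4,6)])
      finally show "a + b \<in> ?I"
        using pq form_add mpoly_ideal_add[OF ideal_J] by blast
    next
      fix a r :: "('v, 'k) mpoly" assume "a \<in> ?I" and r: "r \<in> poly_in V"
      then obtain p where p: "a \<in> J" "form 1 p" "a - eval_poly f p \<in> N 1" by blast
      obtain c where c: "r - const c \<in> \<mm>" using diff_const_in_\<mm>[OF r] by blast
      have "r * a - eval_poly f (const c * p) = (r - const c) * a + const c * (a - eval_poly f p)"
        by (simp add: algebra_simps)
      also have "\<dots> \<in> N 1"
        using \<mm>_mult_Jpow[OF c, of a 1] p(1) J1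
        by (intro mpoly_ideal_add[OF ideal_N] mpoly_ideal_mult[OF ideal_N p(3)]) auto
      finally have "r * a - eval_poly f (const c * p) \<in> N 1" .
      moreover have "form 0 (const c :: (nat, 'k) mpoly)" by (rule formI) (auto split: if_splits)
      then have "form (0 + 1) (const c * p)" using p(2) by (rule form_mult)
      then have "form 1 (const c * p)" by simp
      ultimately show "r * a \<in> ?I" using mpoly_ideal_mult[OF ideal_J p(1) r] by blast
    qed
    moreover have "f i \<in> ?I" for i
    proof -
      have "form 1 (mvar i :: (nat, 'k) mpoly)" by (rule formI) (auto simp: mvar_def)
      then show ?thesis
        using f_in_J mpoly_ideal_0[OF ideal_N] by (auto intro!: exI[of _ "mvar i"])
    qed
    ultimately have "J \<subseteq> ?I" by (rule J_minimal)
    then show ?thesis using b by blast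
  qed
  from Suc.prems[unfolded Jpow_Suc] show ?case
  proof (induction rule: ideal_prod.induct)
    case (prod a b)
    obtain p where p: "form k p" "a - eval_poly f p \<in> N k" using Suc.IH[OF prod(1)] by blast
    obtain q where q: "form 1 q" "b - eval_poly f q \<in> N 1" using one[OF prod(2)] by blast
    have b: "b \<in> Jpow 1"
      using prod(2) S.ideal_prod_one[OF ideal_J] S.ideal_prod_commute[OF ideal_J S.oneideal]
      by (simp add: Jpow_Suc Jpow_0)
    have "a * b - eval_poly f (p * q) = (a - eval_poly f p) * b + eval_poly f p * (b - eval_poly f q)"
      by (simp add: algebra_simps)
    also have "\<dots> \<in> N (k + 1)"
      using N_mult[OF p(2) b] mult_N[OF form_eval_in_Jpow[OF p(1)] q(2)]
      by (rule mpoly_ideal_add[OF ideal_N])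
    finally show ?case using form_mult[OF p(1) q(1)] by (intro exI[of _ "p * q"]) simp
  next
    case (sum a b)
    then obtain p q where pq: "form (Suc k) p" "a - eval_poly f p \<in> N (Suc k)"
      "form (Suc k) q" "b - eval_poly f q \<in> N (Suc k)" by blast
    have "a + b - eval_poly f (p + q) = (a - eval_poly f p) + (b - eval_poly f q)" by simp
    also have "\<dots> \<in> N (Suc k)" by (rule mpoly_ideal_add[OF ideal_N pq(2,4)])
    finally show ?case using pq form_add by (intro exI[of _ "p + q"]) simp
  qed
qed

lemma monom_val_homogeneous:
  "s \<in> keys (monom_val f t) \<Longrightarrow> degree s = \<delta> * degree t"
proof (induction t arbitrary: s rule: exponent_induct[where V = UNIV, simplified, case_names zero add])
  case zero
  then show ?case by simp
next
  case (add v t)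
  then obtain a b where "s = a + b" "a \<in> keys (f v)" "b \<in> keys (monom_val f t)"
    using keys_mult[of "f v" "monom_val f t"] by (auto simp: monom_val_add)
  then show ?case using add.IH f_homogeneous by (simp add: weight_add)
qed

lemma form_eval_homogeneous:
  assumes "form k p" "s \<in> keys (eval_poly f p)"
  shows "degree s = \<delta> * k"
proof -
  obtain t where t: "t \<in> keys p" "s \<in> keys (const (lookup p t) * monom_val f t)"
    using assms(2) keys_sum[of "\<lambda>t. const (lookup p t) * monom_val f t" "keys p"]
    unfolding eval_poly_def by blast
  then have "s \<in> keys (monom_val f t)"
    using keys_mult[of "const (lookup p t)" "monom_val f t"] by (auto split: if_splits)
  then show ?thesis using monom_val_homogeneous form_keys[OF assms(1) t(1)] by simp
qed

text \<open>A form of degree \<open>k\<close> has a value that is homogeneous of degree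
  \<open>\<delta> * k\<close>, while elements of \<open>N k\<close> have no terms below degree
  \<open>\<delta> * k + 1\<close>. This is where equal degrees of the generators matter.\<close>

lemma form_eval_in_N:
  assumes "form k p" "eval_poly f p \<in> N k"
  shows "eval_poly f p = 0"
proof -
  have "keys (eval_poly f p) = {}"
    using form_eval_homogeneous[OF assms(1)] N_order_ge assms(2) by (fastforce simp: order_ge_def)
  then show ?thesis by simp
qed

end

context homogeneous_generators
begin

abbreviation "R \<equiv> special_fiber_ring S \<mm> J"

text \<open>The canonical map from B to the special fiber ring, which sends the \<open>k\<close>-th
  variable to the class of \<open>f k\<close> in degree 1.\<close>

definition fiber :: "(nat, 'k) mpoly \<Rightarrow> nat \<Rightarrow> ('v, 'k) mpoly set"
  where "fiber p k = N k +>\<^bsub>S\<^esub> eval_poly f (component degree k p)"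

lemma fiber_eqI: "(\<And>k. g k = N k +>\<^bsub>S\<^esub> eval_poly f (component degree k p)) \<Longrightarrow> fiber p = g"
  by (auto simp: fiber_def)

lemma N_coset_0 [simp]: "N k +>\<^bsub>S\<^esub> 0 = N k"
  using mpoly_coset_eq_self_iff[OF ideal_N] mpoly_ideal_0[OF ideal_N] by blast

lemma eval_component_in_Jpow: "eval_poly f (component degree k p) \<in> Jpow k"
  by (rule form_eval_in_Jpow) (rule form_component)

lemma special_fiber_ring_eq:
  "R =
    \<lparr>carrier = {g. (\<forall>k. g k \<in> (\<lambda>a. N k +>\<^bsub>S\<^esub> a) ` Jpow k) \<and> finite {k. g k \<noteq> N k}},
     monoid.mult = (\<lambda>g h k. \<Oplus>\<^bsub>S Quot N k\<^esub>i \<in> {..k}. rcoset_mult S (N k) (g i) (h (k - i))),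
     one = (\<lambda>k. if k = 0 then N 0 +>\<^bsub>S\<^esub> \<one>\<^bsub>S\<^esub> else N k),
     zero = N,
     add = (\<lambda>g h k. g k <+>\<^bsub>S\<^esub> h k)\<rparr>"
proof -
  have "(\<lambda>k. ideal_prod S \<mm> (ideal_power S J k)) = N"
    by (auto simp: N_def Jpow_def)
  then show ?thesis by (simp add: special_fiber_ring_def Let_def Jpow_def fun_eq_iff[of _ N, symmetric])
qed

lemma fiber_mult:
  "fiber (p * q) k = (\<Oplus>\<^bsub>S Quot N k\<^esub>i \<in> {..k}. rcoset_mult S (N k) (fiber p i) (fiber q (k - i)))"
proof -
  define a where "a i = eval_poly f (component degree i p)" for i
  define b where "b i = eval_poly f (component degree i q)" for i
  have ab: "a i \<in> Jpow i" "b i \<in> Jpow i" for i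
    unfolding a_def b_def by (rule eval_component_in_Jpow)+
  have abV: "a i * b j \<in> poly_in V" for i j
    unfolding a_def b_def by (intro poly_in_mult eval_poly_in_V)
  have eq: "rcoset_mult S (N k) (fiber p i) (fiber q (k - i)) = N k +>\<^bsub>S\<^esub> (a i * b (k - i))" if "i \<le> k" for i
  proof -
    have k: "i + (k - i) = k" using that by simp
    show ?thesis
      unfolding fiber_def a_def[symmetric] b_def[symmetric]
    proof (rule rcoset_mult_mpoly[OF ideal_N ideal_N ideal_N])
      show "x * y \<in> N k" if "x \<in> N i" "y \<in> N (k - i)" for x y
        using N_mult[of x i y "k - i"] that N_subset_Jpow k by auto
      show "x * b (k - i) \<in> N k" if "x \<in> N i" for x
        using N_mult[OF that ab(2)[of "k - i"]] k by simp
      show "a i * y \<in> N k" if "y \<in> N (k - i)" for y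
        using mult_N[OF ab(1)[of i] that] k by simp
    qed
  qed
  interpret Q: ring "S Quot N k" by (rule ideal.quotient_is_ring[OF ideal_N])
  have "(\<Oplus>\<^bsub>S Quot N k\<^esub>i \<in> {..k}. rcoset_mult S (N k) (fiber p i) (fiber q (k - i))) =
      (\<Oplus>\<^bsub>S Quot N k\<^esub>i \<in> {..k}. N k +>\<^bsub>S\<^esub> (a i * b (k - i)))"
    using abV by (intro Q.finsum_cong') (auto simp: eq FactRing_def A_RCOSETS_def')
  also have "\<dots> = N k +>\<^bsub>S\<^esub> (\<Sum>i\<le>k. a i * b (k - i))"
    using abV by (intro finsum_Quot_coset[OF ideal_N]) auto
  also have "(\<Sum>i\<le>k. a i * b (k - i)) = eval_poly f (component degree k (p * q))"
    by (simp add: a_def b_def component_mult[OF weight_add] eval_poly_sum)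
  finally show ?thesis by (simp add: fiber_def)
qed

text \<open>Substitution multiplies degrees by \<open>\<delta>\<close>, and
  \<open>\<delta> > 0\<close> keeps different degrees apart. Hence every homogeneous part of a
  relation is again a relation.\<close>

lemma component_eval_poly: "component degree (\<delta> * k) (eval_poly f p) = eval_poly f (component degree k p)"
proof -
  have "lookup (component degree (\<delta> * k) (eval_poly f p)) s =
      lookup (eval_poly f (component degree k p)) s" for s
  proof -
    let ?D = "insert k (degree ` keys p)"
    have other: "lookup (eval_poly f (component degree j p)) s = 0"
      if "degree s \<noteq> \<delta> * j" for j
      using form_eval_homogeneous[OF form_component] that by (meson in_keys_iff)
    have "p = (\<Sum>j\<in>?D. component degree j p)"
      by (rule sum_component[symmetric]) auto
    then have "eval_poly f p = (\<Sum>j\<in>?D. eval_poly f (component degree j p))"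
      by (metis eval_poly_sum)
    then have lk: "lookup (eval_poly f p) s = (\<Sum>j\<in>?D. lookup (eval_poly f (component degree j p)) s)"
      by (simp add: lookup_sum)
    show ?thesis
    proof (cases "degree s = \<delta> * k")
      case True
      have "(\<Sum>j\<in>?D. lookup (eval_poly f (component degree j p)) s) =
          (\<Sum>j\<in>{k}. lookup (eval_poly f (component degree j p)) s)"
        using True \<delta>_pos other by (intro sum.mono_neutral_right) auto
      then show ?thesis using lk True by (simp add: lookup_component)
    next
      case False
      then show ?thesis using other[OF False] by (simp add: lookup_component)
    qed
  qed
  then show ?thesis by (rule poly_mapping_eqI)
qed

sublocale fiber: comm_ring_image "R" fiber
proof
  show "range fiber = carrier R"
  proof (intro equalityI subsetI)
    fix g assume "g \<in> range fiber"
    then obtain p where g: "g = fiber p" by blast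
    have "{k. g k \<noteq> N k} \<subseteq> degree ` keys p"
    proof (rule subsetI, rule ccontr)
      fix k assume "k \<in> {k. g k \<noteq> N k}" and k: "k \<notin> degree ` keys p"
      have "component degree k p = 0"
        using k keys_component[of degree k p] by (auto simp flip: keys_eq_empty)
      then have "g k = N k"
        by (simp add: g fiber_def)
      then show False using \<open>k \<in> {k. g k \<noteq> N k}\<close> by simp
    qed
    then have "finite {k. g k \<noteq> N k}" by (rule finite_subset) simp
    then show "g \<in> carrier R"
      using eval_component_in_Jpow by (auto simp: special_fiber_ring_eq g fiber_def)
  next
    fix g assume g: "g \<in> carrier R"
    \<comment> \<open>For surjectivity a form is chosen for each entry; only the finitely many
      degrees in \<open>K\<close> with a nonzero entry are summed.\<close>
    have "\<exists>p. form k p \<and> g k = N k +>\<^bsub>S\<^esub> eval_poly f p" for k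
    proof -
      obtain a where a: "a \<in> Jpow k" "g k = N k +>\<^bsub>S\<^esub> a" using g by (auto simp: special_fiber_ring_eq)
      then obtain p where "form k p" "a - eval_poly f p \<in> N k" using Jpow_approx by blast
      then show ?thesis using a by (auto simp: mpoly_coset_eq_iff[OF ideal_N])
    qed
    then obtain P where P: "\<And>k. form k (P k)" "\<And>k. g k = N k +>\<^bsub>S\<^esub> eval_poly f (P k)" by metis
    define K where "K = {k. g k \<noteq> N k}"
    have K: "finite K" using g by (simp add: special_fiber_ring_eq K_def)
    have comp: "component degree k (\<Sum>j\<in>K. P j) = (if k \<in> K then P k else 0)" for k
    proof -
      have "component degree k (P j) = (if j = k then P k else 0)" for j
        using P(1)[of j] component_component[of degree k j "P j"] by (auto simp: form_def)
      then show ?thesis using K by (simp add: component_sum)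
    qed
    have "fiber (\<Sum>j\<in>K. P j) = g"
    proof (rule fiber_eqI)
      fix k
      show "g k = N k +>\<^bsub>S\<^esub> eval_poly f (component degree k (\<Sum>j\<in>K. P j))"
      proof (cases "k \<in> K")
        case True
        then show ?thesis using P(2) by (simp add: comp)
      next
        case False
        then have "g k = N k" by (simp add: K_def)
        then show ?thesis
          using False by (simp add: comp)
      qed
    qed
    then show "g \<in> range fiber" by blast
  qed
  fix p q
  show "fiber (p + q) = fiber p \<oplus>\<^bsub>R\<^esub> fiber q"
    by (rule fiber_eqI)
      (simp add: special_fiber_ring_eq fiber_def component_add mpoly_coset_add[OF ideal_N] eval_poly_in_V)
  show "fiber (p * q) = fiber p \<otimes>\<^bsub>R\<^esub> fiber q"
    by (rule ext) (simp add: special_fiber_ring_eq fiber_mult)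
  show "fiber 0 = \<zero>\<^bsub>R\<^esub>"
    by (intro fiber_eqI) (simp add: special_fiber_ring_eq)
  show "fiber 1 = \<one>\<^bsub>R\<^esub>"
  proof (rule fiber_eqI)
    fix k
    have "component degree k (1 :: (nat, 'k) mpoly) = (if k = 0 then 1 else 0)"
      using component_single[of degree k 0 "1::'k"] by (simp only: single_one weight_0 eq_commute[of 0 k])
    then show "\<one>\<^bsub>R\<^esub> k = N k +>\<^bsub>S\<^esub> eval_poly f (component degree k 1)"
      by (simp add: special_fiber_ring_eq)
  qed
qed

lemma fiber_eq_zero_iff: "fiber p = \<zero>\<^bsub>R\<^esub> \<longleftrightarrow> eval_poly f p = 0"
proof
  assume "fiber p = \<zero>\<^bsub>R\<^esub>"
  then have "N k +>\<^bsub>S\<^esub> eval_poly f (component degree k p) = N k" for k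
    by (simp add: special_fiber_ring_eq fiber_def fun_eq_iff)
  then have *: "eval_poly f (component degree k p) = 0" for k
    using mpoly_coset_eq_self_iff[OF ideal_N] form_eval_in_N form_component by blast
  have "p = (\<Sum>k\<in>degree ` keys p. component degree k p)"
    by (rule sum_component[symmetric]) auto
  then have "eval_poly f p = (\<Sum>k\<in>degree ` keys p. eval_poly f (component degree k p))"
    by (metis eval_poly_sum)
  then show "eval_poly f p = 0" using * by simp
next
  assume "eval_poly f p = 0"
  then have "eval_poly f (component degree k p) = 0" for k
    using component_eval_poly[of k p] by simp
  then show "fiber p = \<zero>\<^bsub>R\<^esub>"
    by (intro fiber_eqI) (simp add: special_fiber_ring_eq)
qed

text \<open>A common frame for both upper bounds. Elements of B that are independent modulo a prime
  containing all relations of \<open>f\<close> stay independent after substituting \<open>g\<close>,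
  because relations of \<open>g\<close> are relations of \<open>f\<close>. Their values lie in a
  polynomial ring in \<open>card W\<close> variables.\<close>

lemma krull_dim_leI:
  assumes W: "finite W" and g: "\<And>i. g i \<in> poly_in W"
    and ker: "\<And>p. eval_poly g p = 0 \<Longrightarrow> eval_poly f p = 0"
  shows "krull_dim R \<le> enat (card W)"
proof (rule fiber.krull_dim_leI)
  fix P n
  assume P: "\<And>i. i \<le> n \<Longrightarrow> prime_ideal (P i)" "\<And>i. i < n \<Longrightarrow> P i \<subset> P (Suc i)"
    and "{p. fiber p = \<zero>\<^bsub>R\<^esub>} \<subseteq> P 0"
  then have K: "p \<in> P 0" if "eval_poly f p = 0" for p using that fiber_eq_zero_iff by blast
  obtain h where h: "indep_mod (P 0) h n" using chain_imp_indep_mod[of n P] P by blast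
  have "indep_mod {0} (\<lambda>i. eval_poly g (h i)) n"
    unfolding indep_mod_def
  proof (intro ballI impI notI)
    fix r assume r: "r \<in> poly_in {..<n}" "r \<noteq> 0" "eval_poly (\<lambda>i. eval_poly g (h i)) r \<in> {0}"
    then have "eval_poly g (eval_poly h r) = 0" by (simp add: eval_poly_eval_poly)
    then have "eval_poly h r \<in> P 0" using ker K by blast
    then show False using h r(1,2) by (simp add: indep_mod_def)
  qed
  then show "n \<le> card W"
    by (rule indep_le_card[OF W, rotated]) (rule eval_poly_in[where V = UNIV], auto simp: g)
qed

lemma krull_dim_le_card_variables:
  assumes "finite V"
  shows "krull_dim R \<le> enat (card V)"
  using assms f_in by (rule krull_dim_leI)

lemma krull_dim_le_card_generators:
  assumes "\<And>i. i \<ge> n \<Longrightarrow> f i = 0"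
  shows "krull_dim R \<le> enat n"
proof -
  \<comment> \<open>\<open>g\<close> discards the variables belonging to the padding; substituting
    \<open>f\<close> afterwards changes nothing, since the padding is zero.\<close>
  define g :: "nat \<Rightarrow> (nat, 'k) mpoly" where "g i = (if i < n then mvar i else 0)" for i
  have "krull_dim R \<le> enat (card {..<n})"
  proof (rule krull_dim_leI[where g = g])
    fix p assume "eval_poly g p = 0"
    then have "eval_poly f (eval_poly g p) = 0" by simp
    moreover have "(\<lambda>i. eval_poly f (g i)) = f" using assms by (auto simp: g_def fun_eq_iff)
    ultimately show "eval_poly f p = 0" by (simp add: eval_poly_eval_poly)
  qed (auto simp: g_def)
  then show ?thesis by simp
qed

end

text \<open>The ideal of relations is prime because its quotient embeds in a domain, it meets F[Y]
  in 0 by independence, and it contains the variables of the padding. So a chain of length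
  \<open>card Y\<close> starts at it.\<close>

lemma krull_dim_special_fiber_ring_geI:
  fixes V :: "'v::linorder set" and f :: "nat \<Rightarrow> ('v, 'k::field) mpoly"
  assumes "homogeneous_generators V f \<delta>" and f0: "\<And>i. i \<ge> n \<Longrightarrow> f i = 0" and Y: "Y \<subseteq> {..<n}"
    and indep: "\<And>p. p \<in> poly_in Y \<Longrightarrow> p \<noteq> 0 \<Longrightarrow> eval_poly f p \<noteq> 0"
  shows "enat (card Y) \<le> krull_dim (special_fiber_ring (mpoly_ring V)
    (homogeneous_generators.\<mm> V) (homogeneous_generators.J V f))"
proof -
  interpret homogeneous_generators V f \<delta> by fact
  let ?K = "{p. eval_poly f p = 0}"
  have "prime_ideal ?K" by (auto simp: prime_ideal_def ring_ideal_def)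
  moreover have "?K \<inter> poly_in Y \<subseteq> {0}" using indep by blast
  moreover have "mvar j \<in> ?K" if "j \<notin> {..<n}" for j using that f0 by simp
  ultimately have "\<exists>R. R 0 = ?K \<and> (\<forall>i\<le>card Y. prime_ideal (R i)) \<and> (\<forall>i<card Y. R i \<subset> R (Suc i))"
    using Y by (intro prime_ideal_chain[of ?K Y "{..<n}"]) auto
  then obtain R where R: "R 0 = ?K" "\<forall>i\<le>card Y. prime_ideal (R i)" "\<forall>i<card Y. R i \<subset> R (Suc i)" by blast
  show ?thesis
    by (rule fiber.krull_dim_geI[of _ R]) (use R fiber_eq_zero_iff in auto)
qed

section \<open>Binomial edge ideals of pairs\<close>

definition edge_binomial :: "nat \<Rightarrow> nat \<Rightarrow> nat \<Rightarrow> nat \<Rightarrow> (nat \<times> nat, 'k::field) mpoly"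
  where "edge_binomial i j k l = mvar (i, k) * mvar (j, l) - mvar (i, l) * mvar (j, k)"

definition edge_binomials :: "nat pair_pre_digraph \<Rightarrow> nat pair_pre_digraph \<Rightarrow> (nat \<times> nat, 'k::field) mpoly set"
  where "edge_binomials G H = {edge_binomial i j k l | i j k l.
    (i, j) \<in> parcs G \<and> i < j \<and> (k, l) \<in> parcs H \<and> k < l}"

text \<open>Reversing an edge changes only the sign of the binomial. Edges may therefore be oriented
  as a weight demands, although the generators use increasing labels.\<close>

lemma edge_binomial_cases:
  assumes "pair_graph G" "pair_graph H" "(i, j) \<in> parcs G" "(k, l) \<in> parcs H"
  shows "\<exists>b\<in>edge_binomials G H. edge_binomial i j k l = b \<or> edge_binomial i j k l = - b"
proof -
  interpret G: pair_graph G by fact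
  interpret H: pair_graph H by fact
  have G: "(j, i) \<in> parcs G" "i \<noteq> j" and H: "(l, k) \<in> parcs H" "k \<noteq> l"
    using assms(3,4) G.pair_sym_arcs H.pair_sym_arcs G.pair_no_loops[of "(i, j)"] H.pair_no_loops[of "(k, l)"]
    by (auto simp: symmetric_def dest: symD)
  let ?a = "min i j" and ?b = "max i j" and ?c = "min k l" and ?d = "max k l"
  have "edge_binomial ?a ?b ?c ?d \<in> edge_binomials G H"
    unfolding edge_binomials_def using G H assms(3,4)
    by (intro CollectI exI[of _ ?a] exI[of _ ?b] exI[of _ ?c] exI[of _ ?d]) (auto simp: min_def max_def)
  moreover have "edge_binomial i j k l = edge_binomial ?a ?b ?c ?d \<or> edge_binomial i j k l = - edge_binomial ?a ?b ?c ?d"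
    unfolding edge_binomial_def by (cases "i \<le> j"; cases "k \<le> l") (simp_all add: min_def max_def mult.commute)
  ultimately show ?thesis by blast
qed

lemma card_edge_binomials:
  assumes "pair_graph G" "pair_graph H"
  shows "finite (edge_binomials G H)" "card (edge_binomials G H) \<le> num_edges G * num_edges H"
proof -
  interpret G: pair_graph G by fact
  interpret H: pair_graph H by fact
  have count: "card {(i, j) \<in> parcs K. i < j} = num_edges K" if "pair_graph K" for K :: "nat pair_pre_digraph"
  proof -
    interpret K: pair_graph K by fact
    have "{{u, v} |u v. (u, v) \<in> parcs K} = (\<lambda>(u, v). {u, v}) ` {(i, j) \<in> parcs K. i < j}"
    proof (intro equalityI subsetI)
      fix e assume "e \<in> {{u, v} |u v. (u, v) \<in> parcs K}"
      then obtain u v where uv: "e = {u, v}" "(u, v) \<in> parcs K" by blast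
      then have "(v, u) \<in> parcs K" "u \<noteq> v"
        using K.pair_sym_arcs K.pair_no_loops[of "(u, v)"] by (auto simp: symmetric_def dest: symD)
      then have "(min u v, max u v) \<in> {(i, j) \<in> parcs K. i < j}" "e = {min u v, max u v}"
        using uv by (auto simp: min_def max_def)
      then show "e \<in> (\<lambda>(u, v). {u, v}) ` {(i, j) \<in> parcs K. i < j}" by force
    qed auto
    moreover have "inj_on (\<lambda>(u, v). {u, v}) {(i, j) \<in> parcs K. i < j}"
      by (auto intro!: inj_onI simp: doubleton_eq_iff)
    ultimately show ?thesis by (simp add: num_edges_def card_image)
  qed
  let ?A = "{(i, j) \<in> parcs G. i < j} \<times> {(k, l) \<in> parcs H. k < l}"
  have fin: "finite ?A"
    by (intro finite_cartesian_product finite_subset[OF _ G.pair_finite_arcs] finite_subset[OF _ H.pair_finite_arcs]) auto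
  have eq: "edge_binomials G H = (\<lambda>((i, j), (k, l)). edge_binomial i j k l) ` ?A"
    unfolding edge_binomials_def by force
  show "finite (edge_binomials G H)" unfolding eq using fin by simp
  have "card (edge_binomials G H) \<le> card ?A" unfolding eq by (rule card_image_le[OF fin])
  then show "card (edge_binomials G H) \<le> num_edges G * num_edges H"
    by (simp add: card_cartesian_product count assms)
qed

lemma keys_diff_subset: "keys (p - q) \<subseteq> keys p \<union> keys (q :: ('v, 'k::field) mpoly)"
  by (auto simp: in_keys_iff lookup_minus)

text \<open>Enumerates the edge binomials and pads with zeros, so that the theory of equigenerated
  ideals applies with degree 2.\<close>

lemma obtain_generators:
  assumes "pair_graph G" "pair_graph H"
  obtains f :: "nat \<Rightarrow> (nat \<times> nat, 'k::field) mpoly" and n where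
    "homogeneous_generators (pverts G \<times> pverts H) f 2"
    "f ` {..<n} = edge_binomials G H" "\<And>i. i \<ge> n \<Longrightarrow> f i = 0" "n \<le> num_edges G * num_edges H"
    "homogeneous_generators.J (pverts G \<times> pverts H) f = binomial_edge_ideal G H"
proof -
  interpret G: pair_graph G by fact
  interpret H: pair_graph H by fact
  let ?V = "pverts G \<times> pverts H" and ?B = "edge_binomials G H :: (nat \<times> nat, 'k) mpoly set"
  define n where "n = card ?B"
  have finB: "finite ?B" by (rule card_edge_binomials[OF assms])
  obtain h where h: "bij_betw h {0..<n} ?B" using ex_bij_betw_nat_finite[OF finB] by (auto simp: n_def)
  define f where "f i = (if i < n then h i else 0)" for i
  have fim: "f ` {..<n} = ?B"
    using bij_betw_imp_surj_on[OF h] by (auto simp: f_def image_iff lessThan_atLeast0)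
  have f0: "f i = 0" if "i \<ge> n" for i using that by (simp add: f_def)
  have f_cases: "f i = 0 \<or> f i \<in> ?B" for i using fim f0 by (cases "i < n") auto
  have B: "b \<in> poly_in ?V \<and> (\<forall>t\<in>keys b. degree t = 2)" if b: "b \<in> ?B" for b
  proof -
    obtain i j k l where *: "b = edge_binomial i j k l" "(i, j) \<in> parcs G" "(k, l) \<in> parcs H"
      using b by (auto simp: edge_binomials_def)
    then have "i \<in> pverts G" "j \<in> pverts G" "k \<in> pverts H" "l \<in> pverts H"
      using G.in_arcsD1 G.in_arcsD2 H.in_arcsD1 H.in_arcsD2 by auto
    then have "b \<in> poly_in ?V"
      unfolding *(1) edge_binomial_def by (intro poly_in_diff poly_in_mult) auto
    moreover have "degree t = 2" if "t \<in> keys b" for t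
    proof -
      have "t \<in> keys (mvar (i, k) * mvar (j, l) :: (nat \<times> nat, 'k) mpoly) \<union>
          keys (mvar (i, l) * mvar (j, k) :: (nat \<times> nat, 'k) mpoly)"
        using that keys_diff_subset unfolding *(1) edge_binomial_def by blast
      then show ?thesis by (auto simp: mvar_def mult_single weight_add)
    qed
    ultimately show ?thesis by blast
  qed
  have hg: "homogeneous_generators ?V f 2"
  proof
    show "f i \<in> poly_in ?V" for i using f_cases[of i] B by auto
    show "degree t = 2" if "t \<in> keys (f i)" for t i
      using f_cases[of i] B that by auto
  qed simp
  interpret homogeneous_generators ?V f 2 by (rule hg)
  have bei: "binomial_edge_ideal G H = Idl\<^bsub>S\<^esub> ?B"
    by (simp add: binomial_edge_ideal_def edge_binomials_def edge_binomial_def)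
  have "J = Idl\<^bsub>S\<^esub> ?B"
  proof
    have BV: "?B \<subseteq> carrier S" using B by auto
    show "J \<subseteq> Idl\<^bsub>S\<^esub> ?B"
    proof (rule J_minimal)
      show "f i \<in> Idl\<^bsub>S\<^esub> ?B" for i
        using f_cases[of i] S.genideal_self[OF BV] mpoly_ideal_0[OF S.genideal_ideal[OF BV]] by auto
    qed (rule S.genideal_ideal[OF BV])
    have "?B \<subseteq> J" unfolding fim[symmetric] using f_in_J by blast
    then show "Idl\<^bsub>S\<^esub> ?B \<subseteq> J" by (rule S.genideal_minimal[OF ideal_J])
  qed
  moreover have "n \<le> num_edges G * num_edges H"
    unfolding n_def by (rule card_edge_binomials(2)[OF assms])
  ultimately show ?thesis using that[OF hg fim f0] bei by simp
qed

lemma analytic_spread_le: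
  fixes I :: "(nat \<times> nat, 'k::field) mpoly set"
  assumes "pair_graph G" "pair_graph H" and I: "I = binomial_edge_ideal G H"
  shows "analytic_spread (pverts G \<times> pverts H) I \<le> enat (card (pverts G) * card (pverts H))"
    and "analytic_spread (pverts G \<times> pverts H) I \<le> enat (num_edges G * num_edges H)"
proof -
  let ?V = "pverts G \<times> pverts H"
  obtain f :: "nat \<Rightarrow> (nat \<times> nat, 'k) mpoly" and n where f:
    "homogeneous_generators ?V f 2" "f ` {..<n} = edge_binomials G H" "\<And>i. i \<ge> n \<Longrightarrow> f i = 0"
    "n \<le> num_edges G * num_edges H" "homogeneous_generators.J ?V f = binomial_edge_ideal G H"
    by (rule obtain_generators[OF assms(1,2)]; blast)
  interpret homogeneous_generators ?V f 2 by (rule f(1))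
  have "finite ?V"
    using assms(1,2) by (simp add: pair_graph_def pair_digraph_def pair_fin_digraph_def pair_fin_digraph_axioms_def)
  have eq: "analytic_spread ?V I = krull_dim (special_fiber_ring S \<mm> J)"
    by (simp add: analytic_spread_def \<mm>_def I f(5))
  show "analytic_spread ?V I \<le> enat (card (pverts G) * card (pverts H))"
    unfolding eq using krull_dim_le_card_variables[OF \<open>finite ?V\<close>] by (simp add: card_cartesian_product)
  have "analytic_spread ?V I \<le> enat n" unfolding eq using f(3) by (rule krull_dim_le_card_generators)
  also have "\<dots> \<le> enat (num_edges G * num_edges H)" using f(4) by simp
  finally show "analytic_spread ?V I \<le> enat (num_edges G * num_edges H)" .
qed

lemma tops_edge_binomial:
  fixes w :: "nat \<times> nat \<Rightarrow> nat"
  assumes "w (i, k) + w (j, l) > w (i, l) + w (j, k)"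
  defines "T \<equiv> single (i, k) 1 + single (j, l) 1"
  shows "tops (weight w) (weight w T) (edge_binomial i j k l) (single T (1 :: 'k::field))"
proof -
  have b: "edge_binomial i j k l = single T (1 :: 'k) -
      single (single (i, l) 1 + single (j, k) 1) 1"
    by (simp add: edge_binomial_def mvar_def mult_single T_def)
  have "weight w T > weight w (single (i, l) 1 + single (j, k) 1)"
    using assms(1) by (simp add: T_def weight_add)
  then show ?thesis unfolding b tops_def component_diff component_single by auto
qed

text \<open>\<open>t\<close> is the term that \<open>w\<close> selects in some edge binomial. The
  edges are oriented so that the selected term is the one with positive sign.\<close>

definition leading_exponent ::
    "nat pair_pre_digraph \<Rightarrow> nat pair_pre_digraph \<Rightarrow> (nat \<times> nat \<Rightarrow> nat) \<Rightarrow> ((nat \<times> nat) \<Rightarrow>\<^sub>0 nat) \<Rightarrow> bool"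
  where "leading_exponent G H w t \<longleftrightarrow> (\<exists>i j k l. (i, j) \<in> parcs G \<and> (k, l) \<in> parcs H \<and>
    w (i, l) + w (j, k) < w (i, k) + w (j, l) \<and>
    t = single (i, k) 1 + single (j, l) 1)"

lemma leading_exponentI:
  "(i, j) \<in> parcs G \<Longrightarrow> (k, l) \<in> parcs H \<Longrightarrow> w (i, l) + w (j, k) < w (i, k) + w (j, l) \<Longrightarrow>
    leading_exponent G H w (single (i, k) 1 + single (j, l) 1)"
  by (auto simp: leading_exponent_def)

text \<open>A rational relation between exponents, cleared of denominators and split by sign, is an
  equality of two combinations with natural coefficients. The last premise is therefore linear
  independence of the selected exponents.\<close>

lemma analytic_spread_ge:
  fixes I :: "(nat \<times> nat, 'k::field) mpoly set" and w :: "nat \<times> nat \<Rightarrow> nat" and T :: "'e \<Rightarrow> (nat \<times> nat) \<Rightarrow>\<^sub>0 nat"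
  assumes G: "pair_graph G" and H: "pair_graph H" and I: "I = binomial_edge_ideal G H" and E: "finite E"
    and edge: "\<And>e. e \<in> E \<Longrightarrow> leading_exponent G H w (T e)"
    and inj: "\<And>a b e. e \<in> E \<Longrightarrow> (\<And>u. (\<Sum>e\<in>E. a e * lookup (T e) u) =
        (\<Sum>e\<in>E. b e * lookup (T e) u)) \<Longrightarrow> a e = (b e :: nat)"
  shows "enat (card E) \<le> analytic_spread (pverts G \<times> pverts H) I"
proof -
  let ?V = "pverts G \<times> pverts H"
  obtain f :: "nat \<Rightarrow> (nat \<times> nat, 'k) mpoly" and n where f:
    "homogeneous_generators ?V f 2" "f ` {..<n} = edge_binomials G H" "\<And>i. i \<ge> n \<Longrightarrow> f i = 0"
    "n \<le> num_edges G * num_edges H" "homogeneous_generators.J ?V f = binomial_edge_ideal G H"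
    by (rule obtain_generators[OF G H]; blast)
  interpret homogeneous_generators ?V f 2 by (rule f(1))
  have "\<exists>y c. y < n \<and> c \<noteq> 0 \<and> tops (weight w) (weight w (T e)) (f y) (single (T e) c)"
    if e: "e \<in> E" for e
  proof -
    obtain i j k l where *: "(i, j) \<in> parcs G" "(k, l) \<in> parcs H" "w (i, k) + w (j, l) > w (i, l) + w (j, k)"
      "T e = single (i, k) 1 + single (j, l) 1" 
      using edge[OF e] by (auto simp: leading_exponent_def)
    have top: "tops (weight w) (weight w (T e)) (edge_binomial i j k l) (single (T e) (1::'k))"
      unfolding *(4) by (rule tops_edge_binomial[OF *(3)])
    obtain b :: "(nat \<times> nat, 'k) mpoly" where b: "b \<in> edge_binomials G H"
      "edge_binomial i j k l = b \<or> edge_binomial i j k l = - b"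
      using edge_binomial_cases[OF G H *(1,2)] by blast
    obtain y where y: "y < n" "f y = b" using b(1) f(2) by (metis imageE lessThan_iff)
    from b(2) show ?thesis
    proof
      assume "edge_binomial i j k l = b"
      then show ?thesis using top y by (intro exI[of _ y] exI[of _ 1]) auto
    next
      assume "edge_binomial i j k l = - b"
      then have "f y = - edge_binomial i j k l" using y by simp
      then have "tops (weight w) (weight w (T e)) (f y) (single (T e) (-1))"
        using top by (simp add: tops_def component_uminus single_uminus)
      then show ?thesis using y by (intro exI[of _ y] exI[of _ "-1"]) auto
    qed
  qed
  then have "\<forall>e\<in>E. \<exists>y. \<exists>c. y < n \<and> c \<noteq> 0 \<and> tops (weight w) (weight w (T e)) (f y) (single (T e) c)" by blast
  from bchoice[OF this] obtain y where "\<forall>e\<in>E. \<exists>c. y e < n \<and> c \<noteq> 0 \<and>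
    tops (weight w) (weight w (T e)) (f (y e)) (single (T e) c)" ..
  from bchoice[OF this] obtain c where c: "\<forall>e\<in>E. y e < n \<and> c e \<noteq> 0 \<and>
    tops (weight w) (weight w (T e)) (f (y e)) (single (T e) (c e))" ..
  have y_inj: "inj_on y E"
  proof (rule inj_onI, rule ccontr)
    fix e e' assume ee: "e \<in> E" "e' \<in> E" "y e = y e'" "e \<noteq> e'"
    have t: "tops (weight w) (weight w (T e)) (f (y e)) (single (T e) (c e))"
      "tops (weight w) (weight w (T e')) (f (y e)) (single (T e') (c e'))" "c e \<noteq> 0" "c e' \<noteq> 0"
      using c ee by auto
    have "weight w (T e) = weight w (T e')"
    proof (rule ccontr)
      assume "weight w (T e) \<noteq> weight w (T e')"
      then have "single (T e) (c e) = 0 \<or> single (T e') (c e') = 0"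
        using t(1,2) unfolding tops_def by (metis nat_neq_iff)
      then show False using t(3,4) by (metis lookup_single_eq lookup_zero)
    qed
    then have "single (T e) (c e) = single (T e') (c e')"
      using t(1,2) by (simp add: tops_def)
    then have "T e = T e'" using t(3) by (metis lookup_single_eq lookup_single_not_eq)
    \<comment> \<open>If \<open>e\<close> and \<open>e'\<close> shared a generator, they would share
      its selected term; the indicators of \<open>e\<close> and \<open>e'\<close> would then give
      equal combinations, against independence.\<close>
    have "(\<Sum>x\<in>E. (if x = e then 1 else 0) * lookup (T x) u) =
        (\<Sum>x\<in>E. (if x = e' then 1 else 0) * lookup (T x) u)" for u
    proof -
      have "(\<Sum>x\<in>E. (if x = z then 1 else 0) * lookup (T x) u) = lookup (T z) u"
        if "z \<in> E" for z
      proof -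
        have "(\<Sum>x\<in>E. (if x = z then 1 else 0) * lookup (T x) u) =
            (\<Sum>x\<in>E. if x = z then lookup (T x) u else 0)"
          by (intro sum.cong) auto
        then show ?thesis using that E by simp
      qed
      then show ?thesis using ee \<open>T e = T e'\<close> by simp
    qed
    from inj[OF ee(1) this] show False using ee(4) by simp
  qed
  define x where "x = the_inv_into E y"
  have xy: "x (y e) = e" if "e \<in> E" for e using that y_inj by (simp add: x_def the_inv_into_f_f)
  have "eval_poly f p \<noteq> 0" if p: "p \<in> poly_in (y ` E)" "p \<noteq> 0" for p
  proof (rule eval_poly_neq_0I[where h = "weight w" and T = "\<lambda>v. T (x v)" and c = "\<lambda>v. c (x v)"])
    show "c (x v) \<noteq> 0 \<and> tops (weight w) (weight w (T (x v))) (f v) (single (T (x v)) (c (x v)))"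
      if "v \<in> y ` E" for v
      using that c xy by auto
    fix a b v
    assume v: "v \<in> y ` E" and sum: "\<And>u. (\<Sum>v\<in>y ` E. a v * lookup (T (x v)) u) =
        (\<Sum>v\<in>y ` E. b v * lookup (T (x v)) u)"
    then obtain e where e: "e \<in> E" "v = y e" by blast
    have "(\<Sum>e\<in>E. a (y e) * lookup (T e) u) = (\<Sum>e\<in>E. b (y e) * lookup (T e) u)" for u
      using sum[of u] by (simp add: sum.reindex[OF y_inj] xy)
    then show "a v = b v" using inj[OF e(1), of "\<lambda>e. a (y e)" "\<lambda>e. b (y e)"] e(2) by simp
  qed (use p E weight_add in auto)
  then have "enat (card (y ` E)) \<le> krull_dim (special_fiber_ring S \<mm> J)"
    using c by (intro krull_dim_special_fiber_ring_geI[OF f(1,3), where Y = "y ` E"]) auto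
  then show ?thesis by (simp add: analytic_spread_def \<mm>_def I f(5) card_image[OF y_inj])
qed

text \<open>Leading monomials that are the edges of a forest, each named by its lower end \<open>ch e\<close>.\<close>

lemma forest_exponents_inj:
  fixes \<phi> :: "'v \<Rightarrow> nat" and a b :: "'e \<Rightarrow> nat"
  assumes E: "finite E" and ch: "inj_on ch E"
    and \<phi>: "\<And>e. e \<in> E \<Longrightarrow> \<phi> (ch e) < \<phi> (pa e)"
    and T: "\<And>e. e \<in> E \<Longrightarrow> T e = single (ch e) 1 + single (pa e) 1"
    and sum: "\<And>u. (\<Sum>e\<in>E. a e * lookup (T e) u) = (\<Sum>e\<in>E. b e * lookup (T e) u)"
    and "e \<in> E"
  shows "a e = b e"
  using \<open>e \<in> E\<close>
proof (induction "\<phi> (ch e)" arbitrary: e rule: less_induct)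
  case less
  let ?l = "\<lambda>e'. lookup (T e') (ch e)"
  \<comment> \<open>The variable \<open>ch e\<close> occurs only in \<open>e\<close> itself and in
    the edges whose upper end is \<open>ch e\<close>. The lower ends of the latter have smaller
    \<open>\<phi>\<close>, so their coefficients agree by induction.\<close>
  have l: "?l e' = (if e' = e then 1 else 0) + (if pa e' = ch e then 1 else 0)" if "e' \<in> E" for e'
    using T[OF that] inj_onD[OF ch, of e' e] that less.prems
    by (auto simp: lookup_add lookup_single when_def)
  have "pa e \<noteq> ch e" using \<phi>[OF less.prems] by auto
  then have le: "?l e = 1" using l[OF less.prems] by simp
  have "a e' * ?l e' = b e' * ?l e'" if "e' \<in> E - {e}" for e'
  proof (cases "pa e' = ch e")
    case True
    then have "\<phi> (ch e') < \<phi> (ch e)" using \<phi>[of e'] that by auto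
    then show ?thesis using less.hyps[of e'] that by simp
  next
    case False
    then show ?thesis using l[of e'] that by simp
  qed
  then have "(\<Sum>e'\<in>E - {e}. a e' * ?l e') = (\<Sum>e'\<in>E - {e}. b e' * ?l e')" by (intro sum.cong) auto
  moreover have "(\<Sum>e'\<in>E. c e' * ?l e') = c e + (\<Sum>e'\<in>E - {e}. c e' * ?l e')" for c
    using E less.prems le by (simp add: sum.remove[of E e])
  ultimately show ?case using sum[of "ch e"] by simp
qed

section \<open>Spanning forests and unicycle graphs\<close>

text \<open>A shortest path from \<open>u\<close> to \<open>v\<close> that avoids the edge between
  them, closed by this edge, has no chord: a chord would shorten the path.\<close>

lemma rtrancl_avoiding_induced_cycle:
  assumes sym: "sym E" and irrefl: "irrefl E" and uv: "(u, v) \<in> E"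
    and conn: "(u, v) \<in> (E - {(u, v), (v, u)})\<^sup>*"
  obtains vs where "distinct vs" "length vs \<ge> 3" "u \<in> set vs" "v \<in> set vs"
    "\<And>i j. i < length vs \<Longrightarrow> j < length vs \<Longrightarrow> (vs ! i, vs ! j) \<in> E \<longleftrightarrow>
      j = Suc i mod length vs \<or> i = Suc j mod length vs"
proof -
  define r where "r = E - {(u, v), (v, u)}"
  have "\<exists>k. (u, v) \<in> r ^^ k" using conn unfolding r_def by (simp add: rtrancl_power)
  define k where "k = (LEAST k. (u, v) \<in> r ^^ k)"
  have k: "(u, v) \<in> r ^^ k" unfolding k_def using \<open>\<exists>k. _\<close> by (rule LeastI_ex)
  have kmin: "k \<le> l" if "(u, v) \<in> r ^^ l" for l unfolding k_def using that by (rule Least_le)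
  obtain p where p: "p 0 = u" "p k = v" "\<And>i. i < k \<Longrightarrow> (p i, p (Suc i)) \<in> r"
    using k by (auto simp: relpow_fun_conv)
  have path: "(p i, p (i + l)) \<in> r ^^ l" if "i + l \<le> k" for i l
    unfolding relpow_fun_conv using that p(3) by (intro exI[of _ "\<lambda>j. p (i + j)"]) auto
  \<comment> \<open>Replacing the stretch from \<open>p i\<close> to \<open>p j\<close> by a walk of
    length \<open>l\<close> cannot give a path shorter than \<open>k\<close>. The case
    \<open>l = 0\<close> makes the vertices distinct, the case \<open>l = 1\<close> excludes
    chords.\<close>
  have short: "j \<le> i + l" if "i \<le> j" "j \<le> k" "(p i, p j) \<in> r ^^ l" for i j l
  proof -
    have "(u, p i) \<in> r ^^ i" using path[of 0 i] that p by simp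
    moreover have "(p j, v) \<in> r ^^ (k - j)" using path[of j "k - j"] that p by simp
    ultimately have "(u, v) \<in> r ^^ (i + l + (k - j))"
      using that(3) by (auto simp: relpow_add)
    then show ?thesis using kmin that by fastforce
  qed
  have inj: "i = j" if "i \<le> k" "j \<le> k" "p i = p j" for i j
    using that short[of i j 0] short[of j i 0] by (cases i j rule: linorder_cases) auto
  have "u \<noteq> v" using uv irrefl by (auto simp: irrefl_def)
  have k2: "k \<ge> 2"
  proof (rule ccontr)
    assume "\<not> k \<ge> 2"
    then consider "k = 0" | "k = 1" by linarith
    then show False
    proof cases
      case 1
      then show ?thesis using p \<open>u \<noteq> v\<close> by simp
    next
      case 2
      then show ?thesis using p(3)[of 0] p(1,2) by (simp add: r_def)
    qed
  qed
  define vs where "vs = map p [0..<Suc k]"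
  have len: "length vs = Suc k" by (simp add: vs_def)
  have nth: "vs ! i = p i" if "i \<le> k" for i using that by (simp add: vs_def del: upt_Suc)
  have adj: "(p i, p j) \<in> E \<longleftrightarrow> j = Suc i \<or> (i = 0 \<and> j = k)" if "i < j" "j \<le> k" for i j
  proof
    assume E: "(p i, p j) \<in> E"
    show "j = Suc i \<or> (i = 0 \<and> j = k)"
    proof (cases "(p i, p j) \<in> r")
      case True
      then show ?thesis using short[of i j 1] that by auto
    next
      case False
      then have "(p i = u \<and> p j = v) \<or> (p i = v \<and> p j = u)" using E by (auto simp: r_def)
      then show ?thesis using inj[of i 0] inj[of j k] inj[of i k] inj[of j 0] p that by auto
    qed
  next
    assume "j = Suc i \<or> (i = 0 \<and> j = k)"
    then show "(p i, p j) \<in> E" using p uv that by (auto simp: r_def)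
  qed
  have sym': "(a, b) \<in> E \<longleftrightarrow> (b, a) \<in> E" for a b using sym by (auto dest: symD)
  show ?thesis
  proof (rule that[of vs])
    show "distinct vs" unfolding vs_def distinct_map using inj by (auto simp del: upt_Suc intro!: inj_onI)
    show "length vs \<ge> 3" using len k2 by simp
    show "u \<in> set vs" using nth[of 0] p len by (metis le0 nth_mem zero_less_Suc)
    show "v \<in> set vs" using nth[of k] p len by (metis le_refl lessI nth_mem)
    fix i j assume "i < length vs" "j < length vs"
    then have ij: "i \<le> k" "j \<le> k" using len by auto
    have S: "Suc i mod Suc k = (if i = k then 0 else Suc i)" if "i \<le> k" for i using that by auto
    show "(vs ! i, vs ! j) \<in> E \<longleftrightarrow> j = Suc i mod length vs \<or> i = Suc j mod length vs"
      unfolding len nth[OF ij(1)] nth[OF ij(2)] S[OF ij(1)] S[OF ij(2)]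
    proof (cases i j rule: linorder_cases)
      case less
      then show "(p i, p j) \<in> E \<longleftrightarrow> j = (if i = k then 0 else Suc i) \<or> i = (if j = k then 0 else Suc j)"
        using adj[OF less ij(2)] ij by auto
    next
      case equal
      then show "(p i, p j) \<in> E \<longleftrightarrow> j = (if i = k then 0 else Suc i) \<or> i = (if j = k then 0 else Suc j)"
        using irrefl k2 by (auto simp: irrefl_def)
    next
      case greater
      then show "(p i, p j) \<in> E \<longleftrightarrow> j = (if i = k then 0 else Suc i) \<or> i = (if j = k then 0 else Suc j)"
        using adj[OF greater ij(1)] sym'[of "p i" "p j"] ij by auto
    qed
  qed
qed

text \<open>Breadth-first search: \<open>dep\<close> is the distance from \<open>R\<close>, and
  \<open>par\<close> picks a neighbour that is one step closer.\<close>

lemma obtain_parent_function: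
  assumes sym: "sym E" and reach: "\<And>v. v \<in> V \<Longrightarrow> \<exists>r\<in>R. (r, v) \<in> E\<^sup>*"
  obtains par :: "'a \<Rightarrow> 'a" and dep :: "'a \<Rightarrow> nat"
  where "\<And>v. v \<in> R \<Longrightarrow> dep v = 0"
    "\<And>v. v \<in> V - R \<Longrightarrow> (v, par v) \<in> E \<and> dep v = Suc (dep (par v))"
proof -
  define dep where "dep v = (LEAST k. \<exists>r\<in>R. (r, v) \<in> E ^^ k)" for v
  have dep0: "dep v = 0" if "v \<in> R" for v
    unfolding dep_def using that by (intro Least_equality) auto
  have ex: "\<exists>w. (v, w) \<in> E \<and> dep v = Suc (dep w)" if v: "v \<in> V - R" for v
  proof -
    have "\<exists>k. \<exists>r\<in>R. (r, v) \<in> E ^^ k" using reach[of v] v by (auto simp: rtrancl_power)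
    then obtain r where r: "r \<in> R" "(r, v) \<in> E ^^ dep v" unfolding dep_def using LeastI_ex[of "\<lambda>k. \<exists>r\<in>R. (r, v) \<in> E ^^ k"] by blast
    have "dep v \<noteq> 0"
    proof
      assume "dep v = 0"
      then show False using r v by simp
    qed
    then obtain k where k: "dep v = Suc k" by (cases "dep v") auto
    then obtain w where w: "(r, w) \<in> E ^^ k" "(w, v) \<in> E" using r by auto
    have "dep w \<le> k" unfolding dep_def by (rule Least_le) (use w r in blast)
    moreover have "k \<le> dep w"
    proof -
      have "\<exists>k. \<exists>r\<in>R. (r, w) \<in> E ^^ k" using w r by blast
      then obtain r' where "r' \<in> R" "(r', w) \<in> E ^^ dep w"
        unfolding dep_def using LeastI_ex[of "\<lambda>k. \<exists>r\<in>R. (r, w) \<in> E ^^ k"] by blast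
      then have "dep v \<le> Suc (dep w)"
        unfolding dep_def[of v] using w by (intro Least_le) (auto intro!: bexI[of _ r'])
      then show ?thesis using k by simp
    qed
    ultimately show ?thesis using k w sym by (auto dest: symD)
  qed
  then have "\<forall>v\<in>V - R. \<exists>w. (v, w) \<in> E \<and> dep v = Suc (dep w)" by blast
  from bchoice[OF this] obtain par where "\<forall>v\<in>V - R. (v, par v) \<in> E \<and> dep v = Suc (dep (par v))" ..
  then show ?thesis using that[of dep par] dep0 by blast
qed

lemma parent_path_to_root:
  assumes par: "\<And>v. v \<in> V - R \<Longrightarrow> (v, par v) \<in> E \<and> dep v = Suc (dep (par v))" and E: "E \<subseteq> V \<times> V" and "v \<in> V"
  shows "\<exists>r\<in>R. (v, r) \<in> {(v, par v) |v. v \<in> V - R}\<^sup>*"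
  using \<open>v \<in> V\<close>
proof (induction "dep v" arbitrary: v rule: less_induct)
  case less
  show ?case
  proof (cases "v \<in> R")
    case False
    then have v: "v \<in> V - R" using less.prems by simp
    then obtain r where "r \<in> R" "(par v, r) \<in> {(v, par v) |v. v \<in> V - R}\<^sup>*"
      using less.hyps[of "par v"] par[OF v] E by auto
    moreover have "(v, par v) \<in> {(v, par v) |v. v \<in> V - R}" using v by blast
    ultimately show ?thesis by (meson converse_rtrancl_into_rtrancl)
  qed auto
qed

context pair_graph
begin

lemma sym_parcs: "sym (parcs G)"
  using pair_sym_arcs by (simp add: symmetric_def)

lemma irrefl_parcs: "irrefl (parcs G)"
  using pair_no_loops by (force simp: irrefl_def)

lemma parcs_subset: "parcs G \<subseteq> pverts G \<times> pverts G"
  using in_arcsD1 in_arcsD2 by auto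

lemma reachable_iff_rtrancl:
  "u \<rightarrow>\<^sup>*\<^bsub>with_proj G\<^esub> v \<longleftrightarrow> u \<in> pverts G \<and> (u, v) \<in> (parcs G)\<^sup>*"
proof
  assume "u \<rightarrow>\<^sup>*\<^bsub>with_proj G\<^esub> v"
  then show "u \<in> pverts G \<and> (u, v) \<in> (parcs G)\<^sup>*"
    using reachable_rtranclI[of "with_proj G" u v] reachable_in_verts(1)[of u v] by simp
next
  assume *: "u \<in> pverts G \<and> (u, v) \<in> (parcs G)\<^sup>*"
  then have "(u, v) \<in> (parcs G)\<^sup>*" by simp
  then show "u \<rightarrow>\<^sup>*\<^bsub>with_proj G\<^esub> v"
  proof (induction rule: rtrancl_induct)
    case base
    then show ?case using * by auto
  next
    case (step y z)
    then show ?case using reachable_adj_trans[of u y z] by simp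
  qed
qed

lemma in_pverts_rtrancl: "(u, v) \<in> (parcs G)\<^sup>* \<Longrightarrow> u \<in> pverts G \<Longrightarrow> v \<in> pverts G"
  by (induction rule: rtrancl_induct) (use parcs_subset in auto)

text \<open>Arcs are symmetric, so mutual reachability is plain reachability.\<close>

lemma sccs_verts_eq: "sccs_verts = (\<lambda>u. (parcs G)\<^sup>* `` {u}) ` pverts G"
proof -
  have sym: "(v, u) \<in> (parcs G)\<^sup>*" if "(u, v) \<in> (parcs G)\<^sup>*" for u v
    using that sym_rtrancl[OF sym_parcs] by (auto dest: symD)
  show ?thesis
  proof (intro equalityI subsetI)
    fix S assume "S \<in> sccs_verts"
    then have S: "S \<noteq> {}" "\<forall>u\<in>S. \<forall>v\<in>S. u \<rightarrow>\<^sup>*\<^bsub>with_proj G\<^esub> v"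
      "\<forall>u\<in>S. \<forall>v. v \<notin> S \<longrightarrow> \<not> u \<rightarrow>\<^sup>*\<^bsub>with_proj G\<^esub> v \<or> \<not> v \<rightarrow>\<^sup>*\<^bsub>with_proj G\<^esub> u"
      by (auto simp: sccs_verts_def)
    then obtain u where u: "u \<in> S" by blast
    have uV: "u \<in> pverts G" using S(2) u by (auto simp: reachable_iff_rtrancl)
    have "S = (parcs G)\<^sup>* `` {u}"
    proof (intro equalityI subsetI)
      fix v assume "v \<in> S"
      then show "v \<in> (parcs G)\<^sup>* `` {u}" using S(2) u by (auto simp: reachable_iff_rtrancl)
    next
      fix v assume v: "v \<in> (parcs G)\<^sup>* `` {u}"
      then have "v \<in> pverts G" using in_pverts_rtrancl uV by auto
      then show "v \<in> S" using v S(3) u uV sym by (auto simp: reachable_iff_rtrancl)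
    qed
    then show "S \<in> (\<lambda>u. (parcs G)\<^sup>* `` {u}) ` pverts G" using uV by blast
  next
    fix S assume "S \<in> (\<lambda>u. (parcs G)\<^sup>* `` {u}) ` pverts G"
    then obtain u where u: "u \<in> pverts G" "S = (parcs G)\<^sup>* `` {u}" by blast
    have "(a, b) \<in> (parcs G)\<^sup>*" if "a \<in> S" "b \<in> S" for a b
      using rtrancl_trans[OF sym[of u a], of b] that u by simp
    moreover have "b \<in> S" if "a \<in> S" "(a, b) \<in> (parcs G)\<^sup>*" for a b
      using rtrancl_trans[of u a _ b] that u by simp
    moreover have "a \<in> pverts G" if "a \<in> S" for a using that u in_pverts_rtrancl by auto
    moreover have "S \<noteq> {}" using u by auto
    ultimately show "S \<in> sccs_verts" unfolding sccs_verts_def reachable_iff_rtrancl by blast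
  qed
qed

text \<open>\<open>R\<close> contains one vertex of each component. Components are induced
  subgraphs, hence determined by their vertex sets, and may be counted as reachability
  classes.\<close>

lemma obtain_roots:
  obtains R where "R \<subseteq> pverts G" "card R = num_components G"
    "\<And>v. v \<in> pverts G \<Longrightarrow> \<exists>r\<in>R. (r, v) \<in> (parcs G)\<^sup>*"
    "\<And>r s. r \<in> R \<Longrightarrow> s \<in> R \<Longrightarrow> (r, s) \<in> (parcs G)\<^sup>* \<Longrightarrow> r = s"
proof -
  define cl where "cl u = (parcs G)\<^sup>* `` {u}" for u
  have sym: "(v, u) \<in> (parcs G)\<^sup>*" if "(u, v) \<in> (parcs G)\<^sup>*" for u v
    using that sym_rtrancl[OF sym_parcs] by (auto dest: symD)
  obtain R where R: "R \<subseteq> pverts G" "inj_on cl R" "cl ` pverts G = cl ` R"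
    using subset_image_inj[of "cl ` pverts G" cl "pverts G"] by auto
  have "num_components G = card (verts ` sccs)"
  proof -
    have "inj_on verts sccs"
    proof (rule inj_onI)
      fix H K assume "H \<in> sccs" "K \<in> sccs" "verts H = verts K"
      have "induced_subgraph H (with_proj G)" "induced_subgraph K (with_proj G)"
        using \<open>H \<in> sccs\<close> \<open>K \<in> sccs\<close> unfolding sccs_def by blast+
      then show "H = K" using \<open>verts H = verts K\<close> induce_eq_iff_induced by metis
    qed
    then show ?thesis by (simp add: num_components_def card_image)
  qed
  also have "\<dots> = card (cl ` R)" using sccs_verts_eq sccs_verts_conv R(3) by (simp add: cl_def)
  also have "\<dots> = card R" using R(2) by (rule card_image)
  finally have "card R = num_components G" by simp
  moreover have "\<exists>r\<in>R. (r, v) \<in> (parcs G)\<^sup>*" if "v \<in> pverts G" for v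
  proof -
    have "cl v \<in> cl ` R" using R(3) that by blast
    then obtain r where "r \<in> R" "cl v = cl r" by blast
    moreover have "v \<in> cl v" by (simp add: cl_def)
    ultimately show ?thesis by (auto simp: cl_def)
  qed
  moreover have "r = s" if "r \<in> R" "s \<in> R" "(r, s) \<in> (parcs G)\<^sup>*" for r s
  proof -
    have "cl r = cl s" using that(3) sym by (auto simp: cl_def intro: rtrancl_trans)
    then show ?thesis using R(2) that by (auto dest: inj_onD)
  qed
  ultimately show ?thesis using that R(1) by blast
qed

end

context pair_graph
begin

lemma is_cycle_graph_induced:
  assumes vs: "distinct vs" "length vs \<ge> 3" "set vs \<subseteq> pverts G"
    and adj: "\<And>i j. i < length vs \<Longrightarrow> j < length vs \<Longrightarrow> (vs ! i, vs ! j) \<in> parcs G \<longleftrightarrow>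
      j = Suc i mod length vs \<or> i = Suc j mod length vs"
  shows "is_cycle_graph (with_proj G \<restriction> set vs)"
  unfolding is_cycle_graph_def
proof (intro exI[of _ vs] conjI)
  let ?n = "length vs"
  have n: "?n > 0" using vs by linarith
  show "arcs_ends (with_proj G \<restriction> set vs) =
      (\<Union>i<?n. {(vs ! i, vs ! (Suc i mod ?n)), (vs ! (Suc i mod ?n), vs ! i)})"
  proof -
    have "(a, b) \<in> arcs_ends (with_proj G \<restriction> set vs) \<longleftrightarrow> (a, b) \<in> parcs G \<and> a \<in> set vs \<and> b \<in> set vs" for a b
      by (force simp: arcs_ends_def arc_to_ends_def induce_subgraph_def)
    moreover have "(a, b) \<in> parcs G \<and> a \<in> set vs \<and> b \<in> set vs \<longleftrightarrow>
      (a, b) \<in> (\<Union>i<?n. {(vs ! i, vs ! (Suc i mod ?n)), (vs ! (Suc i mod ?n), vs ! i)})" for a b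
    proof
      assume "(a, b) \<in> parcs G \<and> a \<in> set vs \<and> b \<in> set vs"
      then obtain i j where "a = vs ! i" "b = vs ! j" "i < ?n" "j < ?n" "(a, b) \<in> parcs G"
        by (auto simp: in_set_conv_nth)
      then show "(a, b) \<in> (\<Union>i<?n. {(vs ! i, vs ! (Suc i mod ?n)), (vs ! (Suc i mod ?n), vs ! i)})"
        using adj[of i j] by auto
    next
      assume "(a, b) \<in> (\<Union>i<?n. {(vs ! i, vs ! (Suc i mod ?n)), (vs ! (Suc i mod ?n), vs ! i)})"
      then obtain i where i: "i < ?n" "(a = vs ! i \<and> b = vs ! (Suc i mod ?n)) \<or> (a = vs ! (Suc i mod ?n) \<and> b = vs ! i)"
        by auto
      have "Suc i mod ?n < ?n" using n by simp
      then show "(a, b) \<in> parcs G \<and> a \<in> set vs \<and> b \<in> set vs"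
        using i adj[of i "Suc i mod ?n"] adj[of "Suc i mod ?n" i] by auto
    qed
    ultimately show ?thesis by auto
  qed
qed (use vs in auto)

lemma induced_subgraph_restrict: "S \<subseteq> pverts G \<Longrightarrow> induced_subgraph (with_proj G \<restriction> S) (with_proj G)"
  by (rule induced_induce) simp

text \<open>The parent paths from the two ends of an edge that is not a parent edge avoid that edge
  and end in roots of one component, that is, in the same root. So the edge would lie on a
  cycle.\<close>

lemma forest_edges:
  assumes forest: "is_forest (with_proj G)"
    and R: "R \<subseteq> pverts G" "\<And>r s. r \<in> R \<Longrightarrow> s \<in> R \<Longrightarrow> (r, s) \<in> (parcs G)\<^sup>* \<Longrightarrow> r = s"
    and par: "\<And>v. v \<in> pverts G - R \<Longrightarrow> (v, par v) \<in> parcs G \<and> dep v = Suc (dep (par v))"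
    and uv: "(u, v) \<in> parcs G"
  shows "(u \<in> pverts G - R \<and> v = par u) \<or> (v \<in> pverts G - R \<and> u = par v)"
proof (rule ccontr)
  assume not: "\<not> ?thesis"
  let ?E = "parcs G" and ?V = "pverts G"
  let ?P = "{(v, par v) |v. v \<in> ?V - R}"
  let ?r = "?E - {(u, v), (v, u)}"
  have V: "u \<in> ?V" "v \<in> ?V" using uv in_arcsD1 in_arcsD2 by auto
  have "?P \<subseteq> ?r" using not par by auto
  then have mono: "?P\<^sup>* \<subseteq> ?r\<^sup>*" by (rule rtrancl_mono)
  have "?r\<^sup>* \<subseteq> ?E\<^sup>*" by (intro rtrancl_mono) auto
  obtain a where a: "a \<in> R" "(u, a) \<in> ?P\<^sup>*"
    using parent_path_to_root[OF par parcs_subset V(1)] ..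
  obtain b where b: "b \<in> R" "(v, b) \<in> ?P\<^sup>*"
    using parent_path_to_root[OF par parcs_subset V(2)] ..
  note ab = a(1) subsetD[OF mono a(2)] b(1) subsetD[OF mono b(2)]
  have "sym ?r" using sym_parcs unfolding sym_def by blast
  then have sym: "sym (?E\<^sup>*)" "sym (?r\<^sup>*)" using sym_parcs by (simp_all only: sym_rtrancl)
  have "(a, b) \<in> ?E\<^sup>*"
  proof -
    have "(a, u) \<in> ?E\<^sup>*" "(v, b) \<in> ?E\<^sup>*" using ab \<open>?r\<^sup>* \<subseteq> ?E\<^sup>*\<close> sym(1) by (auto dest: symD)
    then show ?thesis using uv by (meson rtrancl.rtrancl_into_rtrancl rtrancl_trans)
  qed
  then have "a = b" using R(2) ab by blast
  then have "(u, v) \<in> ?r\<^sup>*" using ab sym(2) by (meson rtrancl_trans symD)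
  then obtain vs where vs: "distinct vs" "length vs \<ge> 3" "u \<in> set vs" "v \<in> set vs"
    "\<And>i j. i < length vs \<Longrightarrow> j < length vs \<Longrightarrow> (vs ! i, vs ! j) \<in> ?E \<longleftrightarrow>
      j = Suc i mod length vs \<or> i = Suc j mod length vs"
    using rtrancl_avoiding_induced_cycle[OF sym_parcs irrefl_parcs uv] by metis
  \<comment> \<open>The cycle is connected and so lies in a single component, which is where the
    hypothesis on trees applies.\<close>
  have reach: "(vs ! 0, vs ! i) \<in> ?E\<^sup>*" if "i < length vs" for i
    using that
  proof (induction i)
    case (Suc i)
    then have "(vs ! i, vs ! Suc i) \<in> ?E" using vs(5)[of i "Suc i"] by auto
    then show ?case using Suc by (meson Suc_lessD rtrancl.rtrancl_into_rtrancl)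
  qed auto
  define w where "w = vs ! 0"
  have "length vs > 0" using vs(2) by linarith
  have "(w, vs ! 1) \<in> ?E" unfolding w_def using vs(5)[of 0 1] vs(2) by force
  then have wV: "w \<in> ?V" by (rule in_arcsD1)
  let ?S = "?E\<^sup>* `` {w}"
  have sub: "set vs \<subseteq> ?S" using reach by (auto simp: in_set_conv_nth w_def)
  have SV: "?S \<subseteq> ?V" using in_pverts_rtrancl wV by auto
  have "?S \<in> sccs_verts" using sccs_verts_eq wV by auto
  then have "with_proj G \<restriction> ?S \<in> sccs" by (rule in_verts_sccsD_sccs)
  then have "is_tree (with_proj G \<restriction> ?S)" using forest by (simp add: is_forest_def)
  moreover have "subgraph (with_proj G \<restriction> set vs) (with_proj G \<restriction> ?S)"
  proof -
    have "wf_digraph (with_proj G \<restriction> set vs)" "wf_digraph (with_proj G \<restriction> ?S)"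
      using induced_subgraph_restrict[of "set vs"] induced_subgraph_restrict[of ?S] sub SV
      by (auto simp: induced_subgraph_def subgraph_def)
    then show ?thesis using sub by (auto simp: subgraph_def compatible_def induce_subgraph_def)
  qed
  moreover have "is_cycle_graph (with_proj G \<restriction> set vs)"
    using vs(1,2,5) sub SV by (intro is_cycle_graph_induced) auto
  ultimately show False by (auto simp: is_tree_def)
qed

text \<open>The parent edges span every component. In a forest there are no others, which bounds the
  number of edges by the number of vertices that are not roots.\<close>

lemma obtain_spanning_forest:
  obtains R par dep where "R \<subseteq> pverts G" "card R = num_components G"
    "\<And>v. v \<in> pverts G - R \<Longrightarrow> (v, par v) \<in> parcs G \<and> dep v = Suc (dep (par v))"
    "is_forest (with_proj G) \<Longrightarrow> num_edges G \<le> card (pverts G) - num_components G"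
proof -
  obtain R where R: "R \<subseteq> pverts G" "card R = num_components G"
    "\<And>v. v \<in> pverts G \<Longrightarrow> \<exists>r\<in>R. (r, v) \<in> (parcs G)\<^sup>*"
    "\<And>r s. r \<in> R \<Longrightarrow> s \<in> R \<Longrightarrow> (r, s) \<in> (parcs G)\<^sup>* \<Longrightarrow> r = s"
    by (rule obtain_roots; blast)
  obtain par dep where par: "\<And>v. v \<in> pverts G - R \<Longrightarrow> (v, par v) \<in> parcs G \<and> dep v = Suc (dep (par v))"
    using obtain_parent_function[OF sym_parcs R(3)] by metis
  have "num_edges G \<le> card (pverts G) - num_components G" if forest: "is_forest (with_proj G)"
  proof -
    have "{{u, v} |u v. (u, v) \<in> parcs G} \<subseteq> (\<lambda>v. {v, par v}) ` (pverts G - R)"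
      using forest_edges[OF forest R(1,4) par] by blast
    then have "num_edges G \<le> card (pverts G - R)"
      unfolding num_edges_def by (rule surj_card_le[rotated]) (simp add: pair_finite_verts)
    then show ?thesis using R(1,2) by (simp add: card_Diff_subset finite_subset[OF R(1) pair_finite_verts])
  qed
  then show ?thesis using that R(1,2) par by blast
qed

lemma connected_rtrancl:
  assumes "Digraph_Component.connected (with_proj G)" "u \<in> pverts G" "v \<in> pverts G"
  shows "(u, v) \<in> (parcs G)\<^sup>*"
proof -
  have "u \<rightarrow>\<^sup>*\<^bsub>with_proj (mk_symmetric (with_proj G))\<^esub> v"
    using assms by (auto simp: connected_def strongly_connected_def)
  then have "u \<rightarrow>\<^sup>*\<^bsub>with_proj G\<^esub> v"
    using reachable_mk_symmetric_eq[of u v] pair_sym_arcs by simp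
  then show ?thesis by (simp add: reachable_iff_rtrancl)
qed

text \<open>The search starts from all vertices of the cycle at once. An edge that is neither a
  parent edge nor on the cycle would close another induced cycle, since its ends are also joined
  through parent paths and the cycle.\<close>

lemma obtain_unicycle_structure:
  assumes uni: "is_unicycle (with_proj G)"
  obtains cs par dep where "distinct cs" "length cs \<ge> 3" "set cs \<subseteq> pverts G"
    "\<And>v. v \<in> set cs \<Longrightarrow> dep v = 0"
    "\<And>v. v \<in> pverts G - set cs \<Longrightarrow> (v, par v) \<in> parcs G \<and> dep v = Suc (dep (par v))"
    "\<And>i. i < length cs \<Longrightarrow> (cs ! i, cs ! (Suc i mod length cs)) \<in> parcs G"
    "\<And>u v. (u, v) \<in> parcs G \<Longrightarrow> (u \<in> pverts G - set cs \<and> v = par u) \<or> (v \<in> pverts G - set cs \<and> u = par v) \<or>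
      (\<exists>i<length cs. {u, v} = {cs ! i, cs ! (Suc i mod length cs)})"
proof -
  let ?E = "parcs G" and ?V = "pverts G"
  have conn: "Digraph_Component.connected (with_proj G)" using uni by (simp add: is_unicycle_def)
  obtain C where C: "induced_subgraph C (with_proj G)" "is_cycle_graph C"
    and uniq: "\<And>C'. induced_subgraph C' (with_proj G) \<Longrightarrow> is_cycle_graph C' \<Longrightarrow> C' = C"
    using uni unfolding is_unicycle_def by blast
  obtain cs where cs: "length cs \<ge> 3" "distinct cs" "verts C = set cs"
    "arcs_ends C = (\<Union>i<length cs. {(cs ! i, cs ! (Suc i mod length cs)), (cs ! (Suc i mod length cs), cs ! i)})"
    using C(2) unfolding is_cycle_graph_def by blast
  let ?n = "length cs"
  have n: "?n > 0" using cs(1) by linarith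
  have csV: "set cs \<subseteq> ?V" using C(1) cs(3) by (auto simp: induced_subgraph_def subgraph_def)
  have "C = with_proj G \<restriction> set cs" using induce_eq_iff_induced[OF C(1)] cs(3) by simp
  then have cyc: "(a, b) \<in> ?E \<longleftrightarrow> (\<exists>i<?n. (a = cs ! i \<and> b = cs ! (Suc i mod ?n)) \<or> (b = cs ! i \<and> a = cs ! (Suc i mod ?n)))"
    if "a \<in> set cs" "b \<in> set cs" for a b
  proof -
    have "(a, b) \<in> arcs_ends C \<longleftrightarrow> (a, b) \<in> ?E"
      using that unfolding \<open>C = _\<close> by (force simp: arcs_ends_def arc_to_ends_def induce_subgraph_def)
    then show ?thesis unfolding cs(4) by auto
  qed
  have next_mem: "cs ! (Suc i mod ?n) \<in> set cs" for i using n by simp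
  have cycE: "(cs ! i, cs ! (Suc i mod ?n)) \<in> ?E" if "i < ?n" for i
    using cyc[OF nth_mem[OF that] next_mem] that by blast
  have "\<exists>r\<in>set cs. (r, v) \<in> ?E\<^sup>*" if "v \<in> ?V" for v
    using connected_rtrancl[OF conn, of "cs ! 0" v] csV n that nth_mem[of 0 cs] by blast
  then obtain par dep where dep: "\<And>v. v \<in> set cs \<Longrightarrow> dep v = 0"
    and par: "\<And>v. v \<in> ?V - set cs \<Longrightarrow> (v, par v) \<in> ?E \<and> dep v = Suc (dep (par v))"
    using obtain_parent_function[OF sym_parcs, of ?V "set cs"] by metis
  have edges: "(u \<in> ?V - set cs \<and> v = par u) \<or> (v \<in> ?V - set cs \<and> u = par v) \<or>
      (\<exists>i<?n. {u, v} = {cs ! i, cs ! (Suc i mod ?n)})" if uv: "(u, v) \<in> ?E" for u v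
  proof (rule ccontr)
    assume not: "\<not> ?thesis"
    let ?P = "{(v, par v) |v. v \<in> ?V - set cs}"
    let ?r = "?E - {(u, v), (v, u)}"
    have V: "u \<in> ?V" "v \<in> ?V" using uv in_arcsD1 in_arcsD2 by auto
    have "?P \<subseteq> ?r" using not par by auto
    then have mono: "?P\<^sup>* \<subseteq> ?r\<^sup>*" by (rule rtrancl_mono)
    obtain a where a: "a \<in> set cs" "(u, a) \<in> ?P\<^sup>*"
      using parent_path_to_root[OF par parcs_subset V(1)] ..
    obtain b where b: "b \<in> set cs" "(v, b) \<in> ?P\<^sup>*"
      using parent_path_to_root[OF par parcs_subset V(2)] ..
    note ab = a(1) subsetD[OF mono a(2)] b(1) subsetD[OF mono b(2)]
    have "sym ?r" using sym_parcs unfolding sym_def by blast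
    then have sym: "sym (?r\<^sup>*)" by (rule sym_rtrancl)
    have cr: "(cs ! i, cs ! (Suc i mod ?n)) \<in> ?r" if "i < ?n" for i
      using not cycE[OF that] that by (auto simp: doubleton_eq_iff)
    have from0: "(cs ! 0, cs ! i) \<in> ?r\<^sup>*" if "i < ?n" for i
      using that
    proof (induction i)
      case (Suc i)
      then have "(cs ! i, cs ! Suc i) \<in> ?r" using cr[of i] by simp
      then show ?case using Suc by (meson Suc_lessD rtrancl.rtrancl_into_rtrancl)
    qed auto
    then have "(cs ! 0, a) \<in> ?r\<^sup>*" "(cs ! 0, b) \<in> ?r\<^sup>*" using ab by (auto simp: in_set_conv_nth)
    then have "(u, v) \<in> ?r\<^sup>*" using ab(2,4) sym by (meson rtrancl_trans symD)
    then obtain vs where vs: "distinct vs" "length vs \<ge> 3" "u \<in> set vs" "v \<in> set vs"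
      "\<And>i j. i < length vs \<Longrightarrow> j < length vs \<Longrightarrow> (vs ! i, vs ! j) \<in> ?E \<longleftrightarrow>
        j = Suc i mod length vs \<or> i = Suc j mod length vs"
      using rtrancl_avoiding_induced_cycle[OF sym_parcs irrefl_parcs uv] by metis
    have vsV: "set vs \<subseteq> ?V"
    proof
      fix x assume "x \<in> set vs"
      then obtain i where "i < length vs" "x = vs ! i" by (auto simp: in_set_conv_nth)
      moreover have "Suc i mod length vs < length vs" using vs(2) by (intro mod_less_divisor) linarith
      ultimately have "(x, vs ! (Suc i mod length vs)) \<in> ?E" using vs(5) by simp
      then show "x \<in> ?V" by (rule in_arcsD1)
    qed
    \<comment> \<open>By uniqueness the new cycle has the vertices of \<open>C\<close>. Both ends of
      the edge then lie on \<open>C\<close>, which is induced, so the edge belongs to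
      \<open>C\<close> after all.\<close>
    have "with_proj G \<restriction> set vs = C"
      using vs(1,2,5) vsV by (intro uniq induced_subgraph_restrict is_cycle_graph_induced) auto
    then have "set vs = set cs" using cs(3) by (metis induce_subgraph_verts)
    then have "u \<in> set cs" "v \<in> set cs" using vs(3,4) by auto
    then show False using not cyc[of u v] uv by blast
  qed
  show ?thesis using that[OF cs(2,1) csV dep par cycE edges] .
qed

text \<open>Each vertex off the cycle is matched with its parent edge, each vertex on the cycle with
  the edge to its successor. Two vertices off the cycle cannot share an edge, for each would be the
  parent of the other, against the depths.\<close>

lemma num_edges_unicycle:
  assumes cs: "distinct cs" "length cs \<ge> 3" "set cs \<subseteq> pverts G"
    and par: "\<And>v. v \<in> pverts G - set cs \<Longrightarrow> (v, par v) \<in> parcs G \<and> dep v = Suc (dep (par v))"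
    and cyc: "\<And>i. i < length cs \<Longrightarrow> (cs ! i, cs ! (Suc i mod length cs)) \<in> parcs G"
    and edges: "\<And>u v. (u, v) \<in> parcs G \<Longrightarrow> (u \<in> pverts G - set cs \<and> v = par u) \<or> (v \<in> pverts G - set cs \<and> u = par v) \<or>
      (\<exists>i<length cs. {u, v} = {cs ! i, cs ! (Suc i mod length cs)})"
  shows "num_edges G = card (pverts G)"
proof -
  let ?n = "length cs" and ?V = "pverts G"
  let ?A = "(\<lambda>v. {v, par v}) ` (?V - set cs)" and ?B = "(\<lambda>i. {cs ! i, cs ! (Suc i mod ?n)}) ` {..<?n}"
  have n: "?n > 0" using cs(2) by linarith
  have "{{u, v} |u v. (u, v) \<in> parcs G} = ?A \<union> ?B"
  proof (intro equalityI subsetI)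
    fix e assume "e \<in> {{u, v} |u v. (u, v) \<in> parcs G}"
    then obtain u v where "e = {u, v}" "(u, v) \<in> parcs G" by blast
    then show "e \<in> ?A \<union> ?B" using edges[of u v] by auto
  next
    fix e assume "e \<in> ?A \<union> ?B"
    then show "e \<in> {{u, v} |u v. (u, v) \<in> parcs G}" using par cyc by blast
  qed
  moreover have "card (?A \<union> ?B) = card ?A + card ?B"
  proof (rule card_Un_disjoint)
    have "e \<inter> (?V - set cs) \<noteq> {}" if "e \<in> ?A" for e using that by auto
    moreover have "e \<subseteq> set cs" if "e \<in> ?B" for e using that n by auto
    ultimately show "?A \<inter> ?B = {}" by blast
  qed (simp_all add: pair_finite_verts)
  moreover have "card ?A = card (?V - set cs)"
  proof (rule card_image, rule inj_onI, rule ccontr)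
    fix v w assume *: "v \<in> ?V - set cs" "w \<in> ?V - set cs" "{v, par v} = {w, par w}" "v \<noteq> w"
    then have "v = par w" "w = par v" by (auto simp: doubleton_eq_iff)
    moreover have "dep v = Suc (dep (par v))" "dep w = Suc (dep (par w))" using par[OF *(1)] par[OF *(2)] by auto
    ultimately have "dep v = Suc (Suc (dep v))" by metis
    then show False by simp
  qed
  moreover have "card ?B = ?n"
  proof -
    have "inj_on (\<lambda>i. {cs ! i, cs ! (Suc i mod ?n)}) {..<?n}"
    proof (rule inj_onI, rule ccontr)
      fix i j assume *: "i \<in> {..<?n}" "j \<in> {..<?n}" "{cs ! i, cs ! (Suc i mod ?n)} = {cs ! j, cs ! (Suc j mod ?n)}" "i \<noteq> j"
      have eq: "cs ! a = cs ! b \<longleftrightarrow> a = b" if "a < ?n" "b < ?n" for a b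
        using cs(1) that by (simp add: nth_eq_iff_index_eq)
      have "i = Suc j mod ?n" "j = Suc i mod ?n"
        using * n by (auto simp: doubleton_eq_iff eq)
      \<comment> \<open>Two positions sharing an edge would be each other's successor, so the length
        would divide 2.\<close>
      then have "i = Suc (Suc i) mod ?n" by (metis mod_Suc_eq)
      then show False using *(1) cs(2) by (auto simp: mod_Suc split: if_splits)
    qed
    then show ?thesis by (simp add: card_image)
  qed
  moreover have "card (?V - set cs) = card ?V - ?n" "?n \<le> card ?V"
    using cs(1,3) card_mono[OF pair_finite_verts cs(3)] by (simp_all add: card_Diff_subset distinct_card)
  ultimately show ?thesis by (simp add: num_edges_def)
qed

lemma obtain_path:
  assumes "is_path_graph (with_proj G)"
  obtains ps where "distinct ps" "set ps = pverts G" "length ps = card (pverts G)"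
    "\<And>i. Suc i < length ps \<Longrightarrow> (ps ! i, ps ! Suc i) \<in> parcs G" "num_edges G = card (pverts G) - 1"
proof -
  obtain ps where ps: "ps \<noteq> []" "distinct ps" "pverts G = set ps"
    "parcs G = (\<Union>i\<in>{i. Suc i < length ps}. {(ps ! i, ps ! Suc i), (ps ! Suc i, ps ! i)})"
    using assms by (auto simp: is_path_graph_def)
  have len: "length ps = card (pverts G)" using ps by (simp add: distinct_card)
  have "{{u, v} |u v. (u, v) \<in> parcs G} = (\<lambda>i. {ps ! i, ps ! Suc i}) ` {..<length ps - 1}" (is "?l = ?r")
  proof (intro equalityI subsetI)
    fix e assume "e \<in> ?l"
    then obtain u v where "e = {u, v}" "(u, v) \<in> parcs G" by blast
    then show "e \<in> ?r" unfolding ps(4) by (auto simp: insert_commute less_diff_conv)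
  next
    fix e assume "e \<in> ?r"
    then show "e \<in> ?l" unfolding ps(4) by (fastforce simp: less_diff_conv)
  qed
  moreover have "inj_on (\<lambda>i. {ps ! i, ps ! Suc i}) {..<length ps - 1}"
    using ps(2) by (auto intro!: inj_onI simp: doubleton_eq_iff nth_eq_iff_index_eq less_diff_conv)
  ultimately have "num_edges G = length ps - 1" by (simp add: num_edges_def card_image)
  then show ?thesis using that[of ps] ps len by auto
qed

end

section \<open>Analytic spread\<close>

text \<open>Each pair \<open>(i, k)\<close> of non-roots names the binomial of the two parent edges.
  With the product of depths as weight the terms differ by exactly 1, and the selected one joins
  \<open>(i, k)\<close> to \<open>(p i, p' k)\<close>. Following these links increases the distance
  from no variable to itself: the first depth drops at each link, so they form a forest.\<close>

lemma analytic_spread_ge_forest: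
  fixes I :: "(nat \<times> nat, 'k::field) mpoly set"
  assumes G: "pair_graph G" and H: "pair_graph H" and I: "I = binomial_edge_ideal G H"
  shows "enat ((card (pverts G) - num_components G) * (card (pverts H) - num_components H))
    \<le> analytic_spread (pverts G \<times> pverts H) I"
proof -
  interpret G: pair_graph G by fact
  interpret H: pair_graph H by fact
  obtain R p d where R: "R \<subseteq> pverts G" "card R = num_components G"
    and p: "\<And>v. v \<in> pverts G - R \<Longrightarrow> (v, p v) \<in> parcs G \<and> d v = Suc (d (p v))"
    using G.obtain_spanning_forest by metis
  obtain R' p' d' where R': "R' \<subseteq> pverts H" "card R' = num_components H"
    and p': "\<And>v. v \<in> pverts H - R' \<Longrightarrow> (v, p' v) \<in> parcs H \<and> d' v = Suc (d' (p' v))"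
    using H.obtain_spanning_forest by metis
  define E where "E = (pverts G - R) \<times> (pverts H - R')"
  define w where "w = (\<lambda>(i, k). d i * d' k)"
  define pa where "pa = (\<lambda>(i, k). (p i, p' k))"
  define T where "T e = single e 1 + single (pa e) (1::nat)" for e
  define M where "M = Max (d ` pverts G)"
  \<comment> \<open>Subtracting from the largest depth \<open>M\<close> turns falling depth into a
    growing natural number.\<close>
  define \<phi> where "\<phi> = (\<lambda>(i, k::nat). M - d i)"
  have E: "finite E" by (simp add: E_def G.pair_finite_verts H.pair_finite_verts)
  have "enat (card E) \<le> analytic_spread (pverts G \<times> pverts H) I"
  proof (rule analytic_spread_ge[OF G H I E, of w T])
    fix e assume "e \<in> E"
    then obtain i k where e: "e = (i, k)" "i \<in> pverts G - R" "k \<in> pverts H - R'" by (auto simp: E_def)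
    show "leading_exponent G H w (T e)"
      using leading_exponentI[of i "p i" G k "p' k" H w] p[OF e(2)] p'[OF e(3)]
      by (simp add: e(1) w_def T_def pa_def)
  next
    fix a b :: "nat \<times> nat \<Rightarrow> nat" and e
    assume e: "e \<in> E" and sum: "\<And>u. (\<Sum>e\<in>E. a e * lookup (T e) u) = (\<Sum>e\<in>E. b e * lookup (T e) u)"
    show "a e = b e"
    proof (rule forest_exponents_inj[where ch = id and pa = pa and \<phi> = \<phi>, OF E _ _ _ sum e])
      fix e assume "e \<in> E"
      then obtain i k where e: "e = (i, k)" "i \<in> pverts G - R" "k \<in> pverts H - R'" by (auto simp: E_def)
      have "d i \<le> M" using e(2) G.pair_finite_verts by (auto simp: M_def)
      then show "\<phi> (id e) < \<phi> (pa e)" using p[OF e(2)] by (auto simp: e(1) \<phi>_def pa_def)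
    qed (auto simp: T_def)
  qed
  moreover have "card E = (card (pverts G) - num_components G) * (card (pverts H) - num_components H)"
    using R R' by (simp add: E_def card_cartesian_product card_Diff_subset
        finite_subset[OF R(1) G.pair_finite_verts] finite_subset[OF R'(1) H.pair_finite_verts])
  ultimately show ?thesis by simp
qed

text \<open>For forests the number of generators does not exceed the lower bound.\<close>

lemma analytic_spread_forest:
  fixes I :: "(nat \<times> nat, 'k::field) mpoly set"
  assumes G: "pair_graph G" and H: "pair_graph H" and I: "I = binomial_edge_ideal G H"
    and "is_forest (with_proj G)" "is_forest (with_proj H)"
  shows "analytic_spread (pverts G \<times> pverts H) I =
    enat ((card (pverts G) - num_components G) * (card (pverts H) - num_components H))"
proof (rule antisym[OF _ analytic_spread_ge_forest[OF G H I]])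
  interpret G: pair_graph G by fact
  interpret H: pair_graph H by fact
  have "num_edges G \<le> card (pverts G) - num_components G" "num_edges H \<le> card (pverts H) - num_components H"
    using G.obtain_spanning_forest H.obtain_spanning_forest assms(4,5) by metis+
  then have "enat (num_edges G * num_edges H) \<le>
      enat ((card (pverts G) - num_components G) * (card (pverts H) - num_components H))"
    by (simp add: mult_le_mono)
  then show "analytic_spread (pverts G \<times> pverts H) I \<le>
      enat ((card (pverts G) - num_components G) * (card (pverts H) - num_components H))"
    using analytic_spread_le(2)[OF G H I] by (rule order_trans[rotated])
qed

text \<open>On the diagonal entries 1, 2, 3 the leading monomials form a triangle, whose incidence matrix is
  invertible over the rationals; every other entry is pendant to one of them.\<close>

lemma analytic_spread_complete:
  fixes I :: "(nat \<times> nat, 'k::field) mpoly set"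
  assumes G: "pair_graph G" and H: "pair_graph H" and I: "I = binomial_edge_ideal G H"
    and V: "pverts G = {1..n}" "pverts H = {1..m}" "n \<ge> 3" "m \<ge> 3"
    and cG: "parcs G = {(u, v). u \<in> {1..n} \<and> v \<in> {1..n} \<and> u \<noteq> v}"
    and cH: "parcs H = {(u, v). u \<in> {1..m} \<and> v \<in> {1..m} \<and> u \<noteq> v}"
  shows "enat (n * m) \<le> analytic_spread (pverts G \<times> pverts H) I"
proof -
  define E where "E = {1..n} \<times> {1..m}"
  define D :: "(nat \<times> nat) set" where "D = {(1, 1), (2, 2), (3, 3)}"
  \<comment> \<open>For \<open>x\<close> different from \<open>i\<close> and \<open>k\<close>, the
    entries \<open>(x, k)\<close> and \<open>(i, x)\<close> are off the diagonal. So this weight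
    selects the product of the variables at \<open>(x, x)\<close> and \<open>(i, k)\<close> whenever
    \<open>x\<close> is 1, 2 or 3.\<close>
  define w where "w e = (if e \<in> D then 1 else 0 :: nat)" for e
  \<comment> \<open>\<open>c e\<close> is a value among 1, 2, 3 that differs from both coordinates
    of \<open>e\<close>; three values suffice to avoid two.\<close>
  define c :: "nat \<times> nat \<Rightarrow> nat" where "c = (\<lambda>(i, k). if i \<noteq> 1 \<and> k \<noteq> 1 then 1 else if i \<noteq> 2 \<and> k \<noteq> 2 then 2 else 3)"
  define T where "T e = (if e = (1, 1) then single (2, 2) 1 + single (3, 3) 1
    else if e = (2, 2) then single (1, 1) 1 + single (3, 3) 1
    else if e = (3, 3) then single (1, 1) 1 + single (2, 2) 1
    else single (c e, c e) 1 + single e (1::nat))" for e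
  have E: "finite E" by (simp add: E_def)
  have DE: "D \<subseteq> E" using V by (auto simp: D_def E_def)
  have c: "c (i, k) \<noteq> i" "c (i, k) \<noteq> k" "c (i, k) \<in> {1, 2, 3}" for i k by (auto simp: c_def)
  have "enat (card E) \<le> analytic_spread (pverts G \<times> pverts H) I"
  proof (rule analytic_spread_ge[OF G H I E, of w T])
    fix e assume "e \<in> E"
    then obtain i k where e: "e = (i, k)" "i \<in> {1..n}" "k \<in> {1..m}" by (auto simp: E_def)
    have lead: "leading_exponent G H w (T e)"
      if "T e = single (x, x) 1 + single (i, k) 1"
        "x \<in> {1, 2, 3}" "x \<noteq> i" "x \<noteq> k" "i \<in> {1..n}" "k \<in> {1..m}" for x i k
    proof -
      have "w (x, k) = 0" "w (i, x) = 0" "w (x, x) = 1" using that(2-4) by (auto simp: w_def D_def)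
      moreover have "(x, i) \<in> parcs G" "(x, k) \<in> parcs H" using that V(3,4) by (auto simp: cG cH)
      ultimately show ?thesis
        unfolding that(1) by (intro leading_exponentI) simp_all
    qed
    consider "e = (1, 1)" | "e = (2, 2)" | "e = (3, 3)" | "e \<notin> D" by (auto simp: D_def)
    then show "leading_exponent G H w (T e)"
    proof cases
      case 1
      then show ?thesis using lead[of 2 3 3] V(3,4) by (simp add: T_def)
    next
      case 2
      then show ?thesis using lead[of 1 3 3] V(3,4) by (simp add: T_def)
    next
      case 3
      then show ?thesis using lead[of 1 2 2] V(3,4) by (simp add: T_def)
    next
      case 4
      then have "T e = single (c e, c e) 1 + single (i, k) 1"
        using e(1) by (auto simp: T_def D_def)
      then show ?thesis using lead[of "c e" i k] c[of i k] e by simp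
    qed
  next
    fix a b :: "nat \<times> nat \<Rightarrow> nat" and e
    assume e: "e \<in> E" and sum: "\<And>u. (\<Sum>e\<in>E. a e * lookup (T e) u) = (\<Sum>e\<in>E. b e * lookup (T e) u)"
    \<comment> \<open>A variable outside \<open>D\<close> occurs in one selected term only, the one
      it names.\<close>
    have off: "a v = b v" if v: "v \<in> E - D" for v
    proof -
      have l: "lookup (T e) v = (if e = v then 1 else 0)" for e
      proof (cases "e \<in> D")
        case True
        then consider "e = (1, 1)" | "e = (2, 2)" | "e = (3, 3)" by (auto simp: D_def)
        moreover have "(1, 1) \<noteq> v" "(2, 2) \<noteq> v" "(3, 3) \<noteq> v" using v DE by (auto simp: D_def)
        ultimately have "lookup (T e) v = 0"
          by cases (simp_all add: T_def lookup_add lookup_single_not_eq)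
        then show ?thesis using True v by auto
      next
        case False
        then have "T e = single (c e, c e) 1 + single e 1" by (auto simp: T_def D_def)
        moreover have "(c e, c e) \<in> D" by (cases e) (auto simp: c_def D_def)
        then have "(c e, c e) \<noteq> v" using v by blast
        ultimately show ?thesis by (simp add: lookup_add lookup_single when_def)
      qed
      have "(\<Sum>e\<in>E. f e * lookup (T e) v) = f v" for f :: "nat \<times> nat \<Rightarrow> nat"
      proof -
        have "(\<Sum>e\<in>E. f e * lookup (T e) v) = (\<Sum>e\<in>E. if e = v then f e else 0)"
          by (intro sum.cong) (auto simp: l)
        then show ?thesis using v E by simp
      qed
      then show ?thesis using sum[of v] by simp
    qed
    have diag: "(\<Sum>e\<in>D. a e * lookup (T e) u) = (\<Sum>e\<in>D. b e * lookup (T e) u)" for u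
    proof -
      have "(\<Sum>e\<in>E. f e * lookup (T e) u) =
          (\<Sum>e\<in>E - D. f e * lookup (T e) u) + (\<Sum>e\<in>D. f e * lookup (T e) u)" for f
        by (rule sum.subset_diff[OF DE E])
      moreover have "(\<Sum>e\<in>E - D. a e * lookup (T e) u) = (\<Sum>e\<in>E - D. b e * lookup (T e) u)"
        by (intro sum.cong) (auto simp: off)
      ultimately show ?thesis using sum[of u] by simp
    qed
    \<comment> \<open>The three pairwise sums determine the three coefficients because the triangle
      is an odd cycle.\<close>
    have "a (2, 2) + a (3, 3) = b (2, 2) + b (3, 3)" "a (1, 1) + a (3, 3) = b (1, 1) + b (3, 3)"
      "a (1, 1) + a (2, 2) = b (1, 1) + b (2, 2)"
      using diag[of "(1, 1)"] diag[of "(2, 2)"] diag[of "(3, 3)"]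
      by (simp_all add: D_def T_def lookup_add lookup_single)
    then have "a (1, 1) = b (1, 1)" "a (2, 2) = b (2, 2)" "a (3, 3) = b (3, 3)" by linarith+
    then show "a e = b e" using off[of e] e by (auto simp: D_def)
  qed
  then show ?thesis by (simp add: E_def card_cartesian_product)
qed

text \<open>\<open>H\<close> is labelled so that labels grow along the trees towards the cycle and then along the cycle
  \<open>c\<^sub>0, \<dots>, c\<^bsub>L-1\<^esub>\<close>; the closing edge \<open>{c\<^sub>0, c\<^bsub>L-1\<^esub>}\<close> is the only one whose leading monomial has
  its lower end in the next row.\<close>

lemma analytic_spread_ge_path_unicycle:
  fixes I :: "(nat \<times> nat, 'k::field) mpoly set"
  assumes G: "pair_graph G" and H: "pair_graph H" and I: "I = binomial_edge_ideal G H"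
    and ps: "distinct ps" "\<And>i. Suc i < length ps \<Longrightarrow> (ps ! i, ps ! Suc i) \<in> parcs G"
    and cs: "distinct cs" "length cs \<ge> 3" "set cs \<subseteq> pverts H"
      "\<And>v. v \<in> set cs \<Longrightarrow> dep v = 0"
      "\<And>v. v \<in> pverts H - set cs \<Longrightarrow> (v, par v) \<in> parcs H \<and> dep v = Suc (dep (par v))"
      "\<And>i. i < length cs \<Longrightarrow> (cs ! i, cs ! (Suc i mod length cs)) \<in> parcs H"
  shows "enat ((length ps - 1) * card (pverts H)) \<le> analytic_spread (pverts G \<times> pverts H) I"
proof -
  interpret G: pair_graph G by fact
  interpret H: pair_graph H by fact
  define L where "L = length cs"
  define pos where "pos = the_inv_into {..<length ps} ((!) ps)"
  define idx where "idx = the_inv_into {..<L} ((!) cs)"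
  have pos: "pos (ps ! i) = i" if "i < length ps" for i
    unfolding pos_def using ps(1) that by (intro the_inv_into_f_f) (auto intro!: inj_onI simp: nth_eq_iff_index_eq)
  have idx: "idx (cs ! k) = k" if "k < L" for k
    unfolding idx_def using cs(1) that
    by (intro the_inv_into_f_f) (auto intro!: inj_onI simp: nth_eq_iff_index_eq L_def)
  have L: "L \<ge> 3" using cs(2) by (simp add: L_def)
  define last where "last = cs ! (L - 1)"
  define M where "M = Max (dep ` pverts H)"
  have M: "dep v \<le> M" if "v \<in> pverts H" for v using that H.pair_finite_verts by (auto simp: M_def)
  \<comment> \<open>Off the cycle the label is below \<open>M\<close> and grows as the depth falls;
    on the cycle it starts at \<open>M\<close> and grows with the position.\<close>
  define h where "h v = (if v \<in> set cs then M + idx v else M - dep v)" for v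
  define w where "w = (\<lambda>(x, v). pos x * h v)"
  define up where "up v = (if v \<in> set cs then cs ! (Suc (idx v) mod L) else par v)" for v
  \<comment> \<open>The edge closing the cycle in rows \<open>i\<close> and \<open>i + 1\<close> has
    its larger label at \<open>last\<close>, so the selected term contains \<open>last\<close> in
    the later row. Naming it by that variable keeps \<open>ch\<close> injective: other vertices name
    terms in row \<open>i\<close>, \<open>last\<close> in row \<open>i + 1\<close>.\<close>
  define ch where "ch = (\<lambda>(i, v). if v = last then (ps ! Suc i, v) else (ps ! i, v))"
  define pa where "pa = (\<lambda>(i, v). if v = last then (ps ! i, cs ! 0) else (ps ! Suc i, up v))"
  define T where "T e = single (ch e) 1 + single (pa e) (1::nat)" for e
  \<comment> \<open>A step to the next row gains \<open>L\<close>, while a step along the cycle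
    loses \<open>L - 1\<close>, which leaves a net gain of 1. The closing edge goes back one row and
    loses \<open>L\<close>, but returning from position \<open>L - 1\<close> to 0 gains
    \<open>(L - 1) * (L - 1)\<close>, which exceeds \<open>L\<close> because
    \<open>L \<ge> 3\<close>.\<close>
  define \<phi> where "\<phi> = (\<lambda>(x, v). L * pos x + (if v \<in> set cs then (L - 1 - idx v) * (L - 1) else 0))"
  define E where "E = {..<length ps - 1} \<times> pverts H"
  have E: "finite E" by (simp add: E_def H.pair_finite_verts)
  have last: "last \<in> set cs" "idx last = L - 1" using L idx[of "L - 1"] by (auto simp: last_def L_def)
  have cs0: "cs ! 0 \<in> set cs" "idx (cs ! 0) = 0" using L idx[of 0] by (force simp: L_def intro!: nth_mem)+
  have cyc: "\<exists>k. v = cs ! k \<and> k < L - 1 \<and> idx v = k \<and> up v = cs ! Suc k \<and> cs ! Suc k \<in> set cs \<and> idx (cs ! Suc k) = Suc k"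
    if v: "v \<in> set cs" "v \<noteq> last" for v
  proof -
    obtain k where k: "v = cs ! k" "k < L" using v by (auto simp: in_set_conv_nth L_def)
    then have "k \<noteq> L - 1" using v(2) by (auto simp: last_def)
    then have "Suc k < L" using k by simp
    then show ?thesis
      using k v(1) idx[of k] idx[of "Suc k"] by (intro exI[of _ k]) (auto simp: up_def L_def)
  qed
  have "enat (card E) \<le> analytic_spread (pverts G \<times> pverts H) I"
  proof (rule analytic_spread_ge[OF G H I E, of w T])
    fix e assume "e \<in> E"
    then obtain i v where e: "e = (i, v)" "Suc i < length ps" "v \<in> pverts H" by (auto simp: E_def)
    have lead: "leading_exponent G H w (T e)"
      if "(x, y) \<in> parcs H" "h x < h y" "T e = single (ps ! i, x) 1 + single (ps ! Suc i, y) 1" for x y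
      unfolding that(3) using that(1,2) ps(2)[OF e(2)] e(2)
      by (intro leading_exponentI) (auto simp: w_def pos)
    show "leading_exponent G H w (T e)"
    proof (cases "v = last")
      case True
      have "Suc (L - 1) mod L = 0" using L by simp
      then have "(last, cs ! 0) \<in> parcs H" using cs(6)[of "L - 1"] L by (simp add: last_def L_def)
      then have "(cs ! 0, last) \<in> parcs H" using H.sym_parcs by (auto dest: symD)
      moreover have "h (cs ! 0) < h last" using last cs0 L by (simp add: h_def)
      ultimately show ?thesis
        using True by (intro lead[of "cs ! 0" last]) (auto simp: T_def ch_def pa_def e(1) add.commute)
    next
      case False
      have "(v, up v) \<in> parcs H \<and> h v < h (up v)"
      proof (cases "v \<in> set cs")
        case True
        then obtain k where k: "v = cs ! k" "k < L - 1" "idx v = k" "up v = cs ! Suc k" "cs ! Suc k \<in> set cs" "idx (cs ! Suc k) = Suc k"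
          using cyc False by blast
        then show ?thesis using cs(6)[of k] True by (auto simp: h_def L_def)
      next
        case False
        then have p: "(v, par v) \<in> parcs H" "dep v = Suc (dep (par v))" using cs(5)[of v] e(3) by auto
        then show ?thesis using False M[OF e(3)] by (auto simp: up_def h_def)
      qed
      then show ?thesis
        using False by (intro lead[of v "up v"]) (auto simp: T_def ch_def pa_def e(1))
    qed
  next
    fix a b :: "nat \<times> nat \<Rightarrow> nat" and e
    assume e: "e \<in> E" and sum: "\<And>u. (\<Sum>e\<in>E. a e * lookup (T e) u) = (\<Sum>e\<in>E. b e * lookup (T e) u)"
    show "a e = b e"
    proof (rule forest_exponents_inj[where ch = ch and pa = pa and \<phi> = \<phi>, OF E _ _ _ sum e])
      show "inj_on ch E"
        using ps(1) by (auto intro!: inj_onI simp: ch_def E_def nth_eq_iff_index_eq less_diff_conv split: if_splits)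
      fix e assume "e \<in> E"
      then obtain i v where e: "e = (i, v)" "Suc i < length ps" "v \<in> pverts H" by (auto simp: E_def)
      show "\<phi> (ch e) < \<phi> (pa e)"
      proof (cases "v = last")
        case True
        have "L = Suc (Suc (Suc (L - 3)))" using L by simp
        then obtain l where l: "L = Suc (Suc (Suc l))" by blast
        have "L < (L - 1) * (L - 1)" by (simp add: l algebra_simps)
        then show ?thesis using True last cs0 e(2) by (simp add: e(1) ch_def pa_def \<phi>_def pos algebra_simps)
      next
        case False
        show ?thesis
        proof (cases "v \<in> set cs")
          case True
          then obtain k where k: "k < L - 1" "idx v = k" "up v = cs ! Suc k" "cs ! Suc k \<in> set cs" "idx (cs ! Suc k) = Suc k"
            using cyc False by blast
          have "L - 1 - k = Suc (L - 1 - Suc k)" using k(1) by simp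
          then have "(L - 1 - k) * (L - 1) = (L - 1) + (L - 1 - Suc k) * (L - 1)" by simp
          moreover have "\<phi> (ch e) = L * i + (L - 1 - k) * (L - 1)"
            using k False True e(2) by (simp add: e(1) ch_def \<phi>_def pos)
          moreover have "\<phi> (pa e) = L * i + L + (L - 1 - Suc k) * (L - 1)"
            using k False e(2) by (simp add: e(1) pa_def \<phi>_def pos)
          ultimately show ?thesis using L by linarith
        next
          case False
          then have "v \<noteq> last" using last by auto
          then show ?thesis using False e(2) L by (simp add: e(1) ch_def pa_def \<phi>_def pos)
        qed
      qed
    qed (auto simp: T_def)
  qed
  then show ?thesis by (simp add: E_def card_cartesian_product)
qed

theorem theorem1p6:
  fixes n m :: nat
    and G H :: "nat pair_pre_digraph"
    and J :: "(nat \<times> nat, 'f::field) mpoly set"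
  assumes "n \<ge> 3" and "m \<ge> 3"
    and "pair_graph G" and "pverts G = {1..n}" and "no_isolated_vertices G"
    and "pair_graph H" and "pverts H = {1..m}" and "no_isolated_vertices H"
    and J: "J = binomial_edge_ideal G H"
  shows
    "(enat ((n - num_components G) * (m - num_components H)) \<le> analytic_spread ({1..n} \<times> {1..m}) J \<and>
      analytic_spread ({1..n} \<times> {1..m}) J \<le> enat (m * n) \<and>
      (is_forest (with_proj G) \<and> is_forest (with_proj H) \<longrightarrow>
        analytic_spread ({1..n} \<times> {1..m}) J = enat ((n - num_components G) * (m - num_components H))) \<and>
      (complete_digraph n (with_proj G) \<and> complete_digraph m (with_proj H) \<longrightarrow>
        analytic_spread ({1..n} \<times> {1..m}) J = enat (m * n))) \<and>
     (is_path_graph (with_proj G) \<and> is_unicycle (with_proj H) \<longrightarrow>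
        analytic_spread ({1..n} \<times> {1..m}) J = enat ((n - 1) * m) \<and>
        (n - 1) * m = num_edges G * num_edges H)"
proof -
  note G = \<open>pair_graph G\<close> and H = \<open>pair_graph H\<close>
  interpret G: pair_graph G by fact
  interpret H: pair_graph H by fact
  have cards: "card (pverts G) = n" "card (pverts H) = m" using assms by auto
  have lower: "enat ((n - num_components G) * (m - num_components H)) \<le> analytic_spread ({1..n} \<times> {1..m}) J"
    using analytic_spread_ge_forest[OF G H J] assms(4,7) by simp
  have upper: "analytic_spread ({1..n} \<times> {1..m}) J \<le> enat (m * n)"
    using analytic_spread_le(1)[OF G H J] assms(4,7) by (simp add: mult.commute)
  have forest: "analytic_spread ({1..n} \<times> {1..m}) J = enat ((n - num_components G) * (m - num_components H))"
    if "is_forest (with_proj G)" "is_forest (with_proj H)"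
    using analytic_spread_forest[OF G H J that] assms(4,7) by simp
  have complete: "analytic_spread ({1..n} \<times> {1..m}) J = enat (m * n)"
    if "complete_digraph n (with_proj G)" "complete_digraph m (with_proj H)"
  proof -
    have "parcs G = {(u, v). u \<in> {1..n} \<and> v \<in> {1..n} \<and> u \<noteq> v}"
      "parcs H = {(u, v). u \<in> {1..m} \<and> v \<in> {1..m} \<and> u \<noteq> v}"
      using that assms(4,7) by (auto simp: complete_digraph_def)
    then have "enat (n * m) \<le> analytic_spread ({1..n} \<times> {1..m}) J"
      using analytic_spread_complete[OF G H J assms(4,7,1,2)] assms(4,7) by simp
    then show ?thesis using upper by (intro antisym) (simp_all add: mult.commute)
  qed
  have "analytic_spread ({1..n} \<times> {1..m}) J = enat ((n - 1) * m) \<and> (n - 1) * m = num_edges G * num_edges H"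
    if path: "is_path_graph (with_proj G)" and uni: "is_unicycle (with_proj H)"
  proof -
    obtain ps where ps: "distinct ps" "length ps = card (pverts G)"
      "\<And>i. Suc i < length ps \<Longrightarrow> (ps ! i, ps ! Suc i) \<in> parcs G" "num_edges G = card (pverts G) - 1"
      by (rule G.obtain_path[OF path]; blast)
    obtain cs par dep where cs: "distinct cs" "length cs \<ge> 3" "set cs \<subseteq> pverts H"
      "\<And>v. v \<in> set cs \<Longrightarrow> dep v = 0"
      "\<And>v. v \<in> pverts H - set cs \<Longrightarrow> (v, par v) \<in> parcs H \<and> dep v = Suc (dep (par v))"
      "\<And>i. i < length cs \<Longrightarrow> (cs ! i, cs ! (Suc i mod length cs)) \<in> parcs H"
      "\<And>u v. (u, v) \<in> parcs H \<Longrightarrow> (u \<in> pverts H - set cs \<and> v = par u) \<or> (v \<in> pverts H - set cs \<and> u = par v) \<or>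
        (\<exists>i<length cs. {u, v} = {cs ! i, cs ! (Suc i mod length cs)})"
      by (rule H.obtain_unicycle_structure[OF uni]; rule that; assumption)
    have edges: "num_edges H = card (pverts H)" by (rule H.num_edges_unicycle[OF cs(1,2,3,5,6,7)])
    then have "(n - 1) * m = num_edges G * num_edges H" using ps(4) cards by simp
    moreover have "enat ((n - 1) * m) \<le> analytic_spread ({1..n} \<times> {1..m}) J"
      using analytic_spread_ge_path_unicycle[OF G H J ps(1,3) cs(1-6)] assms(4,7) cards ps(2) by simp
    moreover have "analytic_spread ({1..n} \<times> {1..m}) J \<le> enat (num_edges G * num_edges H)"
      using analytic_spread_le(2)[OF G H J] assms(4,7) by simp
    ultimately show ?thesis by (auto intro: antisym)
  qed
  then show ?thesis using lower upper forest complete by blast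
qed

end
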